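(* Let $\Omega\subset\mathbb{R}^n$ ($n\ge 2$) be a bounded domain, and let $u=(u^1,\dots,u^n)\in C^2(\Omega;\mathbb{R}^n)\cap C^1(\overline{\Omega};\mathbb{R}^n)$ be a classical solution of the system $$C^{kl}_{ij}\,u^j_{kl}+f_i(u)=0\quad\text{in }\Omega,\qquad i=1,\dots,n,$$ subject to the homogeneous Dirichlet boundary condition $u=0$ on $\partial\Omega$, where $f_i=\partial F/\partial u^i$ and $F(0)=0$. Then $$\int_{\Omega}\left[\frac{n-2}{2}\,u^k f_k(u)-nF(u)\right]dx=-\frac12\int_{\partial\Omega}C^{kl}_{ij}\,u^i_k\,u^j_l\,(x,\nu)\,ds,$$ where $\nu$ is the outward unit normal to $\partial\Omega$ and $(\cdot,\cdot)$ is the Euclidean scalar product in $\mathbb{R}^n$.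
   Context: Summation over repeated indices, running from $1$ to $n$, is understood. Subscripts on $u$ denote partial derivatives: $u^k_i=\partial u^k/\partial x_i$, $u^k_{ij}=\partial^2u^k/\partial x_i\partial x_j$. The boundary $\partial\Omega$ is (piecewise) smooth, so $\nu$ is defined almost everywhere on it with respect to surface measure $ds$. The elastic moduli $C^{kl}_{ij}$ ($i,j,k,l\in\{1,\dots,n\}$) are real constants with the symmetries $C^{kl}_{ij}=C^{il}_{kj}=C^{kj}_{il}=C^{lk}_{ji}$ and satisfying $C^{kl}_{ij}a^i_ka^j_l\ge 0$ for every real matrix $(a^p_q)$. The body-force potential $F:\mathbb{R}^n\to\mathbb{R}$ is a (sufficiently smooth, at least $C^1$) function of $u$ with $F(0)=0$. *)

theory Defs
  imports "HOL-Analysis.Analysis"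
begin

section \<open>Partial derivatives and classical smoothness classes\<close>

definition partial :: "'n::finite \<Rightarrow> (real ^ 'n \<Rightarrow> real) \<Rightarrow> real ^ 'n \<Rightarrow> real" where
  "partial i f x = deriv (\<lambda>t. f (x + t *\<^sub>R axis i 1)) 0"

text \<open>The classes below are meant for open sets \<open>S\<close>; continuous first partial derivatives make
  \<open>f\<close> itself differentiable, hence continuous, on \<open>S\<close>.\<close>

definition C1_on :: "(real ^ 'n::finite) set \<Rightarrow> (real ^ 'n \<Rightarrow> real) \<Rightarrow> bool" where
  "C1_on S f \<longleftrightarrow> (\<forall>i. (\<forall>x\<in>S. (\<lambda>t. f (x + t *\<^sub>R axis i 1)) differentiable (at 0)) \<and>
      continuous_on S (partial i f))"

definition C2_on :: "(real ^ 'n::finite) set \<Rightarrow> (real ^ 'n \<Rightarrow> real) \<Rightarrow> bool" where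
  "C2_on S f \<longleftrightarrow> C1_on S f \<and> (\<forall>i. C1_on S (partial i f))"

text \<open>\<open>C\<^sup>1\<close> up to the boundary: \<open>f\<close> is continuous on the closure, and its first partial
  derivatives extend continuously from \<open>S\<close> to the closure. The values of these extensions are
  given by \<open>partial_ext\<close>; on the open set \<open>S\<close> itself it agrees with \<open>partial\<close>.\<close>

definition C1_closure :: "(real ^ 'n::finite) set \<Rightarrow> (real ^ 'n \<Rightarrow> real) \<Rightarrow> bool" where
  "C1_closure S f \<longleftrightarrow> C1_on S f \<and> continuous_on (closure S) f \<and>
      (\<forall>i. \<exists>g. continuous_on (closure S) g \<and> (\<forall>x\<in>S. g x = partial i f x))"

definition partial_ext ::
    "(real ^ 'n::finite) set \<Rightarrow> 'n \<Rightarrow> (real ^ 'n \<Rightarrow> real) \<Rightarrow> real ^ 'n \<Rightarrow> real" where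
  "partial_ext S i f x = Lim (at x within S) (partial i f)"

section \<open>Boundary charts, outward normal and surface measure\<close>

text \<open>Inside the open set \<open>U\<close>, the set \<open>\<Omega>\<close> is the part strictly above (\<open>s = 1\<close>) or strictly below
  (\<open>s = -1\<close>) the graph \<open>x\<^sub>k = \<gamma>(x)\<close>. The \<open>C\<^sup>1\<close> function \<open>\<gamma>\<close> of the remaining \<open>n - 1\<close> coordinates is
  represented by a function on the whole space that does not depend on the coordinate \<open>k\<close>.
  It follows that the boundary of \<open>\<Omega>\<close> inside \<open>U\<close> is exactly the graph. By the implicit function
  theorem every \<open>C\<^sup>1\<close> hypersurface is locally a graph over some coordinate hyperplane, so no
  rotations are needed.\<close>

definition boundary_chart ::
    "(real ^ 'n::finite) set \<Rightarrow> (real ^ 'n) set \<Rightarrow> 'n \<Rightarrow> real \<Rightarrow> (real ^ 'n \<Rightarrow> real) \<Rightarrow> bool" where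
  "boundary_chart \<Omega> U k s \<gamma> \<longleftrightarrow> open U \<and> (s = 1 \<or> s = -1) \<and> C1_on UNIV \<gamma> \<and>
      (\<forall>x t. \<gamma> (x + t *\<^sub>R axis k 1) = \<gamma> x) \<and>
      \<Omega> \<inter> U = {x \<in> U. s * (x $ k - \<gamma> x) > 0}"

definition regular_boundary :: "(real ^ 'n::finite) set \<Rightarrow> (real ^ 'n) set" where
  "regular_boundary \<Omega> = {x \<in> frontier \<Omega>. \<exists>U k s \<gamma>. boundary_chart \<Omega> U k s \<gamma> \<and> x \<in> U}"

definition area_factor :: "(real ^ 'n::finite \<Rightarrow> real) \<Rightarrow> real ^ 'n \<Rightarrow> real" where
  "area_factor \<gamma> x = sqrt (1 + (\<Sum>i\<in>UNIV. (partial i \<gamma> x)\<^sup>2))"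

text \<open>In a chart \<open>\<Omega>\<close> is locally \<open>{s (x\<^sub>k - \<gamma>(x)) > 0}\<close>, so the outward unit normal is the normalised
  negative gradient of \<open>s (x\<^sub>k - \<gamma>(x))\<close>. It does not depend on the chart. At singular boundary
  points the value is unspecified; these points carry no surface measure.\<close>

definition outward_normal :: "(real ^ 'n::finite) set \<Rightarrow> real ^ 'n \<Rightarrow> real ^ 'n" where
  "outward_normal \<Omega> x = (THE \<nu>. \<exists>U k s \<gamma>. boundary_chart \<Omega> U k s \<gamma> \<and> x \<in> U \<and> x \<in> frontier \<Omega> \<and>
      \<nu> = (s / area_factor \<gamma> x) *\<^sub>R ((\<chi> i. partial i \<gamma> x) - axis k 1))"

definition lift_graph :: "'n::finite \<Rightarrow> (real ^ 'n \<Rightarrow> real) \<Rightarrow> real ^ 'n \<Rightarrow> real ^ 'n" where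
  "lift_graph k \<gamma> y = (\<chi> i. if i = k then \<gamma> y else y $ i)"

text \<open>The classical surface measure \<open>sqrt (1 + |\<nabla>\<gamma>|\<^sup>2) dy\<close> of the part of the graph of \<open>\<gamma>\<close> lying in
  \<open>U\<close>, where \<open>dy\<close> is the \<open>(n-1)\<close>-dimensional Lebesgue measure in the coordinates other than \<open>k\<close>.
  The latter integration is realised as \<open>n\<close>-dimensional integration over the slab
  \<open>0 \<le> y\<^sub>k \<le> 1\<close> of unit thickness, all functions involved being independent of \<open>y\<^sub>k\<close>.\<close>

definition graph_measure ::
    "(real ^ 'n::finite) set \<Rightarrow> 'n \<Rightarrow> (real ^ 'n \<Rightarrow> real) \<Rightarrow> (real ^ 'n) measure" where
  "graph_measure U k \<gamma> =
     distr (density lborel (\<lambda>y. ennreal (indicator {y. 0 \<le> y $ k \<and> y $ k \<le> 1 \<and> lift_graph k \<gamma> y \<in> U} y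
                                          * area_factor \<gamma> y)))
       borel (lift_graph k \<gamma>)"

text \<open>The chart measures agree on overlaps of charts, so their supremum in the complete lattice of
  measures glues them: it is the Borel measure that coincides with the graph measure in every
  chart and that vanishes off the regular boundary. The index set is never empty, since
  \<open>U = {}\<close> is a (trivial) chart domain.\<close>

definition surface_measure :: "(real ^ 'n::finite) set \<Rightarrow> (real ^ 'n) measure" where
  "surface_measure \<Omega> =
     (SUP (U, k, \<gamma>) \<in> {(U, k, \<gamma>). \<exists>s. boundary_chart \<Omega> U k s \<gamma>}. graph_measure U k \<gamma>)"

section \<open>Piecewise smooth boundary\<close>

text \<open>Vanishing \<open>(n-1)\<close>-dimensional Hausdorff measure. For null sets (and \<open>n \<ge> 2\<close>) no bound on the
  radii is needed, and balls may replace arbitrary covering sets.\<close>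

definition codim1_null :: "(real ^ 'n::finite) set \<Rightarrow> bool" where
  "codim1_null N \<longleftrightarrow> (\<forall>\<epsilon>>0. \<exists>(c :: nat \<Rightarrow> real ^ 'n) r. (\<forall>j. 0 \<le> r j) \<and>
      N \<subseteq> (\<Union>j. cball (c j) (r j)) \<and>
      summable (\<lambda>j. r j ^ (CARD('n) - 1)) \<and> (\<Sum>j. r j ^ (CARD('n) - 1)) < \<epsilon>)"

text \<open>The boundary has finite area and is, outside a (relatively closed) set of vanishing
  \<open>(n-1)\<close>-dimensional measure (edges, corners, ...), a \<open>C\<^sup>1\<close> hypersurface with \<open>\<Omega>\<close> on one side.
  \<open>C\<^sup>1\<close> boundaries of bounded sets are the case of an empty exceptional set.\<close>

definition piecewise_smooth_boundary :: "(real ^ 'n::finite) set \<Rightarrow> bool" where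
  "piecewise_smooth_boundary \<Omega> \<longleftrightarrow> codim1_null (frontier \<Omega> - regular_boundary \<Omega>) \<and>
      emeasure (surface_measure \<Omega>) (frontier \<Omega>) < \<infinity>"

end

theory Submission
  imports Defs
begin

text \<open>The field \<open>W\<^sub>k = C\<^sup>k\<^sup>l\<^sub>i\<^sub>j (x\<^sub>m u\<^sup>i\<^sub>m + (n - 2) / 2 u\<^sup>i) u\<^sup>j\<^sub>l - x\<^sub>k E / 2 + x\<^sub>k F(u)\<close> with
  \<open>E = C\<^sup>k\<^sup>l\<^sub>i\<^sub>j u\<^sup>i\<^sub>k u\<^sup>j\<^sub>l\<close> has divergence \<open>n F(u) - (n - 2) / 2 u\<^sup>k f\<^sub>k(u)\<close>. On the boundary \<open>u = 0\<close>, so every gradient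
  \<open>\<nabla>u\<^sup>i\<close> is a multiple of \<open>\<nu>\<close> and \<open>W \<bullet> \<nu> = E (x \<bullet> \<nu>) / 2\<close>. The identity is therefore the divergence theorem
  for \<open>W\<close>, which is \<open>C\<^sup>1\<close> inside, continuous up to the boundary and of bounded divergence. In a boundary
  chart that theorem follows from \<open>\<integral> \<partial>\<^sub>i h = 0\<close> for compactly supported \<open>h\<close> by a cutoff in the distance to the
  graph. Localisation, together with a cutoff around the singular part of the boundary, gives the general
  case; the gradient of this cutoff is small in \<open>L\<^sup>1\<close> because the singular part has vanishing
  \<open>(n-1)\<close>-dimensional measure.\<close>

section \<open>Calculus with partial derivatives\<close>

text \<open>Second derivatives of \<open>u\<close> may be unbounded near the boundary. The system
  removes them from the sum of the \<open>partial k (W k)\<close> but not from the single terms, so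
  every version of the divergence theorem here assumes a bound on the sum alone. The weight (n - 2)
  / 2 is forced by the energy: the radial multiplier contributes E, the term -x E / 2 contributes -n
  E / 2, and the multiplier u makes up the difference. The other obstacle is that
  \<open>surface_measure\<close> is a supremum over charts, whose value inside one chart is not
  evident. It is found without a change of variables between charts: the chart version of the
  divergence theorem is stated with a plain Lebesgue integral over parameters, and applied to one
  test function in two charts it compares their graph measures. Near the singular set, a cutoff on a
  ball of radius r has a gradient of order 1 / r on a volume of order r^n, which matches the
  exponent n - 1 in \<open>codim1_null\<close>.\<close>

lemma C1_on_has_partial:
  assumes "C1_on S f" "x \<in> S"
  shows "((\<lambda>t. f (x + t *\<^sub>R axis i 1)) has_real_derivative partial i f x) (at 0)"
  using assms unfolding C1_on_def partial_def by (simp add: DERIV_deriv_iff_real_differentiable)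

text \<open>\<open>partial\<close> is a derivative at parameter 0; moving the base point gives it at
  every parameter, as the mean value theorem requires.\<close>

lemma C1_on_has_partial_at:
  assumes "C1_on S f" "x + t *\<^sub>R axis i 1 \<in> S"
  shows "((\<lambda>t. f (x + t *\<^sub>R axis i 1)) has_real_derivative partial i f (x + t *\<^sub>R axis i 1)) (at t)"
proof -
  have "((\<lambda>h. f (x + (h + t) *\<^sub>R axis i 1)) has_real_derivative partial i f (x + t *\<^sub>R axis i 1)) (at 0)"
    using C1_on_has_partial[OF assms(1,2), of i] by (simp add: algebra_simps)
  then show ?thesis
    using DERIV_shift[of "\<lambda>t. f (x + t *\<^sub>R axis i 1)" "partial i f (x + t *\<^sub>R axis i 1)" 0 t] by simp
qed

lemma partial_eqI:
  assumes "((\<lambda>t. f (x + t *\<^sub>R axis i 1)) has_real_derivative D) (at 0)"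
  shows "partial i f x = D"
  using assms unfolding partial_def by (rule DERIV_imp_deriv)

lemma C1_onI:
  assumes "\<And>i x. x \<in> S \<Longrightarrow> ((\<lambda>t. f (x + t *\<^sub>R axis i 1)) has_real_derivative D i x) (at 0)"
    and "\<And>i. continuous_on S (D i)"
  shows "C1_on S f"
proof -
  have "partial i f x = D i x" if "x \<in> S" for i x
    using partial_eqI[OF assms(1)[OF that]] .
  then show ?thesis
    using assms unfolding C1_on_def
    by (metis (mono_tags, lifting) continuous_on_cong real_differentiable_def)
qed

lemma C1_on_subset: "C1_on S f \<Longrightarrow> T \<subseteq> S \<Longrightarrow> C1_on T f"
  unfolding C1_on_def by (blast intro: continuous_on_subset)

text \<open>Dropping coordinates shortens a vector. This keeps the corners of an axis-parallel path
  within the ball around its starting point.\<close>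

lemma norm_sum_axis_le:
  fixes h :: "real ^ 'n::finite"
  shows "norm (\<Sum>i\<in>A. h $ i *\<^sub>R axis i (1::real)) \<le> norm h"
proof -
  have "(\<Sum>i\<in>A. h $ i *\<^sub>R axis i (1::real)) $ j = (if j \<in> A then h $ j else 0)" for j
  proof -
    have "(\<Sum>i\<in>A. h $ i *\<^sub>R axis i (1::real)) $ j = (\<Sum>i\<in>A. if i = j then h $ j else 0)"
      unfolding sum_component by (rule sum.cong) (auto simp: axis_def)
    also have "\<dots> = (if j \<in> A then h $ j else 0)"
      by (subst sum.delta) (auto intro: finite_subset)
    finally show ?thesis .
  qed
  then show ?thesis
    by (intro norm_le_componentwise_cart) auto
qed

text \<open>The increment of \<open>f\<close> is split into steps parallel to the axes; each step is handled by the
  mean value theorem.\<close>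

lemma C1_on_has_derivative:
  fixes f :: "real ^ 'n::finite \<Rightarrow> real"
  assumes "C1_on S f" "open S" "x \<in> S"
  shows "(f has_derivative (\<lambda>h. \<Sum>i\<in>UNIV. h $ i * partial i f x)) (at x)"
proof -
  define P where "P A h = (\<Sum>i\<in>A. h $ i *\<^sub>R axis i (1::real))" for A and h :: "real ^ 'n"
  \<comment> \<open>Induction over the set \<open>A\<close> of coordinates already moved. The
    tolerance \<open>e\<close> stays general because each new coordinate spends half of it.\<close>
  have *: "\<exists>d>0. \<forall>h. norm h < d \<longrightarrow>
      \<bar>f (x + P A h) - f x - (\<Sum>i\<in>A. h $ i * partial i f x)\<bar> \<le> e * norm h"
    if "e > 0" for e and A :: "'n set"
    using finite[of A] that
  proof (induction A arbitrary: e rule: finite_induct)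
    case empty
    then show ?case by (auto simp: P_def intro!: exI[of _ 1])
  next
    case (insert a A)
    obtain d1 where d1: "d1 > 0" "\<And>h. norm h < d1 \<Longrightarrow>
      \<bar>f (x + P A h) - f x - (\<Sum>i\<in>A. h $ i * partial i f x)\<bar> \<le> e/2 * norm h"
      using insert.IH[of "e/2"] insert.prems by auto
    have "isCont (partial a f) x"
      using assms unfolding C1_on_def by (simp add: continuous_on_eq_continuous_at)
    then obtain d2 where d2: "d2 > 0" "\<And>y. dist y x < d2 \<Longrightarrow> \<bar>partial a f y - partial a f x\<bar> < e/2"
      using insert.prems unfolding continuous_at_eps_delta dist_real_def
      by (metis half_gt_zero)
    obtain d3 where d3: "d3 > 0" "ball x d3 \<subseteq> S"
      using assms by (meson open_contains_ball)
    show ?case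
    proof (intro exI[of _ "min d1 (min d2 d3)"] conjI allI impI)
      fix h :: "real ^ 'n" assume h: "norm h < min d1 (min d2 d3)"
      define z where "z = x + P A h"
      define g where "g t = f (z + t *\<^sub>R axis a 1)" for t
      \<comment> \<open>The point is \<open>x + P (insert a A) h'\<close>, where \<open>h'\<close>
        is \<open>h\<close> with its component \<open>a\<close> replaced by the smaller
        \<open>t\<close>.\<close>
      have seg: "dist (z + t *\<^sub>R axis a 1) x \<le> norm h" if "\<bar>t\<bar> \<le> \<bar>h $ a\<bar>" for t
      proof -
        define h' where "h' = (\<chi> j. if j = a then t else h $ j)"
        have "P A h' = P A h"
          using insert.hyps unfolding P_def h'_def by (intro sum.cong) auto
        then have "P (insert a A) h' = P A h + t *\<^sub>R axis a 1"
          using insert.hyps unfolding P_def by (simp add: h'_def)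
        then have "dist (z + t *\<^sub>R axis a 1) x = norm (P (insert a A) h')"
          by (simp add: z_def dist_norm algebra_simps)
        also have "\<dots> \<le> norm h'" unfolding P_def by (rule norm_sum_axis_le)
        also have "\<dots> \<le> norm h"
          using that by (intro norm_le_componentwise_cart) (auto simp: h'_def)
        finally show ?thesis .
      qed
      have der: "(g has_real_derivative partial a f (z + t *\<^sub>R axis a 1)) (at t)" if "\<bar>t\<bar> \<le> \<bar>h $ a\<bar>" for t
        unfolding g_def using seg[OF that] h d3
        by (intro C1_on_has_partial_at[OF assms(1)]) (auto simp: dist_commute subset_iff)
      \<comment> \<open>The linear part is subtracted before the mean value bound is applied; the
        symmetric interval covers both signs of \<open>h $ a\<close>.\<close>
      have step: "\<bar>g (h $ a) - g 0 - h $ a * partial a f x\<bar> \<le> e/2 * norm h"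
      proof -
        have "\<bar>(g (h $ a) - h $ a * partial a f x) - (g 0 - 0 * partial a f x)\<bar> \<le> e/2 * \<bar>h $ a - 0\<bar>"
          unfolding real_norm_def[symmetric]
        proof (rule field_differentiable_bound[where S = "{-\<bar>h $ a\<bar>..\<bar>h $ a\<bar>}"
              and f = "\<lambda>t. g t - t * partial a f x"])
          fix t assume t: "t \<in> {-\<bar>h $ a\<bar>..\<bar>h $ a\<bar>}"
          show "((\<lambda>t. g t - t * partial a f x) has_real_derivative
              partial a f (z + t *\<^sub>R axis a 1) - partial a f x) (at t within {-\<bar>h $ a\<bar>..\<bar>h $ a\<bar>})"
            using t by (auto intro!: derivative_eq_intros DERIV_subset[OF der])
          show "norm (partial a f (z + t *\<^sub>R axis a 1) - partial a f x) \<le> e / 2"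
            using d2(2)[of "z + t *\<^sub>R axis a 1"] seg[of t] t h by force
        qed auto
        also have "\<dots> \<le> e/2 * norm h"
          using insert.prems component_le_norm_cart[of h a] by (intro mult_left_mono) auto
        finally show ?thesis by (simp add: algebra_simps)
      qed
      have "f (x + P (insert a A) h) = g (h $ a)" "g 0 = f (x + P A h)"
        using insert.hyps by (auto simp: g_def z_def P_def algebra_simps)
      then have "f (x + P (insert a A) h) - f x - (\<Sum>i\<in>insert a A. h $ i * partial i f x)
          = (g (h $ a) - g 0 - h $ a * partial a f x) + (f (x + P A h) - f x - (\<Sum>i\<in>A. h $ i * partial i f x))"
        using insert.hyps by simp
      also have "\<bar>\<dots>\<bar> \<le> e/2 * norm h + e/2 * norm h"
        using step d1(2)[of h] h by (intro order_trans[OF abs_triangle_ineq] add_mono) auto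
      finally show "\<bar>f (x + P (insert a A) h) - f x - (\<Sum>i\<in>insert a A. h $ i * partial i f x)\<bar> \<le> e * norm h"
        by simp
    qed (use d1 d2 d3 in auto)
  qed
  have P: "P UNIV h = h" for h :: "real ^ 'n"
    unfolding P_def using basis_expansion[of h] by (simp add: scalar_mult_eq_scaleR)
  show ?thesis
    unfolding has_derivative_at_alt
  proof (intro conjI allI impI)
    show "bounded_linear (\<lambda>h. \<Sum>i\<in>UNIV. h $ i * partial i f x)"
      by (intro bounded_linear_sum bounded_linear_mult_const) (rule bounded_linear_vec_nth)
    fix e :: real assume "e > 0"
    then obtain d where d: "d > 0" "\<And>h. norm h < d \<Longrightarrow>
        \<bar>f (x + P UNIV h) - f x - (\<Sum>i\<in>UNIV. h $ i * partial i f x)\<bar> \<le> e * norm h"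
      using * by blast
    show "\<exists>d>0. \<forall>y. norm (y - x) < d \<longrightarrow>
       norm (f y - f x - (\<Sum>i\<in>UNIV. (y - x) $ i * partial i f x)) \<le> e * norm (y - x)"
      using d(1) d(2)[of "y - x" for y] unfolding P by auto
  qed
qed

lemma C1_on_imp_continuous_on:
  fixes f :: "real ^ 'n::finite \<Rightarrow> real"
  assumes "C1_on S f" "open S"
  shows "continuous_on S f"
  using C1_on_has_derivative[OF assms] has_derivative_continuous continuous_at_imp_continuous_on by blast

lemma C1_on_UNIV_borel_measurable:
  fixes f :: "real ^ 'n::finite \<Rightarrow> real"
  assumes "C1_on UNIV f"
  shows "f \<in> borel_measurable borel"
  by (rule borel_measurable_continuous_onI[OF C1_on_imp_continuous_on[OF assms open_UNIV]])

lemma C1_on_directional: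
  fixes f :: "real ^ 'n::finite \<Rightarrow> real"
  assumes "C1_on S f" "open S" "p t \<in> S" "(p has_vector_derivative v) (at t)"
  shows "((\<lambda>t. f (p t)) has_real_derivative (\<Sum>i\<in>UNIV. v $ i * partial i f (p t))) (at t)"
proof -
  have "((\<lambda>t. f (p t)) has_derivative (\<lambda>h. \<Sum>i\<in>UNIV. (h *\<^sub>R v) $ i * partial i f (p t))) (at t)"
    using has_derivative_compose[OF assms(4)[unfolded has_vector_derivative_def]
        C1_on_has_derivative[OF assms(1,2,3)]] .
  moreover have "(\<lambda>h. \<Sum>i\<in>UNIV. (h *\<^sub>R v) $ i * partial i f (p t)) =
      (*) (\<Sum>i\<in>UNIV. v $ i * partial i f (p t))"
    by (auto simp: fun_eq_iff sum_distrib_left sum_distrib_right mult_ac)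
  ultimately show ?thesis
    by (simp add: has_field_derivative_def)
qed

lemma C1_on_const: "C1_on S (\<lambda>x. c)"
  by (rule C1_onI[where D = "\<lambda>_ _. 0"]) (auto intro!: derivative_eq_intros)

lemma partial_const [simp]: "partial i (\<lambda>x. c) x = 0"
  by (rule partial_eqI) (auto intro!: derivative_eq_intros)

lemma C1_on_component: "C1_on S (\<lambda>x. x $ k)"
  by (rule C1_onI[where D = "\<lambda>i _. axis i 1 $ k"]) (auto intro!: derivative_eq_intros)

lemma partial_component: "partial i (\<lambda>x. x $ k) x = (if i = k then 1 else 0)"
  by (rule partial_eqI) (auto intro!: derivative_eq_intros simp: axis_def)

lemma
  fixes f g :: "real ^ 'n::finite \<Rightarrow> real"
  assumes "open S" and f: "C1_on S f" and g: "C1_on S g"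
  shows C1_on_add: "C1_on S (\<lambda>x. f x + g x)"
    and C1_on_diff: "C1_on S (\<lambda>x. f x - g x)"
    and C1_on_mult: "C1_on S (\<lambda>x. f x * g x)"
    and partial_add: "x \<in> S \<Longrightarrow> partial i (\<lambda>x. f x + g x) x = partial i f x + partial i g x"
    and partial_diff: "x \<in> S \<Longrightarrow> partial i (\<lambda>x. f x - g x) x = partial i f x - partial i g x"
    and partial_mult: "x \<in> S \<Longrightarrow> partial i (\<lambda>x. f x * g x) x = partial i f x * g x + f x * partial i g x"
proof -
  note der = C1_on_has_partial[OF f] C1_on_has_partial[OF g]
  have c: "continuous_on S f" "continuous_on S g" "\<And>i. continuous_on S (partial i f)"
      "\<And>i. continuous_on S (partial i g)"
    using assms C1_on_imp_continuous_on by (auto simp: C1_on_def)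
  have a: "x \<in> S \<Longrightarrow> ((\<lambda>t. f (x + t *\<^sub>R axis i 1) + g (x + t *\<^sub>R axis i 1)) has_real_derivative
      partial i f x + partial i g x) (at 0)" for i x
    by (rule DERIV_add DERIV_diff der | assumption)+
  have d: "x \<in> S \<Longrightarrow> ((\<lambda>t. f (x + t *\<^sub>R axis i 1) - g (x + t *\<^sub>R axis i 1)) has_real_derivative
      partial i f x - partial i g x) (at 0)" for i x
    by (rule DERIV_add DERIV_diff der | assumption)+
  have m: "x \<in> S \<Longrightarrow> ((\<lambda>t. f (x + t *\<^sub>R axis i 1) * g (x + t *\<^sub>R axis i 1)) has_real_derivative
      partial i f x * g x + f x * partial i g x) (at 0)" for i x
    by (rule DERIV_cong[OF DERIV_mult[OF der]]) auto
  show "C1_on S (\<lambda>x. f x + g x)" "C1_on S (\<lambda>x. f x - g x)" "C1_on S (\<lambda>x. f x * g x)"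
    by (rule C1_onI[OF a] C1_onI[OF d] C1_onI[OF m]; (assumption | intro continuous_intros c))+
  show "x \<in> S \<Longrightarrow> partial i (\<lambda>x. f x + g x) x = partial i f x + partial i g x"
    "x \<in> S \<Longrightarrow> partial i (\<lambda>x. f x - g x) x = partial i f x - partial i g x"
    "x \<in> S \<Longrightarrow> partial i (\<lambda>x. f x * g x) x = partial i f x * g x + f x * partial i g x"
    by (rule partial_eqI, rule a d m, assumption)+
qed

lemma C1_on_sum:
  fixes f :: "'b \<Rightarrow> real ^ 'n::finite \<Rightarrow> real"
  assumes f: "\<And>j. j \<in> J \<Longrightarrow> C1_on S (f j)"
  shows "C1_on S (\<lambda>x. \<Sum>j\<in>J. f j x)"
proof (rule C1_onI)
  show "x \<in> S \<Longrightarrow> ((\<lambda>t. \<Sum>j\<in>J. f j (x + t *\<^sub>R axis i 1)) has_real_derivative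
      (\<Sum>j\<in>J. partial i (f j) x)) (at 0)" for i x
    by (intro DERIV_sum C1_on_has_partial[OF f])
qed (use f in \<open>auto intro!: continuous_intros simp: C1_on_def\<close>)

lemma C1_on_prod:
  fixes f :: "'b \<Rightarrow> real ^ 'n::finite \<Rightarrow> real"
  assumes "finite J" "open S" "\<And>j. j \<in> J \<Longrightarrow> C1_on S (f j)"
  shows "C1_on S (\<lambda>x. \<Prod>j\<in>J. f j x)"
  using assms(1,3) by (induction J rule: finite_induct) (auto intro!: C1_on_const C1_on_mult[OF assms(2)])

lemma
  fixes f :: "real ^ 'n::finite \<Rightarrow> real"
  assumes "open S" and f: "C1_on S f"
    and g: "\<And>t. (g has_real_derivative g' t) (at t)" "continuous_on UNIV g'"
  shows C1_on_compose: "C1_on S (\<lambda>x. g (f x))"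
    and partial_compose: "x \<in> S \<Longrightarrow> partial i (\<lambda>x. g (f x)) x = g' (f x) * partial i f x"
proof -
  have a: "x \<in> S \<Longrightarrow> ((\<lambda>t. g (f (x + t *\<^sub>R axis i 1))) has_real_derivative
      g' (f x) * partial i f x) (at 0)" for i x
    using DERIV_chain2[OF g(1) C1_on_has_partial[OF f]] by simp
  have "continuous_on S f" using C1_on_imp_continuous_on[OF f \<open>open S\<close>] .
  then have "continuous_on S (\<lambda>x. g' (f x) * partial i f x)" for i
    using f continuous_on_compose2[OF g(2)] by (auto intro!: continuous_intros simp: C1_on_def)
  then show "C1_on S (\<lambda>x. g (f x))"
    by (intro C1_onI[OF a])
  show "x \<in> S \<Longrightarrow> partial i (\<lambda>x. g (f x)) x = g' (f x) * partial i f x"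
    by (rule partial_eqI, rule a)
qed

lemma
  fixes F :: "real ^ 'm::finite \<Rightarrow> real" and u :: "real ^ 'n::finite \<Rightarrow> real ^ 'm"
  assumes "open S" and F: "C1_on UNIV F" and u: "\<And>j. C1_on S (\<lambda>x. u x $ j)"
  shows C1_on_compose_vec: "C1_on S (\<lambda>x. F (u x))"
    and partial_compose_vec:
      "x \<in> S \<Longrightarrow> partial i (\<lambda>x. F (u x)) x = (\<Sum>j\<in>UNIV. partial i (\<lambda>x. u x $ j) x * partial j F (u x))"
proof -
  have a: "((\<lambda>t. F (u (x + t *\<^sub>R axis i 1))) has_real_derivative
      (\<Sum>j\<in>UNIV. partial i (\<lambda>x. u x $ j) x * partial j F (u x))) (at 0)" if "x \<in> S" for i x
  proof -
    have *: "((\<lambda>t. u (x + t *\<^sub>R axis i 1) $ j) has_derivative (\<lambda>h. h * partial i (\<lambda>x. u x $ j) x)) (at 0)" for j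
      using C1_on_has_partial[OF u that, of i j]
      by (simp add: has_field_derivative_def mult_commute_abs)
    have "((\<lambda>t. u (x + t *\<^sub>R axis i 1)) has_vector_derivative (\<chi> j. partial i (\<lambda>x. u x $ j) x)) (at 0)"
      unfolding has_vector_derivative_def
      by (subst has_derivative_componentwise_within) (auto simp: Basis_vec_def inner_axis intro: *)
    from C1_on_directional[OF F open_UNIV _ this] show ?thesis by simp
  qed
  have cu: "continuous_on S u"
    using C1_on_imp_continuous_on[OF u \<open>open S\<close>] continuous_on_vec_lambda[of S "\<lambda>j x. u x $ j"] by simp
  have cp: "continuous_on S (\<lambda>x. partial j F (u x))" for j
    using F continuous_on_compose2[OF _ cu] unfolding C1_on_def by blast
  show "C1_on S (\<lambda>x. F (u x))"
    using u by (intro C1_onI[OF a] continuous_intros cp) (auto simp: C1_on_def)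
  show "x \<in> S \<Longrightarrow> partial i (\<lambda>x. F (u x)) x = (\<Sum>j\<in>UNIV. partial i (\<lambda>x. u x $ j) x * partial j F (u x))"
    by (rule partial_eqI, rule a)
qed


section \<open>Symmetry of second partial derivatives\<close>

text \<open>The mean value theorem is used twice: in direction \<open>i\<close> for the difference
  of \<open>f\<close> and its copy shifted along \<open>j\<close>, and in direction \<open>j\<close>
  for the resulting difference of \<open>partial i f\<close>.\<close>

lemma second_difference_mean_value:
  fixes f :: "real ^ 'n::finite \<Rightarrow> real"
  assumes f: "C2_on S f" and t: "t > 0" "cball x (2 * t) \<subseteq> S"
  obtains p where "dist x p \<le> 2 * t"
    "f (x + t *\<^sub>R axis i 1 + t *\<^sub>R axis j 1) - f (x + t *\<^sub>R axis i 1) - f (x + t *\<^sub>R axis j 1) + f x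
      = t\<^sup>2 * partial j (partial i f) p"
proof -
  have f1: "C1_on S f" "C1_on S (partial i f)"
    using f by (auto simp: C2_on_def)
  have d: "dist x (x + a *\<^sub>R axis i 1 + b *\<^sub>R axis j 1) \<le> 2 * t" if "0 \<le> a" "a \<le> t" "0 \<le> b" "b \<le> t" for a b
  proof -
    have "dist x (x + a *\<^sub>R axis i 1 + b *\<^sub>R axis j 1) = norm (a *\<^sub>R axis i 1 + b *\<^sub>R axis j 1 :: real ^ 'n)"
      unfolding dist_norm by (subst norm_minus_commute) (simp add: algebra_simps)
    also have "\<dots> \<le> \<bar>a\<bar> + \<bar>b\<bar>"
      by (rule order_trans[OF norm_triangle_ineq]) (simp add: norm_axis_1)
    finally show ?thesis using that by simp
  qed
  then have inS: "x + a *\<^sub>R axis i 1 + b *\<^sub>R axis j 1 \<in> S" if "0 \<le> a" "a \<le> t" "0 \<le> b" "b \<le> t" for a b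
    using that t by (meson mem_cball subsetD)
  have "((\<lambda>a. f (x + a *\<^sub>R axis i 1 + t *\<^sub>R axis j 1) - f (x + a *\<^sub>R axis i 1)) has_real_derivative
      partial i f (x + a *\<^sub>R axis i 1 + t *\<^sub>R axis j 1) - partial i f (x + a *\<^sub>R axis i 1)) (at a)"
    if "0 \<le> a" "a \<le> t" for a
    using C1_on_has_partial_at[OF f1(1), of "x + t *\<^sub>R axis j 1" a i] inS[OF that, of t]
      C1_on_has_partial_at[OF f1(1), of x a i] inS[OF that, of 0] t
    by (intro DERIV_diff) (auto simp: add_ac)
  from MVT2[OF t(1) this] obtain a where a: "0 < a" "a < t" and
    1: "(f (x + t *\<^sub>R axis i 1 + t *\<^sub>R axis j 1) - f (x + t *\<^sub>R axis i 1)) - (f (x + t *\<^sub>R axis j 1) - f x) =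
      t * (partial i f (x + a *\<^sub>R axis i 1 + t *\<^sub>R axis j 1) - partial i f (x + a *\<^sub>R axis i 1))"
    by auto
  have "((\<lambda>b. partial i f (x + a *\<^sub>R axis i 1 + b *\<^sub>R axis j 1)) has_real_derivative
      partial j (partial i f) (x + a *\<^sub>R axis i 1 + b *\<^sub>R axis j 1)) (at b)"
    if "0 \<le> b" "b \<le> t" for b
    using inS[OF _ _ that, of a] a by (intro C1_on_has_partial_at[OF f1(2)]) auto
  from MVT2[OF t(1) this] obtain b where b: "0 < b" "b < t" and
    2: "partial i f (x + a *\<^sub>R axis i 1 + t *\<^sub>R axis j 1) - partial i f (x + a *\<^sub>R axis i 1) =
      t * partial j (partial i f) (x + a *\<^sub>R axis i 1 + b *\<^sub>R axis j 1)"
    by auto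
  show thesis
    by (rule that[OF d[of a b]]) (use a b 1 2 in \<open>auto simp: power2_eq_square\<close>)
qed

text \<open>The second difference is symmetric in the two directions, so both mixed derivatives take
  a common value at points within \<open>2 * t m\<close> of \<open>x\<close>; continuity finishes
  the argument.\<close>

lemma C2_on_partial_commute:
  fixes f :: "real ^ 'n::finite \<Rightarrow> real"
  assumes f: "C2_on S f" and S: "open S" "x \<in> S"
  shows "partial i (partial j f) x = partial j (partial i f) x"
proof -
  obtain d where d: "d > 0" "cball x d \<subseteq> S"
    using S by (meson open_contains_cball)
  define t where "t m = d * inverse (real (Suc m)) / 2" for m
  have t: "t m > 0" "2 * t m \<le> d" for m
  proof -
    have "inverse (real (Suc m)) \<le> 1" by (simp add: inverse_le_1_iff)
    then show "t m > 0" "2 * t m \<le> d"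
      using d(1) by (auto simp: t_def mult_left_le)
  qed
  then have sub: "cball x (2 * t m) \<subseteq> S" for m
    using d(2) by (meson order_trans subset_cball)
  have "\<exists>p q. dist x p \<le> 2 * t m \<and> dist x q \<le> 2 * t m \<and>
      partial j (partial i f) p = partial i (partial j f) q" for m
  proof -
    obtain p where p: "dist x p \<le> 2 * t m" "f (x + t m *\<^sub>R axis i 1 + t m *\<^sub>R axis j 1) - f (x + t m *\<^sub>R axis i 1)
        - f (x + t m *\<^sub>R axis j 1) + f x = (t m)\<^sup>2 * partial j (partial i f) p"
      by (rule second_difference_mean_value[OF f t(1) sub])
    obtain q where q: "dist x q \<le> 2 * t m" "f (x + t m *\<^sub>R axis j 1 + t m *\<^sub>R axis i 1) - f (x + t m *\<^sub>R axis j 1)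
        - f (x + t m *\<^sub>R axis i 1) + f x = (t m)\<^sup>2 * partial i (partial j f) q"
      by (rule second_difference_mean_value[OF f t(1) sub])
    have "x + t m *\<^sub>R axis i 1 + t m *\<^sub>R axis j 1 = x + t m *\<^sub>R axis j 1 + t m *\<^sub>R axis i 1"
      by (simp add: add_ac)
    note eq = arg_cong[OF this, of f]
    \<comment> \<open>Abstracted to plain reals, since the two second differences list their middle
      terms in opposite order and write the far corner differently.\<close>
    have lin: "A = A' \<Longrightarrow> A - b - c + d = X \<Longrightarrow> A' - c - b + d = Y \<Longrightarrow> X = Y" for A A' b c d X Y :: real
      by linarith
    have "(t m)\<^sup>2 * partial j (partial i f) p = (t m)\<^sup>2 * partial i (partial j f) q"
      by (rule lin[OF eq p(2) q(2)])
    then show ?thesis using p q t(1)[of m] by auto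
  qed
  then obtain p q where pq: "\<And>m. dist x (p m) \<le> 2 * t m" "\<And>m. dist x (q m) \<le> 2 * t m"
      "\<And>m. partial j (partial i f) (p m) = partial i (partial j f) (q m)"
    by metis
  have t0: "(\<lambda>m. 2 * t m) \<longlonglongrightarrow> 0"
  proof -
    have eq: "(\<lambda>m. 2 * t m) = (\<lambda>m. d * inverse (real (Suc m)))"
      by (simp add: t_def)
    show ?thesis
      unfolding eq by (rule tendsto_mult_right_zero[OF LIMSEQ_inverse_real_of_nat])
  qed
  have lim: "r \<longlonglongrightarrow> x" if "\<And>m. dist x (r m) \<le> 2 * t m" for r
    unfolding tendsto_dist_iff[of r]
    by (rule tendsto_sandwich[OF _ _ tendsto_const t0]) (use that in \<open>auto simp: dist_commute\<close>)
  have "isCont (partial j (partial i f)) x" "isCont (partial i (partial j f)) x"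
    using f S by (auto simp: C2_on_def C1_on_def continuous_on_eq_continuous_at)
  then have "(\<lambda>m. partial j (partial i f) (p m)) \<longlonglongrightarrow> partial j (partial i f) x"
    "(\<lambda>m. partial i (partial j f) (q m)) \<longlonglongrightarrow> partial i (partial j f) x"
    using isCont_tendsto_compose lim[OF pq(1)] lim[OF pq(2)] by blast+
  then show ?thesis
    using pq(3) LIMSEQ_unique by auto
qed

section \<open>Integration along a coordinate direction\<close>

lemma integrable_bounded_support:
  fixes f :: "'a::euclidean_space \<Rightarrow> real"
  assumes "f \<in> borel_measurable borel" "bounded B" "\<And>x. x \<notin> B \<Longrightarrow> f x = 0" "\<And>x. \<bar>f x\<bar> \<le> M"
  shows "integrable lborel f"
proof -
  obtain R where R: "\<And>x. x \<in> B \<Longrightarrow> norm x \<le> R" using assms(2) by (auto simp: bounded_iff)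
  have "integrable lborel (\<lambda>x. M * indicator (cball 0 R :: 'a set) x :: real)"
    using emeasure_bounded_finite[of "cball 0 R :: 'a set"]
    by (intro integrable_mult_right integrable_real_indicator) auto
  then show ?thesis
  proof (rule Bochner_Integration.integrable_bound)
    show "AE x in lborel. norm (f x) \<le> norm (M * indicator (cball 0 R :: 'a set) x :: real)"
    proof (rule AE_I2)
      fix x
      have "\<bar>f x\<bar> \<le> \<bar>M\<bar>" using assms(4)[of x] by linarith
      then show "norm (f x) \<le> norm (M * indicator (cball 0 R :: 'a set) x :: real)"
        using R[of x] assms(3)[of x] by (cases "x \<in> B") (simp_all add: abs_mult)
    qed
    show "f \<in> borel_measurable lborel" using assms(1) by simp
  qed
qed

lemma compact_bounded_abs:
  fixes f :: "'a::topological_space \<Rightarrow> real"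
  assumes "compact K" "continuous_on K f"
  obtains M where "M \<ge> 0" "\<And>x. x \<in> K \<Longrightarrow> \<bar>f x\<bar> \<le> M"
proof -
  obtain M where M: "\<And>x. x \<in> K \<Longrightarrow> \<bar>f x\<bar> \<le> M"
    using compact_imp_bounded[OF compact_continuous_image[OF assms(2,1)]] by (auto simp: bounded_iff)
  show thesis
    by (rule that[of "max M 0"]) (use M in \<open>auto intro: max.coboundedI1\<close>)
qed

text \<open>The difference quotients of \<open>h\<close> have integral zero by translation invariance; the Lipschitz
  bound allows passing to the limit under the integral.\<close>

lemma integral_directional_derivative_eq_0:
  fixes h q :: "'a::euclidean_space \<Rightarrow> real"
  assumes meas: "h \<in> borel_measurable borel" and supp: "bounded B" "\<And>x. x \<notin> B \<Longrightarrow> h x = 0"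
    and der: "\<And>x. ((\<lambda>t. h (x + t *\<^sub>R v)) has_real_derivative q x) (at 0)"
    and bound: "\<And>x. \<bar>q x\<bar> \<le> M" "\<And>x. \<bar>h x\<bar> \<le> M'"
  shows "integrable lborel q" "(LINT x|lborel. q x) = 0"
proof -
  define e where "e m = inverse (real (Suc m))" for m
  have e: "0 < e m" "e m \<le> 1" for m by (auto simp: e_def field_simps)
  define s where "s m x = (h (x + e m *\<^sub>R v) - h x) / e m" for m x
  obtain R where R: "\<And>x. x \<in> B \<Longrightarrow> norm x \<le> R"
    using supp(1) by (auto simp: bounded_iff)
  have [measurable]: "h \<in> borel_measurable borel" by fact
  have ball_int: "integrable lborel (\<lambda>x. c * indicator (cball 0 r :: 'a set) x :: real)" for r c
    using emeasure_bounded_finite[of "cball 0 r :: 'a set"]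
    by (intro integrable_mult_right integrable_real_indicator) auto
  have hint: "integrable lborel h"
    by (rule integrable_bounded_support[OF meas supp bound(2)])
  have lip: "\<bar>s m x\<bar> \<le> M" for m x
  proof -
    have "((\<lambda>t. h (x + t *\<^sub>R v)) has_real_derivative q (x + t *\<^sub>R v)) (at t)" for t
    proof -
      have "((\<lambda>r. h (x + (r + t) *\<^sub>R v)) has_real_derivative q (x + t *\<^sub>R v)) (at 0)"
        using der[of "x + t *\<^sub>R v"] by (simp add: algebra_simps)
      then show ?thesis
        using DERIV_shift[of "\<lambda>t. h (x + t *\<^sub>R v)" "q (x + t *\<^sub>R v)" 0 t] by simp
    qed
    then have "\<exists>z>0. z < e m \<and> h (x + e m *\<^sub>R v) - h (x + 0 *\<^sub>R v) = (e m - 0) * q (x + z *\<^sub>R v)"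
      by (intro MVT2 e) auto
    then obtain z where "h (x + e m *\<^sub>R v) - h x = e m * q (x + z *\<^sub>R v)"
      by auto
    then have "s m x = q (x + z *\<^sub>R v)"
      using e(1)[of m] by (simp add: s_def)
    then show ?thesis using bound(1) by simp
  qed
  \<comment> \<open>As \<open>e m \<le> 1\<close>, the shift enlarges the support by at most
    \<open>norm v\<close>; this gives one integrable majorant for all \<open>m\<close>.\<close>
  have s0: "s m x = 0" if "norm x > R + norm v" for m x
  proof -
    have "norm (e m *\<^sub>R v) \<le> norm v" using e[of m] by (simp add: mult_left_le_one_le)
    moreover have "norm (x + e m *\<^sub>R v) \<ge> norm x - norm (e m *\<^sub>R v)"
      using norm_triangle_ineq4[of "x + e m *\<^sub>R v" "e m *\<^sub>R v"] by simp
    ultimately have "norm x > R" "norm (x + e m *\<^sub>R v) > R" using that norm_ge_zero[of v] by linarith+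
    then have "x \<notin> B" "x + e m *\<^sub>R v \<notin> B"
      by (meson R not_le)+
    then show ?thesis using supp(2) by (simp add: s_def)
  qed
  have M: "M \<ge> 0" using bound(1)[of 0] by linarith
  have lim: "(\<lambda>m. s m x) \<longlonglongrightarrow> q x" for x
  proof -
    have "((\<lambda>t. (h (x + t *\<^sub>R v) - h x) / t) \<longlongrightarrow> q x) (at 0)"
      using der[of x] by (simp add: DERIV_def)
    moreover have "filterlim e (at 0) sequentially"
      using e(1) LIMSEQ_inverse_real_of_nat unfolding e_def
      by (intro filterlim_atI) (auto simp: e_def less_imp_neq)
    ultimately show ?thesis
      unfolding s_def by (rule filterlim_compose)
  qed
  have sm: "s m \<in> borel_measurable lborel" for m
    unfolding s_def by measurable
  have qm: "q \<in> borel_measurable lborel"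
    using sm lim by (rule borel_measurable_LIMSEQ_real[rotated])
  have dom: "AE x in lborel. norm (s m x) \<le> M * indicator (cball 0 (R + norm v) :: 'a set) x" for m
    using lip s0 M by (intro AE_I2) (auto simp: indicator_def not_le)
  note dct = qm sm ball_int[of M "R + norm v"] AE_I2[OF lim] dom
  show "integrable lborel q"
    by (rule integrable_dominated_convergence[OF dct])
  have sint: "(LINT x|lborel. s m x) = 0" for m
  proof -
    have sh: "has_bochner_integral lborel (\<lambda>x. h (x + e m *\<^sub>R v)) (LINT x|lborel. h x)"
    proof -
      have "integrable (distr lborel borel ((+) (e m *\<^sub>R v))) h"
        unfolding lborel_distr_plus by (rule hint)
      from integrable_distr[OF _ this] have "integrable lborel (\<lambda>x. h (e m *\<^sub>R v + x))"
        by simp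
      moreover have "(LINT x|lborel. h (e m *\<^sub>R v + x)) = (LINT x|distr lborel borel ((+) (e m *\<^sub>R v)). h x)"
        by (subst integral_distr) auto
      ultimately show ?thesis
        unfolding lborel_distr_plus by (simp add: has_bochner_integral_iff add.commute)
    qed
    show ?thesis
      unfolding s_def using has_bochner_integral_diff[OF sh has_bochner_integral_integrable[OF hint]]
      by (simp add: has_bochner_integral_iff)
  qed
  have "(\<lambda>m. LINT x|lborel. s m x) \<longlonglongrightarrow> (LINT x|lborel. q x)"
    by (rule integral_dominated_convergence[OF dct])
  then show "(LINT x|lborel. q x) = 0"
    unfolding sint by (simp add: LIMSEQ_const_iff)
qed

section \<open>Integration over translates of a graph\<close>

text \<open>As a shift along axis \<open>k\<close>, the lift leaves every function independent of
  coordinate \<open>k\<close> unchanged.\<close>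

lemma lift_graph_alt:
  "lift_graph k \<gamma> y = y + (\<gamma> y - y $ k) *\<^sub>R axis k 1"
  by (auto simp: lift_graph_def vec_eq_iff axis_def)

lemma nn_integral_lborel_shift:
  fixes f :: "'a::euclidean_space \<Rightarrow> ennreal"
  assumes [measurable]: "f \<in> borel_measurable borel"
  shows "(\<integral>\<^sup>+x. f (x + a) \<partial>lborel) = (\<integral>\<^sup>+x. f x \<partial>lborel)"
proof -
  have "(\<integral>\<^sup>+x. f x \<partial>lborel) = (\<integral>\<^sup>+x. f x \<partial>distr lborel borel ((+) a))"
    by (simp add: lborel_distr_plus)
  also have "\<dots> = (\<integral>\<^sup>+x. f (a + x) \<partial>lborel)"
    by (rule nn_integral_distr) auto
  finally show ?thesis by (simp add: add.commute)
qed

abbreviation slab :: "'n \<Rightarrow> (real ^ 'n::finite) set" where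
  "slab k \<equiv> {y. 0 \<le> y $ k \<and> y $ k \<le> 1}"

lemma measurable_vec_nth [measurable]: "(\<lambda>x::real ^ 'n. x $ i) \<in> borel_measurable borel"
  by (intro borel_measurable_continuous_onI continuous_intros)

lemma borel_measurable_lift_graph [measurable]:
  fixes \<gamma> :: "real ^ 'n::finite \<Rightarrow> real"
  assumes [measurable]: "\<gamma> \<in> borel_measurable borel"
  shows "lift_graph k \<gamma> \<in> borel_measurable borel"
  unfolding lift_graph_alt[abs_def] by measurable

text \<open>Fubini's theorem in the unit-slab normalisation of \<open>graph_measure\<close>: translation invariance and
  Tonelli suffice, so the type \<open>real ^ 'n\<close> need not be split into a product.\<close>

lemma nn_integral_slab_fibres:
  fixes f :: "real ^ 'n::finite \<Rightarrow> ennreal" and \<gamma> :: "real ^ 'n \<Rightarrow> real"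
  assumes [measurable]: "f \<in> borel_measurable borel" "\<gamma> \<in> borel_measurable borel"
  shows "(\<integral>\<^sup>+\<tau>. (\<integral>\<^sup>+y. indicator (slab k) y * f (lift_graph k \<gamma> y + \<tau> *\<^sub>R axis k 1) \<partial>lborel) \<partial>lborel)
      = (\<integral>\<^sup>+x. f x \<partial>lborel)"
proof -
  let ?I = "indicator (slab k) :: real ^ 'n \<Rightarrow> ennreal"
  have [measurable]: "?I \<in> borel_measurable borel" by measurable
  have "(\<integral>\<^sup>+\<tau>. (\<integral>\<^sup>+y. ?I y * f (lift_graph k \<gamma> y + \<tau> *\<^sub>R axis k 1) \<partial>lborel) \<partial>lborel)
      = (\<integral>\<^sup>+y. (\<integral>\<^sup>+\<tau>. ?I y * f (lift_graph k \<gamma> y + \<tau> *\<^sub>R axis k 1) \<partial>lborel) \<partial>lborel)"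
    by (rule lborel_pair.Fubini'[symmetric]) measurable
  \<comment> \<open>For fixed \<open>y\<close> the lift is itself a shift along axis
    \<open>k\<close>, hence absorbed by translating \<open>\<tau>\<close>.\<close>
  also have "\<dots> = (\<integral>\<^sup>+y. (\<integral>\<^sup>+\<tau>. ?I y * f (y + \<tau> *\<^sub>R axis k 1) \<partial>lborel) \<partial>lborel)"
  proof (rule nn_integral_cong)
    fix y :: "real ^ 'n"
    have "(\<integral>\<^sup>+\<tau>. ?I y * f (y + (\<tau> + (\<gamma> y - y $ k)) *\<^sub>R axis k 1) \<partial>lborel) = (\<integral>\<^sup>+\<tau>. ?I y * f (y + \<tau> *\<^sub>R axis k 1) \<partial>lborel)"
      by (rule nn_integral_lborel_shift[where f = "\<lambda>\<tau>. ?I y * f (y + \<tau> *\<^sub>R axis k 1)"]) measurable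
    then show "(\<integral>\<^sup>+\<tau>. ?I y * f (lift_graph k \<gamma> y + \<tau> *\<^sub>R axis k 1) \<partial>lborel) = (\<integral>\<^sup>+\<tau>. ?I y * f (y + \<tau> *\<^sub>R axis k 1) \<partial>lborel)"
      by (simp add: lift_graph_alt algebra_simps)
  qed
  also have "\<dots> = (\<integral>\<^sup>+\<tau>. (\<integral>\<^sup>+y. ?I y * f (y + \<tau> *\<^sub>R axis k 1) \<partial>lborel) \<partial>lborel)"
    by (rule lborel_pair.Fubini') measurable
  also have "\<dots> = (\<integral>\<^sup>+\<tau>. (\<integral>\<^sup>+y. ?I (y - \<tau> *\<^sub>R axis k 1) * f y \<partial>lborel) \<partial>lborel)"
  proof (rule nn_integral_cong)
    fix \<tau> :: real
    show "(\<integral>\<^sup>+y. ?I y * f (y + \<tau> *\<^sub>R axis k 1) \<partial>lborel) = (\<integral>\<^sup>+y. ?I (y - \<tau> *\<^sub>R axis k 1) * f y \<partial>lborel)"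
      using nn_integral_lborel_shift[where f = "\<lambda>y. ?I (y - \<tau> *\<^sub>R axis k 1) * f y" and a = "\<tau> *\<^sub>R axis k 1"]
      by simp
  qed
  also have "\<dots> = (\<integral>\<^sup>+y. (\<integral>\<^sup>+\<tau>. ?I (y - \<tau> *\<^sub>R axis k 1) * f y \<partial>lborel) \<partial>lborel)"
    by (rule lborel_pair.Fubini'[symmetric]) measurable
  also have "\<dots> = (\<integral>\<^sup>+y. f y \<partial>lborel)"
  proof (rule nn_integral_cong)
    fix y :: "real ^ 'n"
    \<comment> \<open>The unit thickness of the slab enters here: the admissible
      \<open>\<tau>\<close> form an interval of length one.\<close>
    have "(\<integral>\<^sup>+\<tau>. ?I (y - \<tau> *\<^sub>R axis k 1) * f y \<partial>lborel) = (\<integral>\<^sup>+\<tau>. f y * indicator {y $ k - 1..y $ k} \<tau> \<partial>lborel)"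
      by (intro nn_integral_cong) (auto simp: indicator_def axis_def)
    also have "\<dots> = f y"
      by (subst nn_integral_cmult_indicator) auto
    finally show "(\<integral>\<^sup>+\<tau>. ?I (y - \<tau> *\<^sub>R axis k 1) * f y \<partial>lborel) = f y" .
  qed
  finally show ?thesis .
qed

text \<open>The identity for nonnegative functions says that \<open>T\<close> pushes the product
  measure, restricted to the slab, forward to Lebesgue measure. Signed integrals are then carried
  along by \<open>distr\<close>.\<close>

lemma
  fixes f :: "real ^ 'n::finite \<Rightarrow> real" and \<gamma> :: "real ^ 'n \<Rightarrow> real"
  assumes f: "integrable lborel f" and [measurable]: "\<gamma> \<in> borel_measurable borel"
  shows integral_slab_fibres:
      "(LINT \<tau>|lborel. (LINT y|lborel. indicator (slab k) y * f (lift_graph k \<gamma> y + \<tau> *\<^sub>R axis k 1)))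
        = (LINT x|lborel. f x)"
proof -
  define T where "T p = lift_graph k \<gamma> (snd p) + fst p *\<^sub>R axis k 1" for p :: "real \<times> (real ^ 'n)"
  define L where "L = density (lborel \<Otimes>\<^sub>M lborel) (\<lambda>p::real \<times> (real ^ 'n). ennreal (indicator (slab k) (snd p)))"
  have [measurable]: "f \<in> borel_measurable borel"
    using f by (simp add: integrable_iff_bounded)
  have [measurable]: "T \<in> borel_measurable (lborel \<Otimes>\<^sub>M lborel)"
    unfolding T_def[abs_def] by measurable
  have [measurable]: "(\<lambda>y. indicator (slab k) y :: real) \<in> borel_measurable borel" by measurable
  have eq: "distr L borel T = lborel"
  proof (rule measure_eqI)
    fix A assume "A \<in> sets (distr L borel T)"
    then have [measurable]: "A \<in> sets borel" by simp
    have "emeasure (distr L borel T) A = (\<integral>\<^sup>+x. indicator A x \<partial>distr L borel T)"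
      by (simp add: nn_integral_indicator)
    also have "\<dots> = (\<integral>\<^sup>+p. indicator A (T p) \<partial>L)"
      by (rule nn_integral_distr) (auto simp: L_def)
    also have "\<dots> = (\<integral>\<^sup>+p. indicator (slab k) (snd p) * indicator A (T p) \<partial>(lborel \<Otimes>\<^sub>M lborel))"
      unfolding L_def by (subst nn_integral_density) (auto simp: ennreal_indicator)
    also have "\<dots> = (\<integral>\<^sup>+\<tau>. (\<integral>\<^sup>+y. indicator (slab k) y * indicator A (lift_graph k \<gamma> y + \<tau> *\<^sub>R axis k 1) \<partial>lborel) \<partial>lborel)"
      by (subst lborel.nn_integral_fst[symmetric]) (auto simp: T_def)
    also have "\<dots> = emeasure lborel A"
      by (subst nn_integral_slab_fibres) auto
    finally show "emeasure (distr L borel T) A = emeasure lborel A" .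
  qed simp
  have "integrable (distr L borel T) f" unfolding eq by fact
  then have "integrable L (\<lambda>p. f (T p))"
    by (subst (asm) integrable_distr_eq) (auto simp: L_def)
  then have int: "integrable (lborel \<Otimes>\<^sub>M lborel) (\<lambda>p. indicator (slab k) (snd p) * f (T p))"
    unfolding L_def by (subst (asm) integrable_density) auto
  have "(LINT x|lborel. f x) = (LINT x|distr L borel T. f x)" unfolding eq ..
  also have "\<dots> = (LINT p|L. f (T p))"
    by (rule integral_distr) (auto simp: L_def)
  also have "\<dots> = (LINT p|(lborel \<Otimes>\<^sub>M lborel). indicator (slab k) (snd p) * f (T p))"
    unfolding L_def by (subst integral_density) auto
  also have "\<dots> = (LINT \<tau>|lborel. (LINT y|lborel. indicator (slab k) y * f (lift_graph k \<gamma> y + \<tau> *\<^sub>R axis k 1)))"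
    using lborel_pair.integral_fst'[OF int] by (simp add: T_def)
  finally show ?thesis by simp
qed

section \<open>\<open>C\<^sup>1\<close> cutoff functions\<close>

text \<open>A quadratic spline, the simplest cutoff that is \<open>C\<^sup>1\<close>; its derivative is the tent function of
  height \<open>2\<close> on \<open>[0, 1]\<close>.\<close>

definition step :: "real \<Rightarrow> real" where
  "step t = 2 * (max 0 t)\<^sup>2 - 4 * (max 0 (t - 1/2))\<^sup>2 + 2 * (max 0 (t - 1))\<^sup>2"

definition step' :: "real \<Rightarrow> real" where
  "step' t = 4 * max 0 t - 8 * max 0 (t - 1/2) + 4 * max 0 (t - 1)"

lemma max_0_square_has_derivative:
  "((\<lambda>t::real. (max 0 (t - a))\<^sup>2) has_real_derivative 2 * max 0 (t - a)) (at t)"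
proof -
  have *: "((\<lambda>t::real. (max 0 t)\<^sup>2) has_real_derivative 2 * max 0 t) (at t)" for t
  proof (cases t "0::real" rule: linorder_cases)
    case less
    have "((\<lambda>t::real. 0) has_real_derivative 0) (at t)" by simp
    then show ?thesis
      using less by (subst DERIV_cong_ev[OF refl _ refl, of _ "\<lambda>t. 0"])
        (auto intro!: eventually_mono[OF eventually_nhds_in_open[of "{..<0}"]])
  next
    case greater
    have "((\<lambda>t::real. t\<^sup>2) has_real_derivative 2 * t) (at t)" by (auto intro!: derivative_eq_intros)
    then show ?thesis
      using greater by (subst DERIV_cong_ev[OF refl _ refl, of _ "\<lambda>t. t\<^sup>2"])
        (auto intro!: eventually_mono[OF eventually_nhds_in_open[of "{0<..}"]])
  next
    case equal
    \<comment> \<open>At the kink the difference quotient is at most \<open>\<bar>h\<bar>\<close> in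
      absolute value, so the square removes the kink.\<close>
    have "((\<lambda>h::real. (max 0 h)\<^sup>2 / h) \<longlongrightarrow> 0) (at 0)"
    proof (rule tendsto_sandwich[of "\<lambda>h. -\<bar>h\<bar>" _ _ "\<lambda>h. \<bar>h\<bar>"])
      show "\<forall>\<^sub>F h in at (0::real). -\<bar>h\<bar> \<le> (max 0 h)\<^sup>2 / h"
        "\<forall>\<^sub>F h in at (0::real). (max 0 h)\<^sup>2 / h \<le> \<bar>h\<bar>"
        by (auto simp: max_def power2_eq_square)
    qed (auto intro!: tendsto_eq_intros)
    then show ?thesis using equal by (simp add: DERIV_def)
  qed
  from DERIV_shift[of "\<lambda>t. (max 0 t)\<^sup>2" "2 * max 0 (t - a)" t "-a"] *[of "t - a"] show ?thesis
    by simp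
qed

lemma step_has_derivative: "(step has_real_derivative step' t) (at t)"
proof -
  note d = max_0_square_has_derivative
  show ?thesis
    unfolding step_def[abs_def] step'_def
    using DERIV_add[OF DERIV_diff[OF DERIV_cmult[OF d[of 0], of 2] DERIV_cmult[OF d[of "1/2"], of 4]]
        DERIV_cmult[OF d[of 1], of 2]]
    by simp
qed

lemma continuous_on_step': "continuous_on A step'"
  unfolding step'_def[abs_def] by (intro continuous_intros)

lemma step_0: "t \<le> 0 \<Longrightarrow> step t = 0" and step_1: "1 \<le> t \<Longrightarrow> step t = 1"
  by (auto simp: step_def max_def power2_eq_square algebra_simps)

lemma step'_0: "t \<le> 0 \<or> 1 \<le> t \<Longrightarrow> step' t = 0"
  by (auto simp: step'_def max_def)

lemma step'_bounds: "0 \<le> step' t" "step' t \<le> 2"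
  by (auto simp: step'_def max_def)

lemma step_bounds: "0 \<le> step t" "step t \<le> 1"
proof -
  have mono: "step a \<le> step b" if "a \<le> b" for a b
    by (rule DERIV_nonneg_imp_nondecreasing[OF that]) (blast intro: step_has_derivative step'_bounds)
  show "0 \<le> step t" using mono[of "min 0 t" t] step_0[of "min 0 t"] by simp
  show "step t \<le> 1" using mono[of t "max 1 t"] step_1[of "max 1 t"] by simp
qed

text \<open>This is the weight left on the collar of the boundary after rescaling. The shift by 1
  moves its support to [1, 2], so the cutoff vanishes on a whole layer next to the graph.\<close>

lemma step'_has_bochner_integral: "has_bochner_integral lborel (\<lambda>t. step' (t - 1)) 1"
proof -
  have "has_bochner_integral lborel (\<lambda>t. step' (t - 1) * indicator {1..2} t) (step (2 - 1) - step (1 - 1))"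
  proof (rule has_bochner_integral_FTC_Icc_real)
    fix t :: real
    show "((\<lambda>t. step (t - 1)) has_real_derivative step' (t - 1)) (at t)"
      using DERIV_shift[of step "step' (t - 1)" t "-1"] step_has_derivative by simp
    show "isCont (\<lambda>t. step' (t - 1)) t"
      unfolding step'_def by (intro continuous_intros)
  qed simp
  moreover have "(\<lambda>t. step' (t - 1) * indicator {1..2} t) = (\<lambda>t. step' (t - 1))"
  proof
    show "step' (t - 1) * indicator {1..2} t = step' (t - 1)" for t
      using step'_0[of "t - 1"] by (cases "t \<le> 1 \<or> 2 \<le> t") (auto simp: indicator_def)
  qed
  ultimately show ?thesis by (simp add: step_0 step_1)
qed

text \<open>The argument of \<open>step\<close> is 1 at distance \<open>r\<close> from the centre
  and 0 at distance \<open>2 * r\<close>. It uses the squared norm, which is differentiable at the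
  centre too.\<close>

definition bump :: "real ^ 'n::finite \<Rightarrow> real \<Rightarrow> real ^ 'n \<Rightarrow> real" where
  "bump c r x = step ((4 * r\<^sup>2 - (norm (x - c))\<^sup>2) / (3 * r\<^sup>2))"

lemma
  fixes c :: "real ^ 'n::finite"
  shows C1_on_bump: "C1_on UNIV (bump c r)"
    and partial_bump: "partial i (bump c r) x =
      step' ((4 * r\<^sup>2 - (norm (x - c))\<^sup>2) / (3 * r\<^sup>2)) * (- 2 * (x - c) $ i / (3 * r\<^sup>2))"
proof -
  define f where "f x = (4 * r\<^sup>2 - (norm (x - c))\<^sup>2) / (3 * r\<^sup>2)" for x :: "real ^ 'n"
  have d: "((\<lambda>t. f (x + t *\<^sub>R axis i 1)) has_real_derivative (- 2 * (x - c) $ i / (3 * r\<^sup>2))) (at 0)" for x i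
  proof -
    have "(norm (x + t *\<^sub>R axis i 1 - c))\<^sup>2 = (norm (x - c))\<^sup>2 + 2 * t * (x - c) $ i + t\<^sup>2" for t
    proof -
      have "x + t *\<^sub>R axis i 1 - c = (x - c) + t *\<^sub>R axis i 1" by simp
      then show ?thesis
        by (simp only: power2_norm_eq_inner)
          (simp add: inner_add_left inner_add_right inner_axis inner_axis' power2_eq_square algebra_simps)
    qed
    moreover have "((\<lambda>t. 4 * r\<^sup>2 - ((norm (x - c))\<^sup>2 + 2 * t * (x - c) $ i + t\<^sup>2)) has_real_derivative
        - 2 * (x - c) $ i) (at 0)"
      by (auto intro!: derivative_eq_intros)
    ultimately show ?thesis
      unfolding f_def by (simp only: DERIV_cdivide)
  qed
  have f: "C1_on UNIV f"
    by (rule C1_onI[OF d]) (unfold divide_inverse, intro continuous_intros)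
  have b: "bump c r = (\<lambda>x. step (f x))"
    by (auto simp: bump_def f_def)
  note s = step_has_derivative continuous_on_step'[of UNIV]
  show "C1_on UNIV (bump c r)"
    unfolding b by (rule C1_on_compose[OF open_UNIV f s])
  show "partial i (bump c r) x =
      step' ((4 * r\<^sup>2 - (norm (x - c))\<^sup>2) / (3 * r\<^sup>2)) * (- 2 * (x - c) $ i / (3 * r\<^sup>2))"
    unfolding b using partial_compose[OF open_UNIV f s, of x i] partial_eqI[OF d, of i x]
    by (simp add: f_def)
qed

lemma bump_bounds: "0 \<le> bump c r x" "bump c r x \<le> 1"
  by (auto simp: bump_def step_bounds)

lemma bump_1:
  assumes "r > 0" "x \<in> cball c r"
  shows "bump c r x = 1"
proof -
  have "(norm (x - c))\<^sup>2 \<le> r\<^sup>2"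
    using assms by (intro power_mono) (auto simp: dist_norm norm_minus_commute)
  then show ?thesis
    unfolding bump_def using assms by (intro step_1) (simp add: le_divide_eq)
qed

lemma bump_0:
  assumes "r > 0" "x \<notin> ball c (2 * r)"
  shows "bump c r x = 0"
proof -
  have "(2 * r)\<^sup>2 \<le> (norm (x - c))\<^sup>2"
    using assms by (intro power_mono) (auto simp: dist_norm norm_minus_commute)
  then show ?thesis
    unfolding bump_def using assms by (intro step_0) (simp add: divide_le_0_iff)
qed

text \<open>The derivative of \<open>step\<close> is at most 2 and the inner derivative at most 4 /
  (3 r) on the support; 8 / (3 r) is rounded up to 3 / r.\<close>

lemma partial_bump_bound:
  assumes "r > 0"
  shows "\<bar>partial i (bump c r) x\<bar> \<le> 3 / r * indicator (cball c (2 * r)) x"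
proof (cases "x \<in> cball c (2 * r)")
  case True
  then have "\<bar>(x - c) $ i\<bar> \<le> 2 * r"
    using component_le_norm_cart[of "x - c" i] by (simp add: dist_norm norm_minus_commute)
  then have "\<bar>- 2 * (x - c) $ i / (3 * r\<^sup>2)\<bar> \<le> 4 * r / (3 * r\<^sup>2)"
    using assms by (simp add: abs_mult divide_right_mono)
  also have "\<dots> = 4 / (3 * r)" using assms by (simp add: power2_eq_square)
  finally have "\<bar>partial i (bump c r) x\<bar> \<le> 2 * (4 / (3 * r))"
    unfolding partial_bump abs_mult
    by (intro mult_mono) (use step'_bounds in auto)
  also have "\<dots> \<le> 3 / r" using assms by (simp add: field_simps)
  finally show ?thesis using True by simp
next
  case False
  then have "(2 * r)\<^sup>2 \<le> (norm (x - c))\<^sup>2"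
    using assms by (intro power_mono) (auto simp: dist_norm norm_minus_commute)
  then have "(4 * r\<^sup>2 - (norm (x - c))\<^sup>2) / (3 * r\<^sup>2) \<le> 0"
    using assms by (simp add: divide_le_0_iff)
  then show ?thesis
    using False by (simp add: partial_bump step'_0)
qed

section \<open>Locality of partial derivatives and integrals of compactly supported
  derivatives\<close>

lemma C1_on_open_cong_partial:
  fixes x :: "real ^ 'n::finite"
  assumes "open S" "x \<in> S" "\<And>y. y \<in> S \<Longrightarrow> f y = g y"
    "((\<lambda>t. g (x + t *\<^sub>R axis i 1)) has_real_derivative D) (at 0)"
  shows "((\<lambda>t. f (x + t *\<^sub>R axis i 1)) has_real_derivative D) (at 0)"
proof -
  have "continuous_on UNIV (\<lambda>t. x + t *\<^sub>R axis i (1::real))"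
    by (intro continuous_intros)
  then have "open ((\<lambda>t. x + t *\<^sub>R axis i 1) -` S)"
    by (rule open_vimage[OF assms(1)])
  then have "\<forall>\<^sub>F t in nhds 0. x + t *\<^sub>R axis i 1 \<in> S"
    using eventually_nhds_in_open[of "(\<lambda>t. x + t *\<^sub>R axis i 1) -` S" 0] assms(2) by simp
  then have "\<forall>\<^sub>F t in nhds 0. f (x + t *\<^sub>R axis i 1) = g (x + t *\<^sub>R axis i 1)"
    by (rule eventually_mono) (rule assms(3))
  from DERIV_cong_ev[OF refl this refl] show ?thesis using assms(4) by simp
qed

lemma partial_cong_open:
  assumes "open S" "x \<in> S" "\<And>y. y \<in> S \<Longrightarrow> f y = g y" "C1_on S g"
  shows "partial i f x = partial i g x"
  by (rule partial_eqI, rule C1_on_open_cong_partial[OF assms(1-3) C1_on_has_partial[OF assms(4,2)]])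

lemma partial_eq_0_open:
  assumes "open S" "x \<in> S" "\<And>y. y \<in> S \<Longrightarrow> f y = 0"
  shows "partial i f x = 0"
  using partial_cong_open[OF assms C1_on_const] by simp

text \<open>Since \<open>L\<close> is compact inside \<open>V\<close>, the open sets
  \<open>V\<close> and \<open>- L\<close> cover the space, and the extension of \<open>f\<close> by
  zero has partial derivatives on both. Thus the whole-space result applies to it.\<close>

lemma integral_partial_compact_support:
  fixes f :: "real ^ 'n::finite \<Rightarrow> real"
  assumes V: "open V" and L: "compact L" "L \<subseteq> V" and f: "C1_on V f" "\<And>x. x \<in> V \<Longrightarrow> x \<notin> L \<Longrightarrow> f x = 0"
  shows "integrable lborel (\<lambda>x. indicator V x * partial i f x)"
    and "(LINT x|lborel. indicator V x * partial i f x) = 0"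
proof -
  define h where "h x = indicator V x * f x" for x
  define q where "q x = indicator V x * partial i f x" for x
  have cont: "continuous_on V f" "continuous_on V (partial i f)"
    using f V C1_on_imp_continuous_on by (auto simp: C1_on_def)
  have 1: "h \<in> borel_measurable borel"
    using borel_measurable_continuous_on_indicator[OF _ cont(1)] V by (simp add: h_def[abs_def])
  have 2: "bounded L" using L compact_imp_bounded by blast
  have h0: "h x = 0" if "x \<notin> L" for x
    using f(2)[of x] that by (cases "x \<in> V") (auto simp: h_def)
  have 4: "((\<lambda>t. h (x + t *\<^sub>R axis i 1)) has_real_derivative q x) (at 0)" for x
  proof (cases "x \<in> V")
    case True
    show ?thesis
    proof (rule C1_on_open_cong_partial[OF V True])
      show "h y = f y" if "y \<in> V" for y using that by (simp add: h_def)
      show "((\<lambda>t. f (x + t *\<^sub>R axis i 1)) has_real_derivative q x) (at 0)"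
        using C1_on_has_partial[OF f(1) True, of i] True by (simp add: q_def)
    qed
  next
    case False
    have "open (-L)" "x \<in> -L" using L False by (auto simp: compact_imp_closed open_Compl)
    then show ?thesis
    proof (rule C1_on_open_cong_partial)
      show "h y = 0" if "y \<in> - L" for y using that h0 by simp
      show "((\<lambda>t. 0) has_real_derivative q x) (at 0)" using False by (simp add: q_def)
    qed
  qed
  obtain M where M: "\<And>x. x \<in> L \<Longrightarrow> \<bar>partial i f x\<bar> \<le> M"
    using compact_imp_bounded[OF compact_continuous_image[OF continuous_on_subset[OF cont(2) L(2)] L(1)]]
    by (auto simp: bounded_iff)
  have 5: "\<bar>q x\<bar> \<le> max M 0" for x
  proof (cases "x \<in> L")
    case True
    then show ?thesis using M[of x] L by (auto simp: q_def indicator_def)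
  next
    case False
    have "partial i f x = 0" if "x \<in> V"
    proof (rule partial_eq_0_open)
      show "open (V - L)" using V L by (simp add: compact_imp_closed open_Diff)
    qed (use False that f in auto)
    then show ?thesis by (auto simp: q_def indicator_def)
  qed
  obtain M' where M': "\<And>x. x \<in> L \<Longrightarrow> \<bar>f x\<bar> \<le> M'"
    using compact_imp_bounded[OF compact_continuous_image[OF continuous_on_subset[OF cont(1) L(2)] L(1)]]
    by (auto simp: bounded_iff)
  have 6: "\<bar>h x\<bar> \<le> max M' 0" for x
    using M'[of x] h0[of x] by (cases "x \<in> L") (auto simp: h_def indicator_def)
  show "integrable lborel (\<lambda>x. indicator V x * partial i f x)"
    "(LINT x|lborel. indicator V x * partial i f x) = 0"
    using integral_directional_derivative_eq_0[OF 1 2 h0 4 5 6] unfolding q_def by auto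
qed

section \<open>The divergence theorem in a boundary chart\<close>

text \<open>The outward normal before normalisation. Its length is the area factor, so a flux
  becomes an integral over parameters in which no square root appears.\<close>

definition conormal :: "'n::finite \<Rightarrow> real \<Rightarrow> (real ^ 'n \<Rightarrow> real) \<Rightarrow> 'n \<Rightarrow> real ^ 'n \<Rightarrow> real" where
  "conormal k s \<gamma> i y = s * (partial i \<gamma> y - (if i = k then 1 else 0))"

locale chart =
  fixes \<Omega> U :: "(real ^ 'n::finite) set" and k :: 'n and s :: real and \<gamma> :: "real ^ 'n \<Rightarrow> real"
  assumes chart: "boundary_chart \<Omega> U k s \<gamma>"
begin

text \<open>Signed distance to the graph measured along axis \<open>k\<close>, positive in
  \<open>\<Omega>\<close>. Unlike the Euclidean distance it is affine along the fibres and has an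
  explicit gradient, minus the conormal.\<close>

definition height :: "real ^ 'n \<Rightarrow> real" where
  "height x = s * (x $ k - \<gamma> x)"

abbreviation lift :: "real ^ 'n \<Rightarrow> real ^ 'n" where
  "lift \<equiv> lift_graph k \<gamma>"

abbreviation N :: "'n \<Rightarrow> real ^ 'n \<Rightarrow> real" where
  "N \<equiv> conormal k s \<gamma>"

abbreviation footprint :: "(real ^ 'n) set" where
  "footprint \<equiv> {y \<in> slab k. lift y \<in> U}"

lemma open_U: "open U" and s: "s = 1 \<or> s = -1" and C1_\<gamma>: "C1_on UNIV \<gamma>"
  and \<gamma>_shift: "\<gamma> (x + t *\<^sub>R axis k 1) = \<gamma> x"
  and \<Omega>_iff: "x \<in> U \<Longrightarrow> x \<in> \<Omega> \<longleftrightarrow> height x > 0"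
  using chart unfolding boundary_chart_def height_def by (auto simp: set_eq_iff)

lemma s_sq: "s * s = 1" and abs_s: "\<bar>s\<bar> = 1" and s_nz: "s \<noteq> 0"
  using s by auto

lemma partial_\<gamma>_shift: "partial i \<gamma> (x + t *\<^sub>R axis k 1) = partial i \<gamma> x"
proof -
  have "\<gamma> (x + t *\<^sub>R axis k 1 + r *\<^sub>R axis i 1) = \<gamma> (x + r *\<^sub>R axis i 1)" for r
    using \<gamma>_shift[of "x + r *\<^sub>R axis i 1" t] by (simp add: add_ac)
  then show ?thesis by (simp add: partial_def)
qed

lemma partial_k_\<gamma>: "partial k \<gamma> x = 0"
  by (rule partial_eqI) (simp add: \<gamma>_shift)

lemma continuous_on_\<gamma>: "continuous_on A \<gamma>"
  using C1_on_imp_continuous_on[OF C1_\<gamma>] continuous_on_subset by blast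

lemma \<gamma>_measurable [measurable]: "\<gamma> \<in> borel_measurable borel"
  using continuous_on_\<gamma> by (rule borel_measurable_continuous_onI)

lemma continuous_on_partial_\<gamma>: "continuous_on A (partial i \<gamma>)"
  using C1_\<gamma> continuous_on_subset unfolding C1_on_def by blast

lemma continuous_on_N: "continuous_on A (N i)"
  unfolding conormal_def[abs_def] by (intro continuous_intros continuous_on_partial_\<gamma>)

lemma N_measurable [measurable]: "N i \<in> borel_measurable borel"
  using continuous_on_N by (rule borel_measurable_continuous_onI)

lemma C1_on_height: "C1_on A height"
  unfolding height_def[abs_def]
  by (rule C1_on_subset[of UNIV])
    (intro C1_on_mult C1_on_const C1_on_diff C1_on_component C1_\<gamma> open_UNIV subset_UNIV)+

lemma partial_height: "partial i height x = - N i x"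
proof -
  have d: "C1_on UNIV (\<lambda>x. x $ k - \<gamma> x)"
    by (rule C1_on_diff[OF open_UNIV C1_on_component C1_\<gamma>])
  show ?thesis
    unfolding height_def[abs_def] conormal_def partial_mult[OF open_UNIV C1_on_const d UNIV_I]
      partial_diff[OF open_UNIV C1_on_component C1_\<gamma> UNIV_I] partial_component
    by (simp add: algebra_simps)
qed

lemma continuous_on_height: "continuous_on A height"
  using C1_on_imp_continuous_on[OF C1_on_height[of UNIV]] continuous_on_subset by blast

lemma height_shift: "height (x + t *\<^sub>R axis k 1) = height x + s * t"
  by (simp add: height_def \<gamma>_shift algebra_simps)

lemma height_lift: "height (lift y) = 0"
  by (simp add: lift_graph_alt height_shift) (simp add: height_def algebra_simps)

lemma partial_\<gamma>_lift: "partial i \<gamma> (lift y) = partial i \<gamma> y"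
  by (simp add: lift_graph_alt partial_\<gamma>_shift)

lemma N_shift: "N i (x + t *\<^sub>R axis k 1) = N i x"
  by (simp add: conormal_def partial_\<gamma>_shift)

lemma N_lift: "N i (lift y) = N i y"
  by (simp add: lift_graph_alt N_shift)

lemma lift_eq: "height x = 0 \<Longrightarrow> lift x = x"
  using s_nz by (simp add: lift_graph_alt height_def)

lemma open_inside: "open (\<Omega> \<inter> U)"
proof -
  have "\<Omega> \<inter> U = U \<inter> height -` {0<..}"
    using \<Omega>_iff by auto
  then show ?thesis
    using continuous_on_height[of UNIV] open_U by (auto intro!: open_Int open_vimage)
qed

text \<open>Positive and negative height are open conditions that place a point in the interior or
  off the closure. From height zero, a small step of sign \<open>s\<close> along axis
  \<open>k\<close> enters \<open>\<Omega>\<close>.\<close>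

lemma in_frontier_iff:
  assumes "x \<in> U"
  shows "x \<in> frontier \<Omega> \<longleftrightarrow> height x = 0"
proof
  assume "x \<in> frontier \<Omega>"
  then have fr: "x \<in> closure \<Omega>" "x \<notin> interior \<Omega>" by (auto simp: frontier_def)
  have "\<not> height x > 0"
  proof
    assume "height x > 0"
    then have "x \<in> \<Omega> \<inter> U" using \<Omega>_iff assms by auto
    then show False using fr(2) interior_maximal[OF _ open_inside, of \<Omega>] by blast
  qed
  moreover have "\<not> height x < 0"
  proof
    assume "height x < 0"
    moreover have "open (U \<inter> height -` {..<0})"
      using continuous_on_height[of UNIV] open_U by (auto intro!: open_Int open_vimage)
    moreover have "(U \<inter> height -` {..<0}) \<inter> \<Omega> = {}"
      using \<Omega>_iff by auto
    ultimately have "(U \<inter> height -` {..<0}) \<inter> closure \<Omega> = {}"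
      using open_Int_closure_eq_empty by blast
    then show False using fr(1) \<open>height x < 0\<close> assms by auto
  qed
  ultimately show "height x = 0" by simp
next
  assume 0: "height x = 0"
  have "x \<in> closure \<Omega>"
    unfolding closure_approachable
  proof (intro allI impI)
    fix e :: real assume "e > 0"
    obtain d where d: "d > 0" "ball x d \<subseteq> U" using open_U assms by (meson open_contains_ball)
    define y where "y = x + (s * (min d e / 2)) *\<^sub>R axis k 1"
    have "dist y x = min d e / 2"
      using d(1) \<open>e > 0\<close> by (simp add: y_def dist_norm abs_mult abs_s)
    moreover have "min d e \<le> d" "min d e \<le> e" "0 < min d e" using d(1) \<open>e > 0\<close> by auto
    ultimately have "dist y x < d" "dist y x < e" by linarith+
    moreover have "height y = min d e / 2"
      using s_sq unfolding y_def height_shift 0 by (simp add: mult.assoc[symmetric])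
    ultimately have "y \<in> \<Omega>" using \<Omega>_iff[of y] d \<open>e > 0\<close> by (auto simp: dist_commute subset_iff)
    then show "\<exists>y\<in>\<Omega>. dist y x < e" using \<open>dist y x < e\<close> by blast
  qed
  moreover have "x \<notin> \<Omega>" using \<Omega>_iff assms 0 by simp
  ultimately show "x \<in> frontier \<Omega>" using interior_subset by (auto simp: frontier_def)
qed

text \<open>The displaced point has height \<open>e m * \<theta>\<close>, because
  \<open>s * s = 1\<close>. These are the points through which boundary values are reached.\<close>

lemma lift_tendsto_inside:
  assumes "lift y \<in> U" "\<theta> > 0" "e \<longlonglongrightarrow> 0" "\<And>m. e m > 0"
  shows "\<forall>\<^sub>F m in sequentially. lift y + (s * e m * \<theta>) *\<^sub>R axis k 1 \<in> \<Omega> \<inter> U"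
proof -
  have "(\<lambda>m. lift y + (s * e m * \<theta>) *\<^sub>R axis k 1) \<longlonglongrightarrow> lift y + (s * 0 * \<theta>) *\<^sub>R axis k 1"
    by (intro tendsto_intros assms)
  then have "\<forall>\<^sub>F m in sequentially. lift y + (s * e m * \<theta>) *\<^sub>R axis k 1 \<in> U"
    using topological_tendstoD[OF _ open_U] assms(1) by simp
  then show ?thesis
  proof (rule eventually_mono)
    fix m assume *: "lift y + (s * e m * \<theta>) *\<^sub>R axis k 1 \<in> U"
    have "height (lift y + (s * e m * \<theta>) *\<^sub>R axis k 1) = s * s * (e m * \<theta>)"
      unfolding height_shift height_lift by simp
    then have "height (lift y + (s * e m * \<theta>) *\<^sub>R axis k 1) > 0"
      using assms by (simp add: s_sq)
    then show "lift y + (s * e m * \<theta>) *\<^sub>R axis k 1 \<in> \<Omega> \<inter> U"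
      using * \<Omega>_iff[OF *] by simp
  qed
qed

end

text \<open>The test function is cut off by \<open>step (height / \<epsilon> - 1)\<close>, which makes it compactly supported
  inside \<open>\<Omega>\<close>; the derivative of the cutoff concentrates on the graph as \<open>\<epsilon> \<rightarrow> 0\<close>. In this way no
  integrability of the individual derivatives \<open>\<partial>\<^sub>i W\<^sub>i\<close> up to the boundary is needed.\<close>

lemma (in chart) divergence_chart:
  fixes W :: "'n \<Rightarrow> real ^ 'n \<Rightarrow> real" and \<phi> :: "real ^ 'n \<Rightarrow> real"
  assumes bdd: "bounded \<Omega>" and op: "open \<Omega>"
    and W: "\<And>i. continuous_on (closure \<Omega>) (W i)" "\<And>i. C1_on \<Omega> (W i)"
    and div: "\<And>x. x \<in> \<Omega> \<Longrightarrow> \<bar>\<Sum>i\<in>UNIV. partial i (W i) x\<bar> \<le> M"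
    and \<phi>: "C1_on UNIV \<phi>" and K: "compact K" "K \<subseteq> U" "\<And>x. x \<notin> K \<Longrightarrow> \<phi> x = 0"
  shows "(LINT x|lborel. indicator \<Omega> x *
            (\<phi> x * (\<Sum>i\<in>UNIV. partial i (W i) x) + (\<Sum>i\<in>UNIV. W i x * partial i \<phi> x)))
      = (LINT y|lborel. indicator footprint y * (\<phi> (lift y) * (\<Sum>i\<in>UNIV. W i (lift y) * N i y)))"
proof -
  define V where "V = \<Omega> \<inter> U"
  define P where "P x = \<phi> x * (\<Sum>i\<in>UNIV. partial i (W i) x) + (\<Sum>i\<in>UNIV. W i x * partial i \<phi> x)" for x
  define R where "R x = \<phi> x * (\<Sum>i\<in>UNIV. W i x * N i x)" for x
  define G where "G x = indicator V x * R x" for x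
  define e where "e m = inverse (real (Suc m))" for m
  have e: "e m > 0" for m by (simp add: e_def)
  have e0: "e \<longlonglongrightarrow> 0" unfolding e_def by (rule LIMSEQ_inverse_real_of_nat)
  have V: "open V" "V \<subseteq> \<Omega>" "V \<subseteq> U" "V \<subseteq> closure \<Omega>"
    using open_inside closure_subset by (auto simp: V_def)
  have VK: "x \<in> V" if "x \<in> K" "height x > 0" for x
    using that K \<Omega>_iff by (auto simp: V_def)
  have hV: "x \<in> V \<Longrightarrow> height x > 0" for x
    using \<Omega>_iff by (auto simp: V_def)
  have clK: "closed K" using K compact_imp_closed by blast
  have \<phi>c: "continuous_on A \<phi>" "continuous_on A (partial i \<phi>)" for A i
    using C1_on_imp_continuous_on[OF \<phi>] \<phi> continuous_on_subset unfolding C1_on_def by blast+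
  have d\<phi>0: "partial i \<phi> x = 0" if "x \<notin> K" for x i
    by (rule partial_eq_0_open[of "- K"]) (use that K clK in auto)
  have P0: "P x = 0" if "x \<notin> K" for x using d\<phi>0[OF that] K(3)[OF that] by (simp add: P_def)
  have R0: "R x = 0" if "x \<notin> K" for x using K(3)[OF that] by (simp add: R_def)
  have G0: "G x = 0" if "x \<notin> K" for x using R0[OF that] by (simp add: G_def)
  have Wc: "continuous_on V (W i)" "continuous_on V (partial i (W i))" for i
    using W V(2,4) continuous_on_subset unfolding C1_on_def by blast+
  have Pc: "continuous_on V P"
    unfolding P_def[abs_def] by (intro continuous_intros \<phi>c Wc)
  have Rc: "continuous_on V R"
    unfolding R_def[abs_def] by (intro continuous_intros \<phi>c Wc continuous_on_N)
  have [measurable]: "(\<lambda>x. indicator V x * P x) \<in> borel_measurable borel"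
    "G \<in> borel_measurable borel"
    using borel_measurable_continuous_on_indicator[OF _ Pc] borel_measurable_continuous_on_indicator[OF _ Rc] V
    by (simp_all add: G_def[abs_def])
  have [measurable]: "height \<in> borel_measurable borel" "step \<in> borel_measurable borel" "step' \<in> borel_measurable borel"
    by (auto intro!: borel_measurable_continuous_onI continuous_on_height continuous_on_step'
        simp: continuous_on_eq_continuous_at intro: DERIV_isCont[OF step_has_derivative])
  have comp: "compact (closure \<Omega>)" "compact (closure \<Omega> \<inter> K)"
    using bdd K compact_closure by (auto intro: compact_Int_closed clK)
  have RcK: "continuous_on (closure \<Omega> \<inter> K) R"
    unfolding R_def[abs_def]
    by (intro continuous_intros \<phi>c continuous_on_N continuous_on_subset[OF W(1)]) auto
  obtain MR where MR: "MR \<ge> 0" "\<And>x. x \<in> closure \<Omega> \<inter> K \<Longrightarrow> \<bar>R x\<bar> \<le> MR"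
    by (rule compact_bounded_abs[OF comp(2) RcK]) (rule that)
  have Rb: "\<bar>G x\<bar> \<le> MR" for x
    using R0[of x] V MR unfolding G_def by (cases "x \<in> K"; cases "x \<in> V") auto
  have SK: "continuous_on (closure \<Omega> \<inter> K) (\<lambda>x. \<Sum>i\<in>UNIV. W i x * partial i \<phi> x)"
    by (intro continuous_intros \<phi>c continuous_on_subset[OF W(1)]) auto
  obtain MP1 where MP1: "MP1 \<ge> 0" "\<And>x. x \<in> closure \<Omega> \<inter> K \<Longrightarrow> \<bar>\<Sum>i\<in>UNIV. W i x * partial i \<phi> x\<bar> \<le> MP1"
    by (rule compact_bounded_abs[OF comp(2) SK]) (rule that)
  obtain MP2 where MP2: "MP2 \<ge> 0" "\<And>x. x \<in> K \<Longrightarrow> \<bar>\<phi> x\<bar> \<le> MP2"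
    by (rule compact_bounded_abs[OF K(1) \<phi>c(1)]) (rule that)
  define MP where "MP = MP2 * \<bar>M\<bar> + MP1"
  have MP: "MP \<ge> 0" using MP1 MP2 by (simp add: MP_def)
  have Pb: "\<bar>indicator V x * P x\<bar> \<le> MP" for x
  proof (cases "x \<in> K \<and> x \<in> V")
    case True
    then have "\<bar>\<phi> x * (\<Sum>i\<in>UNIV. partial i (W i) x)\<bar> \<le> MP2 * \<bar>M\<bar>"
      unfolding abs_mult using div[of x] MP2 V by (intro mult_mono) auto
    moreover have "\<bar>\<Sum>i\<in>UNIV. W i x * partial i \<phi> x\<bar> \<le> MP1"
      using True V MP1 by auto
    ultimately show ?thesis using True unfolding P_def MP_def by simp
  next
    case False
    then show ?thesis using P0[of x] MP by (cases "x \<in> K") auto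
  qed
  have Kb: "bounded K" using K compact_imp_bounded by blast
  have intP: "integrable lborel (\<lambda>x. indicator V x * P x)"
    by (rule integrable_bounded_support[OF _ Kb _ Pb]) (auto simp: P0)
  have sb: "\<bar>step t\<bar> \<le> 1" for t using step_bounds[of t] by simp
  have s'b: "\<bar>step' t\<bar> \<le> 2" for t using step'_bounds[of t] by simp
  have intP': "integrable lborel (\<lambda>x. step (height x / e m - 1) * (indicator V x * P x))" for m
  proof (rule integrable_bounded_support[OF _ Kb, where M = MP])
    show "\<bar>step (height x / e m - 1) * (indicator V x * P x)\<bar> \<le> MP" for x
      unfolding abs_mult[of "step _"]
      using mult_mono[OF sb[of "height x / e m - 1"] Pb[of x]] MP by simp
  qed (auto simp: P0)
  have intR': "integrable lborel (\<lambda>x. step' (height x / e m - 1) / e m * G x)" for m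
  proof (rule integrable_bounded_support[OF _ Kb, where M = "2 / e m * MR"])
    show "\<bar>step' (height x / e m - 1) / e m * G x\<bar> \<le> 2 / e m * MR" for x
      unfolding abs_mult[of "step' _ / e m"] abs_divide
      using e[of m] s'b[of "height x / e m - 1"] Rb[of x] MR(1) by (intro mult_mono) (auto simp: divide_right_mono)
  qed (auto simp: G0)
  \<comment> \<open>The integral of the divergence of cutoff times \<open>\<phi>\<close> times
    \<open>W\<close> is zero. Differentiating the cutoff produces minus the conormal and hence the
    collar term on the right.\<close>
  have balance: "(LINT x|lborel. step (height x / e m - 1) * (indicator V x * P x)) =
      (LINT x|lborel. step' (height x / e m - 1) / e m * G x)" for m
  proof -
    define c where "c x = step (height x / e m - 1)" for x
    define f where "f i x = c x * (\<phi> x * W i x)" for i x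
    \<comment> \<open>The cutoff vanishes where the height is at most \<open>e m\<close>, so the
      support stays away from the graph and is compact in \<open>V\<close>.\<close>
    define L where "L = K \<inter> {x. e m \<le> height x}"
    have "closed {x. e m \<le> height x}"
      by (intro closed_Collect_le continuous_on_height continuous_intros)
    then have L: "compact L" "L \<subseteq> V"
      using K e[of m] unfolding L_def by (auto intro!: compact_Int_closed VK)
    define hh where "hh x = height x * inverse (e m) - 1" for x
    have hh: "C1_on V hh" "x \<in> V \<Longrightarrow> partial i hh x = - N i x / e m" for x i
      unfolding hh_def[abs_def] using V
      by (auto intro!: C1_on_diff C1_on_mult C1_on_const C1_on_height
          simp: partial_diff[of V] partial_mult[of V] C1_on_mult C1_on_const C1_on_height partial_height divide_inverse)
    have ceq: "c = (\<lambda>x. step (hh x))" by (simp add: c_def hh_def divide_inverse fun_eq_iff)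
    note st = V(1) hh(1) step_has_derivative continuous_on_step'[of UNIV]
    have c: "C1_on V c" "x \<in> V \<Longrightarrow> partial i c x = - step' (height x / e m - 1) / e m * N i x" for x i
      unfolding ceq using C1_on_compose[OF st] partial_compose[OF st, of x i] hh(2)[of x i]
      by (auto simp: hh_def divide_inverse)
    have \<phi>V: "C1_on V \<phi>" and WV: "C1_on V (W i)" for i
      using \<phi> W(2) V C1_on_subset by blast+
    have \<phi>W: "C1_on V (\<lambda>x. \<phi> x * W i x)" for i
      by (rule C1_on_mult[OF V(1) \<phi>V WV])
    have f: "C1_on V (f i)" for i
      unfolding f_def[abs_def] by (rule C1_on_mult[OF V(1) c(1) \<phi>W])
    have pf: "partial i (f i) x = c x * (\<phi> x * partial i (W i) x + W i x * partial i \<phi> x)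
        - step' (height x / e m - 1) / e m * (\<phi> x * (W i x * N i x))" if "x \<in> V" for i x
    proof -
      have "partial i (f i) x = partial i c x * (\<phi> x * W i x) + c x * partial i (\<lambda>x. \<phi> x * W i x) x"
        unfolding f_def[abs_def] by (rule partial_mult[OF V(1) c(1) \<phi>W that])
      also have "partial i (\<lambda>x. \<phi> x * W i x) x = partial i \<phi> x * W i x + \<phi> x * partial i (W i) x"
        by (rule partial_mult[OF V(1) \<phi>V WV that])
      finally show ?thesis unfolding c(2)[OF that] by (simp add: algebra_simps)
    qed
    have f0: "f i x = 0" if "x \<in> V" "x \<notin> L" for i x
    proof (cases "x \<in> K")
      case True
      then have "height x / e m - 1 \<le> 0" using that e[of m] by (simp add: L_def)
      then show ?thesis by (simp add: f_def c_def step_0)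
    qed (simp add: f_def K)
    note ip = integral_partial_compact_support[OF V(1) L f f0]
    have "0 = (\<Sum>i\<in>UNIV. LINT x|lborel. indicator V x * partial i (f i) x)"
      using ip(2) by simp
    also have "\<dots> = (LINT x|lborel. (\<Sum>i\<in>UNIV. indicator V x * partial i (f i) x))"
      by (rule Bochner_Integration.integral_sum[symmetric]) (rule ip(1))
    also have "\<dots> = (LINT x|lborel. c x * (indicator V x * P x) - step' (height x / e m - 1) / e m * G x)"
    proof (rule Bochner_Integration.integral_cong[OF refl])
      fix x
      show "(\<Sum>i\<in>UNIV. indicator V x * partial i (f i) x) =
          c x * (indicator V x * P x) - step' (height x / e m - 1) / e m * G x"
      proof (cases "x \<in> V")
        case True
        have "(\<Sum>i\<in>UNIV. partial i (f i) x) = c x * P x - step' (height x / e m - 1) / e m * R x"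
          unfolding pf[OF True] P_def R_def sum_subtractf sum_distrib_left[symmetric] sum.distrib ..
        then show ?thesis using True by (simp add: G_def)
      qed (simp add: G_def)
    qed
    also have "\<dots> = (LINT x|lborel. c x * (indicator V x * P x)) -
        (LINT x|lborel. step' (height x / e m - 1) / e m * G x)"
      by (rule Bochner_Integration.integral_diff[OF intP'[of m, folded c_def] intR'[of m]])
    finally show ?thesis by (simp add: c_def)
  qed
  have lim1: "(\<lambda>m. LINT x|lborel. step (height x / e m - 1) * (indicator V x * P x))
      \<longlonglongrightarrow> (LINT x|lborel. indicator V x * P x)"
  proof (rule integral_dominated_convergence[where w = "\<lambda>x. \<bar>indicator V x * P x\<bar>"])
    show "AE x in lborel. (\<lambda>m. step (height x / e m - 1) * (indicator V x * P x)) \<longlonglongrightarrow> indicator V x * P x"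
    proof (rule AE_I2)
      fix x
      show "(\<lambda>m. step (height x / e m - 1) * (indicator V x * P x)) \<longlonglongrightarrow> indicator V x * P x"
      proof (cases "x \<in> V")
        case True
        \<comment> \<open>The cutoff has reached 1 once the height is at least
          \<open>2 * e m\<close>.\<close>
        then have "height x / 2 > 0" using hV by simp
        then have "\<forall>\<^sub>F m in sequentially. e m < height x / 2"
          using order_tendstoD(2)[OF e0] by blast
        then have "\<forall>\<^sub>F m in sequentially. step (height x / e m - 1) * (indicator V x * P x) = indicator V x * P x"
          by (rule eventually_mono) (use e in \<open>simp add: step_1 field_simps\<close>)
        then show ?thesis by (rule tendsto_eventually)
      qed simp
    qed
    show "AE x in lborel. norm (step (height x / e m - 1) * (indicator V x * P x)) \<le> \<bar>indicator V x * P x\<bar>" for m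
      using sb by (intro AE_I2) (simp add: abs_mult mult_left_le_one_le)
  qed (use intP in simp_all)
  \<comment> \<open>\<open>J\<close> is the flux through the graph displaced by
    \<open>\<tau>\<close> along axis \<open>k\<close>. Its limit from the side of
    \<open>\<Omega>\<close> is the boundary flux \<open>J0\<close>.\<close>
  define J where "J \<tau> = (LINT y|lborel. indicator (slab k) y * G (lift y + \<tau> *\<^sub>R axis k 1))" for \<tau>
  define J0 where "J0 = (LINT y|lborel. indicator footprint y * (\<phi> (lift y) * (\<Sum>i\<in>UNIV. W i (lift y) * N i y)))"
  obtain b where b: "\<And>x. x \<in> K \<Longrightarrow> norm x \<le> b" using Kb by (auto simp: bounded_iff)
  \<comment> \<open>The lift preserves the coordinates other than \<open>k\<close>, bounded by
    \<open>b\<close> on \<open>K\<close>; coordinate \<open>k\<close> lies in [0, 1] on the slab.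
    The box works for all displacements at once.\<close>
  define B where "B = cbox (\<chi> i. - \<bar>b\<bar> - 1) ((\<chi> i. \<bar>b\<bar> + 1) :: real ^ 'n)"
  have Bx: "y \<in> B" if "y \<in> slab k" "lift y + \<tau> *\<^sub>R axis k 1 \<in> K" for y \<tau>
  proof -
    have "\<bar>y $ i\<bar> \<le> \<bar>b\<bar> + 1" for i
    proof (cases "i = k")
      case True then show ?thesis using that by auto
    next
      case False
      then have "(lift y + \<tau> *\<^sub>R axis k 1) $ i = y $ i" by (simp add: lift_graph_def axis_def)
      then show ?thesis using b[OF that(2)] component_le_norm_cart[of "lift y + \<tau> *\<^sub>R axis k 1" i] by simp
    qed
    then show ?thesis by (auto simp: B_def mem_box_cart abs_le_iff minus_le_iff) (smt (verit))+
  qed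
  have intB: "integrable lborel (\<lambda>y. MR * indicator B y)"
    using emeasure_bounded_finite[of B] unfolding B_def
    by (intro integrable_mult_right integrable_real_indicator) auto
  have Jb1: "\<bar>indicator (slab k) y * G (lift y + \<tau> *\<^sub>R axis k 1)\<bar> \<le> MR * indicator B y" for y \<tau>
  proof (cases "y \<in> slab k \<and> lift y + \<tau> *\<^sub>R axis k 1 \<in> K")
    case True
    then show ?thesis using Bx[of y \<tau>] Rb[of "lift y + \<tau> *\<^sub>R axis k 1"] by simp
  next
    case False
    then show ?thesis using G0[of "lift y + \<tau> *\<^sub>R axis k 1"] MR(1) by (cases "y \<in> slab k") auto
  qed
  have [measurable]: "(\<lambda>y. indicator (slab k) y * G (lift y + \<tau> *\<^sub>R axis k 1))
      \<in> borel_measurable borel" for \<tau>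
    by measurable
  have Jb: "\<bar>J \<tau>\<bar> \<le> MR * measure lborel B" for \<tau>
  proof -
    have "\<bar>J \<tau>\<bar> \<le> (LINT y|lborel. MR * indicator B y)"
      unfolding J_def
      by (rule order_trans[OF integral_abs_bound])
        (intro integral_mono' intB Jb1 mult_nonneg_nonneg MR indicator_pos_le abs_ge_zero)
    also have "\<dots> = MR * measure lborel B" by (simp add: B_def)
    finally show ?thesis .
  qed
  have Jm [measurable]: "J \<in> borel_measurable borel"
  proof -
    have "(\<lambda>p::real \<times> (real ^ 'n). indicator (slab k) (snd p) * G (lift (snd p) + fst p *\<^sub>R axis k 1))
        \<in> borel_measurable (borel \<Otimes>\<^sub>M lborel)"
      by measurable
    then show ?thesis
      unfolding J_def[abs_def] by (intro lborel.borel_measurable_lebesgue_integral) (simp add: case_prod_beta')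
  qed
  have Jlim: "(\<lambda>m. J (s * e m * \<theta>)) \<longlonglongrightarrow> J0" if "\<theta> > 0" for \<theta>
    unfolding J_def J0_def
  proof (rule integral_dominated_convergence[OF _ _ intB])
    show "AE y in lborel. (\<lambda>m. indicator (slab k) y * G (lift y + (s * e m * \<theta>) *\<^sub>R axis k 1))
        \<longlonglongrightarrow> indicator footprint y * (\<phi> (lift y) * (\<Sum>i\<in>UNIV. W i (lift y) * N i y))"
    proof (rule AE_I2)
      fix y
      define p where "p m = lift y + (s * e m * \<theta>) *\<^sub>R axis k 1" for m
      have "p \<longlonglongrightarrow> lift y + (s * 0 * \<theta>) *\<^sub>R axis k 1"
        unfolding p_def by (intro tendsto_intros e0)
      then have plim: "p \<longlonglongrightarrow> lift y" by simp
      have "(\<lambda>m. G (p m)) \<longlonglongrightarrow> indicator U (lift y) * (\<phi> (lift y) * (\<Sum>i\<in>UNIV. W i (lift y) * N i y))"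
      proof (cases "lift y \<in> U")
        case True
        have ev: "\<forall>\<^sub>F m in sequentially. p m \<in> V"
          using lift_tendsto_inside[OF True that e0 e] by (simp add: p_def V_def)
        have cl: "lift y \<in> closure \<Omega>"
          using in_frontier_iff[OF True] height_lift by (simp add: frontier_def)
        have "(\<lambda>m. W i (p m)) \<longlonglongrightarrow> W i (lift y)" for i
          by (rule continuous_on_tendsto_compose[OF W(1) plim cl])
            (rule eventually_mono[OF ev], rule subsetD[OF V(4)])
        moreover have "(\<lambda>m. \<phi> (p m)) \<longlonglongrightarrow> \<phi> (lift y)"
          using continuous_on_tendsto_compose[OF \<phi>c(1)[of UNIV] plim] by simp
        ultimately have "(\<lambda>m. \<phi> (p m) * (\<Sum>i\<in>UNIV. W i (p m) * N i y)) \<longlonglongrightarrow> \<phi> (lift y) * (\<Sum>i\<in>UNIV. W i (lift y) * N i y)"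
          by (intro tendsto_intros)
        moreover have "N i (p m) = N i y" for i m
          unfolding p_def N_shift N_lift ..
        ultimately have "(\<lambda>m. R (p m)) \<longlonglongrightarrow> \<phi> (lift y) * (\<Sum>i\<in>UNIV. W i (lift y) * N i y)"
          by (simp add: R_def)
        then have "(\<lambda>m. G (p m)) \<longlonglongrightarrow> \<phi> (lift y) * (\<Sum>i\<in>UNIV. W i (lift y) * N i y)"
          by (rule Lim_transform_eventually) (use ev in \<open>auto elim!: eventually_mono simp: G_def\<close>)
        then show ?thesis using True by simp
      next
        case False
        then have "lift y \<in> - K" "open (- K)" using K clK by auto
        then have "\<forall>\<^sub>F m in sequentially. p m \<in> - K" using topological_tendstoD[OF plim] by blast
        then have "\<forall>\<^sub>F m in sequentially. G (p m) = 0"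
          by (rule eventually_mono) (simp add: G0)
        then show ?thesis using False by (simp add: tendsto_eventually)
      qed
      then have "(\<lambda>m. indicator (slab k) y * G (p m)) \<longlonglongrightarrow>
          indicator (slab k) y * (indicator U (lift y) * (\<phi> (lift y) * (\<Sum>i\<in>UNIV. W i (lift y) * N i y)))"
        by (rule tendsto_mult_left)
      moreover have "indicator (slab k) y * (indicator U (lift y) * (\<phi> (lift y) * (\<Sum>i\<in>UNIV. W i (lift y) * N i y)))
          = indicator footprint y * (\<phi> (lift y) * (\<Sum>i\<in>UNIV. W i (lift y) * N i y))"
        by (simp add: indicator_def)
      ultimately show "(\<lambda>m. indicator (slab k) y * G (lift y + (s * e m * \<theta>) *\<^sub>R axis k 1))
        \<longlonglongrightarrow> indicator footprint y * (\<phi> (lift y) * (\<Sum>i\<in>UNIV. W i (lift y) * N i y))"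
        by (simp only: p_def)
    qed
    \<comment> \<open>\<open>W\<close> is controlled only on the closure of \<open>\<Omega>\<close>;
      measurability is taken from the frontier inside \<open>U\<close>, where the lifted points
      lie.\<close>
    show "(\<lambda>y. indicator footprint y * (\<phi> (lift y) * (\<Sum>i\<in>UNIV. W i (lift y) * N i y))) \<in> borel_measurable lborel"
    proof -
      have Rfr: "continuous_on (frontier \<Omega> \<inter> U) R"
        unfolding R_def[abs_def]
        by (intro continuous_intros \<phi>c continuous_on_N continuous_on_subset[OF W(1)]) (auto simp: frontier_def)
      define Q where "Q x = indicator (frontier \<Omega> \<inter> U) x * R x" for x
      have [measurable]: "Q \<in> borel_measurable borel"
        using borel_measurable_continuous_on_indicator[of "frontier \<Omega> \<inter> U" R] open_U Rfr by (simp add: Q_def[abs_def])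
      have "indicator footprint y * (\<phi> (lift y) * (\<Sum>i\<in>UNIV. W i (lift y) * N i y)) =
          indicator (slab k) y * Q (lift y)" for y
        using in_frontier_iff[of "lift y"] height_lift[of y] by (auto simp: indicator_def Q_def R_def N_lift)
      moreover have "(\<lambda>y. indicator (slab k) y * Q (lift y)) \<in> borel_measurable borel"
        by measurable
      ultimately show ?thesis by simp
    qed
  qed (use Jb1 in simp_all)
  \<comment> \<open>Slicing by displaced graphs and substituting
    \<open>\<tau> = s * e m * \<theta>\<close> gives a weight independent of \<open>m\<close>; the
    Jacobian cancels the factor 1 / \<open>e m\<close>.\<close>
  have scale: "(LINT x|lborel. step' (height x / e m - 1) / e m * G x) =
      (LINT \<theta>|lborel. step' (\<theta> - 1) * J (s * e m * \<theta>))" for m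
  proof -
    have "(LINT x|lborel. step' (height x / e m - 1) / e m * G x) =
       (LINT \<tau>|lborel. (LINT y|lborel. indicator (slab k) y * (step' (s * \<tau> / e m - 1) / e m *
          G (lift y + \<tau> *\<^sub>R axis k 1))))"
      using integral_slab_fibres[OF intR'[of m] \<gamma>_measurable, of k, symmetric]
      unfolding height_shift height_lift add_0_left by simp
    also have "\<dots> = (LINT \<tau>|lborel. step' (s * \<tau> / e m - 1) / e m * J \<tau>)"
      unfolding J_def integral_mult_right_zero[symmetric]
      by (intro Bochner_Integration.integral_cong refl) (simp add: mult_ac)
    also have "\<dots> = \<bar>s * e m\<bar> *\<^sub>R (LINT \<theta>|lborel. step' (s * (0 + s * e m * \<theta>) / e m - 1) / e m * J (0 + s * e m * \<theta>))"
      by (rule lborel_integral_real_affine) (use e[of m] s_nz in auto)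
    also have "\<dots> = (LINT \<theta>|lborel. step' (\<theta> - 1) * J (s * e m * \<theta>))"
    proof -
      have sc: "s * (0 + s * e m * \<theta>) / e m = \<theta>" for \<theta>
      proof -
        have "s * (0 + s * e m * \<theta>) / e m = (s * s) * \<theta> * (e m / e m)" by simp
        then show ?thesis using e[of m] by (simp only: s_sq) simp
      qed
      show ?thesis
        using e[of m] unfolding sc real_scaleR_def integral_mult_right_zero[symmetric]
        by (intro Bochner_Integration.integral_cong refl) (simp add: abs_mult abs_s)
    qed
    finally show ?thesis .
  qed
  have "(\<lambda>m. LINT \<theta>|lborel. step' (\<theta> - 1) * J (s * e m * \<theta>)) \<longlonglongrightarrow> (LINT \<theta>|lborel. step' (\<theta> - 1) * J0)"
  proof (rule integral_dominated_convergence[where w = "\<lambda>\<theta>. step' (\<theta> - 1) * (MR * measure lborel B)"])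
    show "AE \<theta> in lborel. (\<lambda>m. step' (\<theta> - 1) * J (s * e m * \<theta>)) \<longlonglongrightarrow> step' (\<theta> - 1) * J0"
    proof (rule AE_I2)
      fix \<theta> :: real
      show "(\<lambda>m. step' (\<theta> - 1) * J (s * e m * \<theta>)) \<longlonglongrightarrow> step' (\<theta> - 1) * J0"
        by (cases "\<theta> > 0") (auto intro!: tendsto_mult_left Jlim simp: step'_0)
    qed
    show "AE \<theta> in lborel. norm (step' (\<theta> - 1) * J (s * e m * \<theta>)) \<le> step' (\<theta> - 1) * (MR * measure lborel B)" for m
      using Jb step'_bounds by (intro AE_I2) (simp add: abs_mult mult_left_mono)
    show "integrable lborel (\<lambda>\<theta>. step' (\<theta> - 1) * (MR * measure lborel B))"
      using step'_has_bochner_integral by (intro integrable_mult_left) (auto simp: has_bochner_integral_iff)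
  qed measurable
  then have "(\<lambda>m. LINT x|lborel. step (height x / e m - 1) * (indicator V x * P x)) \<longlonglongrightarrow> J0"
    unfolding balance scale using step'_has_bochner_integral by (simp add: has_bochner_integral_iff)
  then have "(LINT x|lborel. indicator V x * P x) = J0"
    using lim1 LIMSEQ_unique by blast
  \<comment> \<open>\<open>P\<close> vanishes off \<open>K\<close>, and \<open>K\<close> lies in
    \<open>U\<close>.\<close>
  moreover have VO: "indicator V x * P x = indicator \<Omega> x * P x" for x
    using P0[of x] K by (cases "x \<in> K") (auto simp: V_def indicator_def)
  ultimately show ?thesis
    unfolding VO unfolding P_def J0_def by simp
qed

section \<open>Outward normal and graph measure\<close>

context chart
begin

abbreviation \<mu> :: "(real ^ 'n) measure" where
  "\<mu> \<equiv> graph_measure U k \<gamma>"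

abbreviation nvec :: "real ^ 'n \<Rightarrow> real ^ 'n" where
  "nvec x \<equiv> \<chi> i. N i x"

lemma U_sets [measurable]: "U \<in> sets borel"
  using open_U by simp

text \<open>The cross term in component \<open>k\<close> vanishes because \<open>\<gamma>\<close>
  does not depend on that coordinate, which leaves the summand 1 of the area factor.\<close>

lemma norm_nvec: "norm (nvec x) = area_factor \<gamma> x"
proof -
  have *: "(N i x)\<^sup>2 = (partial i \<gamma> x)\<^sup>2 + (if i = k then 1 else 0)" for i
  proof -
    have "(N i x)\<^sup>2 = (s * s) * (partial i \<gamma> x - (if i = k then 1 else 0))\<^sup>2"
      by (simp add: conormal_def power2_eq_square)
    then show ?thesis by (simp add: s_sq partial_k_\<gamma>)
  qed
  have "(\<Sum>i\<in>UNIV. (N i x)\<^sup>2) = 1 + (\<Sum>i\<in>UNIV. (partial i \<gamma> x)\<^sup>2)"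
    unfolding * sum.distrib by simp
  then show ?thesis
    unfolding norm_vec_def L2_set_def area_factor_def by simp
qed

lemma area_ge_1: "area_factor \<gamma> x \<ge> 1"
  unfolding area_factor_def by (simp add: sum_nonneg)

lemma area_pos: "area_factor \<gamma> x > 0"
  using area_ge_1[of x] by linarith

lemma area_lift: "area_factor \<gamma> (lift y) = area_factor \<gamma> y"
  by (simp add: area_factor_def partial_\<gamma>_lift)

lemma area_measurable [measurable]: "area_factor \<gamma> \<in> borel_measurable borel"
  unfolding area_factor_def[abs_def]
  by (intro borel_measurable_continuous_onI continuous_intros continuous_on_partial_\<gamma>)

lemma sgn_nvec: "sgn (nvec x) = (s / area_factor \<gamma> x) *\<^sub>R ((\<chi> i. partial i \<gamma> x) - axis k 1)"
proof -
  have "nvec x = s *\<^sub>R ((\<chi> i. partial i \<gamma> x) - axis k 1)"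
    by (simp add: vec_eq_iff conormal_def axis_def)
  then show ?thesis
    unfolding sgn_div_norm norm_nvec by (simp add: divide_inverse mult.commute)
qed

lemma sets_\<mu> [simp, measurable_cong]: "sets \<mu> = sets borel"
  by (simp add: graph_measure_def)

lemma space_\<mu> [simp]: "space \<mu> = UNIV"
  by (simp add: graph_measure_def)

lemma dens_measurable [measurable]:
  "(\<lambda>y. indicator footprint y * area_factor \<gamma> y) \<in> borel_measurable borel"
  by measurable

lemma graph_measure_eq:
  "\<mu> = distr (density lborel (\<lambda>y. ennreal (indicator footprint y * area_factor \<gamma> y))) borel lift"
  by (simp add: graph_measure_def conj_assoc)

lemma nn_integral_\<mu>:
  assumes [measurable]: "f \<in> borel_measurable borel"
  shows "(\<integral>\<^sup>+x. f x \<partial>\<mu>) = (\<integral>\<^sup>+y. ennreal (indicator footprint y * area_factor \<gamma> y) * f (lift y) \<partial>lborel)"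
  unfolding graph_measure_eq
  by (subst nn_integral_distr) (simp_all add: nn_integral_density)

lemma integral_\<mu>:
  fixes f :: "real ^ 'n \<Rightarrow> real"
  assumes [measurable]: "f \<in> borel_measurable borel"
  shows "(LINT x|\<mu>. f x) = (LINT y|lborel. indicator footprint y * area_factor \<gamma> y * f (lift y))"
  unfolding graph_measure_eq
  by (subst integral_distr) (simp_all add: integral_density area_pos less_imp_le)

lemma emeasure_\<mu>:
  assumes [measurable]: "A \<in> sets borel"
  shows "emeasure \<mu> A = (\<integral>\<^sup>+y. ennreal (indicator footprint y * area_factor \<gamma> y) * indicator A (lift y) \<partial>lborel)"
  using nn_integral_\<mu>[of "indicator A"] by simp

text \<open>Lifted points have height zero, so the graph measure is carried by the frontier inside
  its chart.\<close>

lemma emeasure_\<mu>_Int: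
  assumes A: "A \<in> sets borel"
  shows "emeasure \<mu> (A \<inter> (frontier \<Omega> \<inter> U)) = emeasure \<mu> A"
  using A in_frontier_iff height_lift
  by (subst (1 2) emeasure_\<mu>) (auto intro!: nn_integral_cong simp: indicator_def)

lemma emeasure_\<mu>_outside:
  assumes "A \<in> sets borel" "A \<inter> (frontier \<Omega> \<inter> U) = {}"
  shows "emeasure \<mu> A = 0"
  using emeasure_\<mu>_Int[OF assms(1)] assms(2) by simp

lemma AE_\<mu>: "AE x in \<mu>. x \<in> frontier \<Omega> \<inter> U"
proof (rule AE_I')
  have "emeasure \<mu> (- (frontier \<Omega> \<inter> U)) = 0"
    by (rule emeasure_\<mu>_outside) (use open_U in auto)
  then show "- (frontier \<Omega> \<inter> U) \<in> null_sets \<mu>"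
    by (rule null_setsI) (use open_U in simp)
qed auto

lemma \<mu>_le_surface_measure: "\<mu> \<le> surface_measure \<Omega>"
  unfolding surface_measure_def
  by (rule SUP_upper2[of "(U, k, \<gamma>)"]) (use chart in auto)

end

text \<open>The half spaces cut out by the two conormals agree, because both describe to first order the
  directions pointing into \<open>\<Omega>\<close>.\<close>

lemma chart_interior_direction:
  assumes "chart \<Omega> U k s \<gamma>" "chart \<Omega> U' k' s' \<gamma>'" "x \<in> U" "x \<in> U'" "x \<in> frontier \<Omega>"
    and v: "(\<chi> i. conormal k s \<gamma> i x) \<bullet> v < 0"
  shows "(\<chi> i. conormal k' s' \<gamma>' i x) \<bullet> v \<le> 0"
proof (rule ccontr)
  interpret A: chart \<Omega> U k s \<gamma> by fact
  interpret B: chart \<Omega> U' k' s' \<gamma>' by fact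
  assume "\<not> ?thesis"
  then have v': "B.nvec x \<bullet> v > 0" by simp
  have p: "((\<lambda>t. x + t *\<^sub>R v) has_vector_derivative v) (at 0)"
    by (auto intro!: derivative_eq_intros simp: has_vector_derivative_def)
  \<comment> \<open>Along \<open>v\<close> the first height would increase from zero and the second
    decrease, so nearby points would be both inside and outside \<open>\<Omega>\<close>.\<close>
  have dA: "((\<lambda>t. A.height (x + t *\<^sub>R v)) has_real_derivative - (A.nvec x \<bullet> v)) (at 0)"
    using C1_on_directional[OF A.C1_on_height open_UNIV _ p]
    by (simp add: A.partial_height inner_vec_def sum_negf mult.commute)
  have dB: "((\<lambda>t. B.height (x + t *\<^sub>R v)) has_real_derivative - (B.nvec x \<bullet> v)) (at 0)"
    using C1_on_directional[OF B.C1_on_height open_UNIV _ p]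
    by (simp add: B.partial_height inner_vec_def sum_negf mult.commute)
  have h0: "A.height x = 0" "B.height x = 0"
    using A.in_frontier_iff B.in_frontier_iff assms by auto
  obtain d1 where d1: "d1 > 0" "\<And>h. 0 < h \<Longrightarrow> h < d1 \<Longrightarrow> A.height (x + h *\<^sub>R v) > 0"
    using DERIV_pos_inc_right[OF dA] v h0 by auto
  obtain d2 where d2: "d2 > 0" "\<And>h. 0 < h \<Longrightarrow> h < d2 \<Longrightarrow> B.height (x + h *\<^sub>R v) < 0"
    using DERIV_neg_dec_right[OF dB] v' h0 by auto
  have "((\<lambda>t. x + t *\<^sub>R v) \<longlongrightarrow> x + 0 *\<^sub>R v) (at_right 0)"
    by (intro tendsto_intros)
  then have "\<forall>\<^sub>F t in at_right 0. x + t *\<^sub>R v \<in> U \<inter> U'"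
    using topological_tendstoD[of _ _ _ "U \<inter> U'"] A.open_U B.open_U assms by (auto simp: open_Int)
  moreover have "\<forall>\<^sub>F t in at_right (0::real). t < min d1 d2" "\<forall>\<^sub>F t in at_right (0::real). 0 < t"
    unfolding eventually_at_right_field using d1(1) d2(1)
    by (intro exI[of _ "min d1 d2"], simp) (intro exI[of _ 1], simp)
  ultimately have "\<forall>\<^sub>F t in at_right (0::real). False"
  proof eventually_elim
    case (elim t)
    then have "x + t *\<^sub>R v \<in> \<Omega>" using A.\<Omega>_iff d1(2)[of t] by auto
    then show ?case using B.\<Omega>_iff[of "x + t *\<^sub>R v"] d2(2)[of t] elim by auto
  qed
  then show False by simp
qed

text \<open>Tilting a vector orthogonal to \<open>a\<close> slightly towards \<open>- a\<close>
  shows that \<open>b\<close> is orthogonal to it as well. So \<open>b\<close> is a multiple of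
  \<open>a\<close>, and testing with \<open>- a\<close> fixes the sign of the factor.\<close>

lemma sgn_eq_of_half_spaces:
  fixes a b :: "'a::real_inner"
  assumes ab: "\<And>v. a \<bullet> v < 0 \<Longrightarrow> b \<bullet> v \<le> 0" and nz: "a \<noteq> 0" "b \<noteq> 0"
  shows "sgn a = sgn b"
proof -
  have le: "b \<bullet> v \<le> 0" if "a \<bullet> v = 0" for v
  proof (rule ccontr)
    assume "\<not> b \<bullet> v \<le> 0"
    then have bv: "b \<bullet> v > 0" by simp
    \<comment> \<open>Chosen so that the tilt changes the product with \<open>b\<close> by at most
      half of \<open>b \<bullet> v\<close>; the added 1 avoids division by zero.\<close>
    define e where "e = b \<bullet> v / (2 * (\<bar>b \<bullet> a\<bar> + 1))"
    have e: "e > 0" using bv by (simp add: e_def)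
    have "a \<bullet> (v - e *\<^sub>R a) < 0" using that e nz by (simp add: inner_diff_right)
    from ab[OF this] have "b \<bullet> v \<le> e * (b \<bullet> a)" by (simp add: inner_diff_right)
    also have "\<dots> \<le> e * (\<bar>b \<bullet> a\<bar> + 1)" using e by (intro mult_left_mono) auto
    also have "\<dots> = b \<bullet> v / 2" by (simp add: e_def field_simps)
    finally show False using bv by simp
  qed
  have eq: "b \<bullet> v = 0" if "a \<bullet> v = 0" for v
    using le[of v] le[of "- v"] that by auto
  define c where "c = (b \<bullet> a) / (a \<bullet> a)"
  define v where "v = b - c *\<^sub>R a"
  have av: "a \<bullet> v = 0" using nz by (simp add: v_def c_def inner_diff_right inner_commute)
  have "v \<bullet> v = b \<bullet> v - c * (a \<bullet> v)" by (simp add: v_def inner_diff_left)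
  then have "v = 0" using av eq[OF av] by simp
  then have b: "b = c *\<^sub>R a" by (simp add: v_def)
  have "a \<bullet> (- a) < 0" using nz by simp
  from ab[OF this] have "c \<ge> 0" by (simp add: c_def)
  then have "c > 0" using b nz by (cases "c = 0") auto
  then show ?thesis unfolding b by (simp add: sgn_scaleR)
qed

lemma (in chart) nvec_nz: "nvec x \<noteq> 0"
  using norm_nvec[of x] area_pos[of x] by auto

lemma (in chart) outward_normal_eq:
  assumes "x \<in> U" "x \<in> frontier \<Omega>"
  shows "outward_normal \<Omega> x = sgn (nvec x)"
  unfolding outward_normal_def
proof (rule the_equality)
  show "\<exists>U k s \<gamma>. boundary_chart \<Omega> U k s \<gamma> \<and> x \<in> U \<and> x \<in> frontier \<Omega> \<and>
      sgn (nvec x) = (s / area_factor \<gamma> x) *\<^sub>R ((\<chi> i. partial i \<gamma> x) - axis k 1)"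
    using chart assms sgn_nvec by blast
next
  fix \<nu>
  assume "\<exists>U k s \<gamma>. boundary_chart \<Omega> U k s \<gamma> \<and> x \<in> U \<and> x \<in> frontier \<Omega> \<and>
      \<nu> = (s / area_factor \<gamma> x) *\<^sub>R ((\<chi> i. partial i \<gamma> x) - axis k 1)"
  then obtain U' k' s' \<gamma>' where c: "boundary_chart \<Omega> U' k' s' \<gamma>'" "x \<in> U'"
      "\<nu> = (s' / area_factor \<gamma>' x) *\<^sub>R ((\<chi> i. partial i \<gamma>' x) - axis k' 1)"
    by blast
  interpret B: chart \<Omega> U' k' s' \<gamma>' by standard (rule c)
  have "sgn (nvec x) = sgn (B.nvec x)"
    by (rule sgn_eq_of_half_spaces[OF chart_interior_direction[OF chart_axioms B.chart_axioms assms(1) c(2) assms(2)]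
        nvec_nz B.nvec_nz])
  then show "\<nu> = sgn (nvec x)" using c(3) B.sgn_nvec by simp
qed

lemma regular_boundaryE:
  assumes "x \<in> regular_boundary \<Omega>"
  obtains U k s \<gamma> where "chart \<Omega> U k s \<gamma>" "x \<in> U" "x \<in> frontier \<Omega>"
  using assms that chart.intro unfolding regular_boundary_def by blast

lemma (in chart) regular_boundaryI: "x \<in> U \<Longrightarrow> x \<in> frontier \<Omega> \<Longrightarrow> x \<in> regular_boundary \<Omega>"
  using chart unfolding regular_boundary_def by blast

text \<open>The regular points are those of the frontier in the union of all chart domains, which is
  open.\<close>

lemma closed_singular: "closed (frontier \<Omega> - regular_boundary \<Omega>)"
proof -
  define D where "D = \<Union>{U. \<exists>k s \<gamma>. boundary_chart \<Omega> U k s \<gamma>}"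
  have "frontier \<Omega> - regular_boundary \<Omega> = frontier \<Omega> - D"
    unfolding regular_boundary_def D_def by blast
  moreover have "open D" unfolding D_def boundary_chart_def by (rule open_Union) auto
  ultimately show ?thesis by (simp add: closed_Diff)
qed

lemma regular_boundary_borel [measurable]: "regular_boundary \<Omega> \<in> sets borel"
proof -
  have "regular_boundary \<Omega> = frontier \<Omega> - (frontier \<Omega> - regular_boundary \<Omega>)"
    unfolding regular_boundary_def by blast
  moreover have "frontier \<Omega> - (frontier \<Omega> - regular_boundary \<Omega>) \<in> sets borel"
    by (intro sets.Diff borel_closed closed_singular frontier_closed)
  ultimately show ?thesis by simp
qed

lemma continuous_on_outward_normal: "continuous_on (regular_boundary \<Omega>) (outward_normal \<Omega>)"
  unfolding continuous_on_eq_continuous_within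
proof
  fix x assume xR: "x \<in> regular_boundary \<Omega>"
  then obtain U k s \<gamma> where c: "chart \<Omega> U k s \<gamma>" and x: "x \<in> U" "x \<in> frontier \<Omega>"
    by (rule regular_boundaryE)
  interpret chart \<Omega> U k s \<gamma> by fact
  have "continuous_on UNIV nvec"
    by (intro continuous_on_vec_lambda continuous_on_N)
  then have "continuous_on UNIV (\<lambda>x. sgn (nvec x))"
    by (intro continuous_on_sgn) (auto simp: nvec_nz)
  then have "((\<lambda>y. sgn (nvec y)) \<longlongrightarrow> sgn (nvec x)) (at x within regular_boundary \<Omega>)"
    using bspec[OF iffD1[OF continuous_on_def continuous_on_subset[OF _ subset_UNIV]] xR] by blast
  moreover have "\<forall>\<^sub>F y in at x within regular_boundary \<Omega>. sgn (nvec y) = outward_normal \<Omega> y"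
    unfolding eventually_at_topological
  proof (intro exI[of _ U] conjI ballI impI)
    fix y assume "y \<in> U" "y \<in> regular_boundary \<Omega>"
    then show "sgn (nvec y) = outward_normal \<Omega> y"
      using outward_normal_eq[of y] by (simp add: regular_boundary_def)
  qed (use open_U x in auto)
  ultimately have "(outward_normal \<Omega> \<longlongrightarrow> sgn (nvec x)) (at x within regular_boundary \<Omega>)"
    by (rule Lim_transform_eventually)
  then show "continuous (at x within regular_boundary \<Omega>) (outward_normal \<Omega>)"
    unfolding continuous_within outward_normal_eq[OF x] .
qed

lemma borel_measurable_outward_normal [measurable]: "outward_normal \<Omega> \<in> borel_measurable borel"
proof -
  \<comment> \<open>Off the regular boundary the description of the normal is unsatisfiable, so
    \<open>THE\<close> returns one and the same default. The normal is therefore continuous on a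
    Borel set and constant off it.\<close>
  define c where "c = (THE \<nu>::real ^ 'a. False)"
  have "outward_normal \<Omega> x = c" if "x \<notin> regular_boundary \<Omega>" for x
  proof -
    have "\<not> (\<exists>U k s \<gamma>. boundary_chart \<Omega> U k s \<gamma> \<and> x \<in> U \<and> x \<in> frontier \<Omega> \<and>
        \<nu> = (s / area_factor \<gamma> x) *\<^sub>R ((\<chi> i. partial i \<gamma> x) - axis k 1))" for \<nu>
      using that unfolding regular_boundary_def by blast
    then show ?thesis unfolding outward_normal_def c_def by (simp only: not_False_eq_True)
  qed
  moreover define f where "f x = indicator (regular_boundary \<Omega>) x *\<^sub>R outward_normal \<Omega> x" for x
  ultimately have eq: "outward_normal \<Omega> = (\<lambda>x. f x + indicator (- regular_boundary \<Omega>) x *\<^sub>R c)"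
    by (auto simp: fun_eq_iff indicator_def)
  have [measurable]: "f \<in> borel_measurable borel"
    unfolding f_def by (rule borel_measurable_continuous_on_indicator[OF _ continuous_on_outward_normal]) simp
  show ?thesis
    unfolding eq by measurable
qed

lemma norm_outward_normal: "x \<in> regular_boundary \<Omega> \<Longrightarrow> norm (outward_normal \<Omega> x) = 1"
  by (erule regular_boundaryE) (simp add: chart.outward_normal_eq chart.nvec_nz norm_sgn)

text \<open>The area density of the graph measure cancels the normalisation of the normal. This
  links the parameter integral of the chart theorem to the geometric flux.\<close>

lemma (in chart) integral_conormal_graph_measure:
  assumes f [measurable]: "f \<in> borel_measurable borel" "\<And>i. g i \<in> borel_measurable borel"
  shows "(LINT y|lborel. indicator footprint y * (f (lift y) * (\<Sum>i\<in>UNIV. g i (lift y) * N i y)))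
      = (LINT x|\<mu>. f x * (\<Sum>i\<in>UNIV. g i x * outward_normal \<Omega> x $ i))"
proof -
  have "(LINT x|\<mu>. f x * (\<Sum>i\<in>UNIV. g i x * outward_normal \<Omega> x $ i)) =
    (LINT y|lborel. indicator footprint y * area_factor \<gamma> y *
      (f (lift y) * (\<Sum>i\<in>UNIV. g i (lift y) * outward_normal \<Omega> (lift y) $ i)))"
    by (rule integral_\<mu>) measurable
  also have "\<dots> = (LINT y|lborel. indicator footprint y * (f (lift y) * (\<Sum>i\<in>UNIV. g i (lift y) * N i y)))"
  proof (rule Bochner_Integration.integral_cong[OF refl])
    fix y
    show "indicator footprint y * area_factor \<gamma> y *
      (f (lift y) * (\<Sum>i\<in>UNIV. g i (lift y) * outward_normal \<Omega> (lift y) $ i)) =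
      indicator footprint y * (f (lift y) * (\<Sum>i\<in>UNIV. g i (lift y) * N i y))"
    proof (cases "lift y \<in> U")
      case True
      then have "outward_normal \<Omega> (lift y) = sgn (nvec (lift y))"
        using outward_normal_eq in_frontier_iff height_lift by simp
      then have "outward_normal \<Omega> (lift y) $ i = N i y / area_factor \<gamma> y" for i
        by (simp add: sgn_div_norm norm_nvec N_lift area_lift divide_inverse)
      then have "area_factor \<gamma> y * (\<Sum>i\<in>UNIV. g i (lift y) * outward_normal \<Omega> (lift y) $ i) = (\<Sum>i\<in>UNIV. g i (lift y) * N i y)"
        using area_pos[of y] by (simp add: sum_distrib_left)
      then show ?thesis by (simp add: mult.left_commute mult.assoc)
    qed simp
  qed
  finally show ?thesis by simp
qed

section \<open>The surface measure\<close>

text \<open>These test functions turn equality of integrals into equality of measures on open sets.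
  A countable family of balls covers \<open>T\<close> by the Lindelof property.\<close>

lemma open_exhaustion_by_bumps:
  fixes T :: "(real ^ 'n::finite) set"
  assumes "open T"
  obtains \<phi> :: "nat \<Rightarrow> real ^ 'n \<Rightarrow> real" and K where
    "\<And>m. C1_on UNIV (\<phi> m)" "\<And>m. compact (K m)" "\<And>m. K m \<subseteq> T" "\<And>m x. x \<notin> K m \<Longrightarrow> \<phi> m x = 0"
    "\<And>m x. 0 \<le> \<phi> m x" "\<And>m x. \<phi> m x \<le> 1" "\<And>x. (\<lambda>m. \<phi> m x) \<longlonglongrightarrow> indicator T x"
proof (cases "T = {}")
  case True
  show thesis
    by (rule that[of "\<lambda>_ _. 0" "\<lambda>_. {}"]) (use True in \<open>simp_all add: C1_on_const\<close>)
next
  case False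
  have "\<exists>r>0. cball x (2 * r) \<subseteq> T" if x: "x \<in> T" for x
  proof -
    obtain e where e: "e > 0" "cball x e \<subseteq> T" using assms x by (meson open_contains_cball)
    show ?thesis by (rule exI[of _ "e / 2"]) (use e in simp)
  qed
  then obtain r where r: "\<And>x. x \<in> T \<Longrightarrow> r x > 0" "\<And>x. x \<in> T \<Longrightarrow> cball x (2 * r x) \<subseteq> T"
    by metis
  define F where "F = (\<lambda>x. ball x (r x)) ` T"
  obtain F' where F': "F' \<subseteq> F" "countable F'" "\<Union>F' = \<Union>F"
    using Lindelof[of F] by (auto simp: F_def)
  have "countable F' \<and> F' \<subseteq> (\<lambda>x. ball x (r x)) ` T"
    using F' by (simp add: F_def)
  then obtain C where C: "C \<subseteq> T" "countable C" "F' = (\<lambda>x. ball x (r x)) ` C"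
    unfolding countable_subset_image by blast
  have cov: "T \<subseteq> (\<Union>x\<in>C. ball x (r x))"
  proof -
    have "T \<subseteq> \<Union>F" using r by (force simp: F_def)
    then show ?thesis using F' C by simp
  qed
  then have "C \<noteq> {}" using False by auto
  define c where "c = from_nat_into C"
  have c: "range c = C" unfolding c_def using \<open>C \<noteq> {}\<close> C(2) by (rule range_from_nat_into)
  then have cO: "c j \<in> T" for j using C by blast
  \<comment> \<open>The complementary product keeps the values in [0, 1], and equals zero as soon as
    one ball of the list contains \<open>x\<close>.\<close>
  define \<phi> where "\<phi> m x = 1 - (\<Prod>j<m. 1 - bump (c j) (r (c j)) x)" for m x
  define K where "K m = (\<Union>j<m. cball (c j) (2 * r (c j)))" for m :: nat
  have b: "0 \<le> 1 - bump (c j) (r (c j)) x" "1 - bump (c j) (r (c j)) x \<le> 1" for j x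
    using bump_bounds by simp_all
  show thesis
  proof (rule that[of \<phi> K])
    show "C1_on UNIV (\<phi> m)" for m
      unfolding \<phi>_def[abs_def]
      by (intro C1_on_diff C1_on_const C1_on_prod C1_on_bump open_UNIV) auto
    show "compact (K m)" for m unfolding K_def by (intro compact_UN) auto
    show "K m \<subseteq> T" for m unfolding K_def using r(2)[OF cO] by blast
    show K0: "\<phi> m x = 0" if "x \<notin> K m" for m x
    proof -
      have "bump (c j) (r (c j)) x = 0" if "j < m" for j
        by (rule bump_0[OF r(1)[OF cO]]) (use \<open>x \<notin> K m\<close> that in \<open>force simp: K_def\<close>)
      then show ?thesis unfolding \<phi>_def by simp
    qed
    show "0 \<le> \<phi> m x" for m x
      unfolding \<phi>_def using prod_le_1[of "{..<m}" "\<lambda>j. 1 - bump (c j) (r (c j)) x"] b by simp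
    show "\<phi> m x \<le> 1" for m x
      unfolding \<phi>_def using prod_nonneg[of "{..<m}" "\<lambda>j. 1 - bump (c j) (r (c j)) x"] b by simp
    show "(\<lambda>m. \<phi> m x) \<longlonglongrightarrow> indicator T x" for x
    proof (cases "x \<in> T")
      case True
      then obtain j where j: "x \<in> ball (c j) (r (c j))" using cov c by blast
      have "\<forall>\<^sub>F m in sequentially. \<phi> m x = 1"
        unfolding eventually_sequentially
      proof (intro exI allI impI)
        fix m assume "Suc j \<le> m"
        moreover have "1 - bump (c j) (r (c j)) x = 0"
          using bump_1[OF r(1)[OF cO[of j]], of x] j by simp
        ultimately have "(\<Prod>j<m. 1 - bump (c j) (r (c j)) x) = 0"
          by (intro prod_zero) auto
        then show "\<phi> m x = 1" by (simp add: \<phi>_def)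
      qed
      then show ?thesis using True by (simp add: tendsto_eventually)
    next
      case False
      then have "\<phi> m x = 0" for m using K0 r(2)[OF cO] unfolding K_def by blast
      then show ?thesis using False by simp
    qed
  qed
qed

lemma sets_surface_measure [simp, measurable_cong]: "sets (surface_measure \<Omega>) = sets borel"
proof -
  have "boundary_chart \<Omega> {} undefined 1 (\<lambda>_. 0)"
    unfolding boundary_chart_def by (simp add: C1_on_const)
  then show ?thesis
    unfolding surface_measure_def
    by (intro sets_SUP) (auto simp: graph_measure_def)
qed

text \<open>A chart measure lies below the supremum and is carried by the frontier, so finite area
  passes to it.\<close>

lemma (in chart) \<mu>_UNIV_finite:
  assumes "emeasure (surface_measure \<Omega>) (frontier \<Omega>) < \<infinity>"
  shows "finite_measure \<mu>"
proof -
  have "emeasure \<mu> UNIV = emeasure \<mu> (UNIV \<inter> (frontier \<Omega> \<inter> U))"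
    by (rule emeasure_\<mu>_Int[symmetric]) simp
  also have "\<dots> \<le> emeasure \<mu> (frontier \<Omega>)" by (rule emeasure_mono) auto
  also have "\<dots> \<le> emeasure (surface_measure \<Omega>) (frontier \<Omega>)"
    using \<mu>_le_surface_measure by (subst (asm) le_measure) auto
  finally have "emeasure \<mu> UNIV \<noteq> \<infinity>" using assms by (auto simp: top_unique)
  then show ?thesis by (intro finite_measureI) simp
qed

text \<open>Tested against the constant field \<open>e\<^sub>k\<close>, the divergence theorem determines the measure
  \<open>\<nu>\<^sub>k ds\<close> from \<open>\<Omega>\<close> alone, and \<open>\<nu>\<^sub>k\<close> has a fixed sign in a chart over the \<open>k\<close>-th coordinate
  hyperplane. This shows that the graph measures of different charts agree.\<close>

lemma graph_measures_agree:
  fixes \<Omega> :: "(real ^ 'n::finite) set"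
  assumes op: "open \<Omega>" and bdd: "bounded \<Omega>"
    and "chart \<Omega> U k s \<gamma>" "chart \<Omega> U' k' s' \<gamma>'"
    and fin: "emeasure (surface_measure \<Omega>) (frontier \<Omega>) < \<infinity>"
    and A: "A \<in> sets borel" "A \<subseteq> U \<inter> U'"
  shows "emeasure (graph_measure U k \<gamma>) A = emeasure (graph_measure U' k' \<gamma>') A"
proof -
  interpret A: chart \<Omega> U k s \<gamma> by fact
  interpret B: chart \<Omega> U' k' s' \<gamma>' by fact
  interpret fA: finite_measure A.\<mu> by (rule A.\<mu>_UNIV_finite[OF fin])
  interpret fB: finite_measure B.\<mu> by (rule B.\<mu>_UNIV_finite[OF fin])
  define V where "V = U \<inter> U'"
  have [measurable]: "A \<in> sets borel" by (rule A(1))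
  have V: "open V" using A.open_U B.open_U by (auto simp: V_def)
  have reg: "x \<in> regular_boundary \<Omega>" if "x \<in> V" "x \<in> frontier \<Omega>" for x
    using A.regular_boundaryI that by (auto simp: V_def)
  \<comment> \<open>The component \<open>k\<close> of the normal, signed to be positive. It depends
    on the first chart only through \<open>k\<close> and \<open>s\<close>, yet equals the reciprocal
    of its area factor and hence lies in (0, 1].\<close>
  define w where "w x = indicator (V \<inter> frontier \<Omega>) x * (- s * outward_normal \<Omega> x $ k)" for x
  have [measurable]: "V \<in> sets borel" "frontier \<Omega> \<in> sets borel" using V by auto
  have [measurable]: "w \<in> borel_measurable borel"
    unfolding w_def[abs_def] by measurable
  have w_eq: "w x = 1 / area_factor \<gamma> x" if "x \<in> V" "x \<in> frontier \<Omega>" for x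
  proof -
    have "A.nvec x $ k = - s"
      by (simp add: conormal_def A.partial_k_\<gamma>)
    then have "sgn (A.nvec x) $ k = - s / area_factor \<gamma> x"
      unfolding sgn_div_norm A.norm_nvec vector_scaleR_component by (simp only:) (simp add: divide_inverse)
    moreover have "outward_normal \<Omega> x = sgn (A.nvec x)"
      by (rule A.outward_normal_eq) (use that in \<open>auto simp: V_def\<close>)
    ultimately have "outward_normal \<Omega> x $ k = - s / area_factor \<gamma> x"
      by (simp only:)
    then show ?thesis using that A.s_sq by (simp add: w_def)
  qed
  have w_pos: "w x > 0" if "x \<in> V" "x \<in> frontier \<Omega>" for x
    using w_eq[OF that] A.area_pos by simp
  have w_0: "w x = 0" if "\<not> (x \<in> V \<and> x \<in> frontier \<Omega>)" for x
    using that by (auto simp: w_def)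
  have w_b: "0 \<le> w x" "w x \<le> 1" for x
    using w_pos[of x] w_0[of x] w_eq[of x] A.area_ge_1[of x] by (cases "x \<in> V \<and> x \<in> frontier \<Omega>"; force)+
  \<comment> \<open>The constant field along axis \<open>k\<close> has zero divergence, so both
    sides come from the same integral of \<open>partial k \<phi>\<close> over
    \<open>\<Omega>\<close>.\<close>
  have test: "(LINT x|A.\<mu>. \<phi> x * w x) = (LINT x|B.\<mu>. \<phi> x * w x)"
    if \<phi>: "C1_on UNIV \<phi>" "compact K" "K \<subseteq> V" "\<And>x. x \<notin> K \<Longrightarrow> \<phi> x = 0" for \<phi> K
  proof -
    define W :: "'n \<Rightarrow> real ^ 'n \<Rightarrow> real" where "W i x = (if i = k then 1 else 0)" for i x
    have Wc: "C1_on X (W i)" "continuous_on X (W i)" and Wd: "partial i (W i) x = 0" for X i x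
      unfolding W_def by (simp_all add: C1_on_const)
    have Wm [measurable]: "W i \<in> borel_measurable borel" for i unfolding W_def by measurable
    have [measurable]: "\<phi> \<in> borel_measurable borel" by (rule C1_on_UNIV_borel_measurable[OF \<phi>(1)])
    have Wnu: "(\<Sum>i\<in>UNIV. W i x * outward_normal \<Omega> x $ i) = outward_normal \<Omega> x $ k" for x
    proof -
      have "(\<Sum>i\<in>UNIV. W i x * outward_normal \<Omega> x $ i) = (\<Sum>i\<in>UNIV. if i = k then outward_normal \<Omega> x $ i else 0)"
        by (intro sum.cong) (auto simp: W_def)
      then show ?thesis by simp
    qed
    have KU: "K \<subseteq> U" "K \<subseteq> U'" using \<phi>(3) by (auto simp: V_def)
    have d: "\<bar>\<Sum>i\<in>UNIV. partial i (W i) x\<bar> \<le> 0" for x by (simp add: Wd)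
    note a1 = A.divergence_chart[OF bdd op Wc(2) Wc(1) d \<phi>(1,2) KU(1) \<phi>(4)]
    note a2 = A.integral_conormal_graph_measure[where f = \<phi> and g = W, OF _ Wm]
    note b1 = B.divergence_chart[OF bdd op Wc(2) Wc(1) d \<phi>(1,2) KU(2) \<phi>(4)]
    note b2 = B.integral_conormal_graph_measure[where f = \<phi> and g = W, OF _ Wm]
    have eq: "(LINT x|A.\<mu>. \<phi> x * outward_normal \<Omega> x $ k) = (LINT x|B.\<mu>. \<phi> x * outward_normal \<Omega> x $ k)"
      using a1 a2 b1 b2 unfolding Wnu by simp
    have w': "\<phi> x * w x = - s * (\<phi> x * outward_normal \<Omega> x $ k)" if "x \<in> frontier \<Omega>" for x
      using \<phi>(3) \<phi>(4)[of x] that by (cases "x \<in> V") (auto simp: w_def)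
    have "(LINT x|A.\<mu>. \<phi> x * w x) = (LINT x|A.\<mu>. - s * (\<phi> x * outward_normal \<Omega> x $ k))"
      by (rule integral_cong_AE) (measurable, use A.AE_\<mu> w' in \<open>auto elim!: eventually_mono\<close>)
    moreover have "(LINT x|B.\<mu>. \<phi> x * w x) = (LINT x|B.\<mu>. - s * (\<phi> x * outward_normal \<Omega> x $ k))"
      by (rule integral_cong_AE) (measurable, use B.AE_\<mu> w' in \<open>auto elim!: eventually_mono\<close>)
    ultimately show ?thesis using eq by simp
  qed
  have opens: "emeasure (density A.\<mu> (\<lambda>x. ennreal (w x))) T = emeasure (density B.\<mu> (\<lambda>x. ennreal (w x))) T"
    if "open T" for T
  proof -
    have "open (T \<inter> V)" using that V by blast
    then obtain \<phi> K where \<phi>: "\<And>m. C1_on UNIV (\<phi> m)" "\<And>m. compact (K m)" "\<And>m. K m \<subseteq> T \<inter> V"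
      "\<And>m x. x \<notin> K m \<Longrightarrow> \<phi> m x = 0" "\<And>m x. 0 \<le> \<phi> m x" "\<And>m x. \<phi> m x \<le> 1"
      "\<And>x. (\<lambda>m. \<phi> m x) \<longlonglongrightarrow> indicator (T \<inter> V) x"
      by (rule open_exhaustion_by_bumps) (rule that)
    have [measurable]: "\<phi> m \<in> borel_measurable borel" for m by (rule C1_on_UNIV_borel_measurable[OF \<phi>(1)])
    have [measurable]: "T \<in> sets borel" using that by simp
    have [measurable]: "V \<in> sets borel" using V by simp
    have lim: "(\<lambda>m. LINT x|M. \<phi> m x * w x) \<longlonglongrightarrow> (LINT x|M. indicator (T \<inter> V) x * w x)"
      if "finite_measure M" and [measurable_cong]: "sets M = sets borel" for M
    proof (rule integral_dominated_convergence[where w = "\<lambda>_. 1"])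
      interpret finite_measure M by fact
      show "integrable M (\<lambda>_. 1::real)" by simp
      show "AE x in M. (\<lambda>m. \<phi> m x * w x) \<longlonglongrightarrow> indicator (T \<inter> V) x * w x"
        by (intro AE_I2 tendsto_mult_right \<phi>(7))
      show "AE x in M. norm (\<phi> m x * w x) \<le> 1" for m
        using mult_le_one[OF \<phi>(6) w_b] \<phi>(5) w_b by (intro AE_I2) (simp add: abs_mult)
    qed measurable
    have eq: "(LINT x|A.\<mu>. indicator (T \<inter> V) x * w x) = (LINT x|B.\<mu>. indicator (T \<inter> V) x * w x)"
    proof -
      have t: "(LINT x|A.\<mu>. \<phi> m x * w x) = (LINT x|B.\<mu>. \<phi> m x * w x)" for m
        by (rule test[OF \<phi>(1,2) _ \<phi>(4)]) (use \<phi>(3) in auto)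
      show ?thesis
        using lim[OF fA.finite_measure_axioms A.sets_\<mu>] lim[OF fB.finite_measure_axioms B.sets_\<mu>]
        unfolding t by (rule LIMSEQ_unique)
    qed
    have em: "emeasure (density M (\<lambda>x. ennreal (w x))) T = ennreal (LINT x|M. indicator (T \<inter> V) x * w x)"
      if "finite_measure M" and [measurable_cong]: "sets M = sets borel" for M
    proof -
      interpret finite_measure M by fact
      have "emeasure (density M (\<lambda>x. ennreal (w x))) T = (\<integral>\<^sup>+x. ennreal (w x) * indicator T x \<partial>M)"
        by (rule emeasure_density) measurable
      also have "\<dots> = (\<integral>\<^sup>+x. ennreal (indicator (T \<inter> V) x * w x) \<partial>M)"
        using w_0 by (intro nn_integral_cong) (auto simp: indicator_def)
      also have "\<dots> = ennreal (LINT x|M. indicator (T \<inter> V) x * w x)"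
      proof (rule nn_integral_eq_integral)
        show "integrable M (\<lambda>x. indicator (T \<inter> V) x * w x)"
          by (rule integrable_const_bound[where B = 1])
            (use w_b in \<open>auto simp: indicator_def intro!: AE_I2\<close>)
      qed (use w_b in simp)
      finally show ?thesis .
    qed
    show ?thesis
      unfolding em[OF fA.finite_measure_axioms A.sets_\<mu>] em[OF fB.finite_measure_axioms B.sets_\<mu>] eq ..
  qed
  have dens: "density A.\<mu> (\<lambda>x. ennreal (w x)) = density B.\<mu> (\<lambda>x. ennreal (w x))"
  proof (rule measure_eqI_generator_eq[where E = "Collect open" and \<Omega> = UNIV and A = "\<lambda>_. UNIV"])
    show "Int_stable (Collect open)" by (auto intro!: Int_stableI)
    show "emeasure (density A.\<mu> (\<lambda>x. ennreal (w x))) UNIV \<noteq> \<infinity>" for i :: nat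
    proof -
      have "emeasure (density A.\<mu> (\<lambda>x. ennreal (w x))) UNIV = (\<integral>\<^sup>+x. ennreal (w x) * indicator UNIV x \<partial>A.\<mu>)"
        by (rule emeasure_density) measurable
      also have "\<dots> \<le> (\<integral>\<^sup>+x. 1 \<partial>A.\<mu>)"
        using w_b by (intro nn_integral_mono) simp
      also have "\<dots> = emeasure A.\<mu> UNIV" by simp
      also have "\<dots> < \<infinity>"
        using fA.emeasure_finite[of UNIV] unfolding infinity_ennreal_def less_top .
      finally show ?thesis by simp
    qed
  qed (use opens in \<open>auto simp: borel_def\<close>)
  \<comment> \<open>Positivity of \<open>w\<close> on the frontier inside \<open>V\<close> allows
    the density to be divided out again.\<close>
  have rec: "emeasure (graph_measure X i g) A = (\<integral>\<^sup>+x. ennreal (1 / w x) * indicator A x \<partial>density (graph_measure X i g) (\<lambda>x. ennreal (w x)))"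
    if "chart \<Omega> X i t g" for X i t g
  proof -
    interpret C: chart \<Omega> X i t g by fact
    have "(\<integral>\<^sup>+x. ennreal (1 / w x) * indicator A x \<partial>density C.\<mu> (\<lambda>x. ennreal (w x)))
        = (\<integral>\<^sup>+x. ennreal (w x) * (ennreal (1 / w x) * indicator A x) \<partial>C.\<mu>)"
      by (intro nn_integral_density) measurable
    also have "\<dots> = (\<integral>\<^sup>+x. indicator A x \<partial>C.\<mu>)"
    proof (rule nn_integral_cong_AE, rule eventually_mono[OF C.AE_\<mu>])
      fix x assume x: "x \<in> frontier \<Omega> \<inter> X"
      show "ennreal (w x) * (ennreal (1 / w x) * indicator A x) = indicator A x"
      proof (cases "x \<in> A")
        case True
        then have "w x > 0" using x A w_pos by (auto simp: V_def)
        then show ?thesis using True by (simp add: ennreal_mult'[symmetric])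
      qed simp
    qed
    also have "\<dots> = emeasure C.\<mu> A" using A(1) by simp
    finally show ?thesis by simp
  qed
  show ?thesis
    unfolding rec[OF A.chart_axioms] rec[OF B.chart_axioms] dens ..
qed

section \<open>Evaluation of the supremum of chart measures\<close>

text \<open>Supplies upper bounds for a supremum of measures: with infinity on all sets leaving
  \<open>U\<close>, domination has to be checked only on subsets of \<open>U\<close>. If one set of
  a disjoint family leaves \<open>U\<close>, so does the union, and both sides of countable
  additivity are infinite.\<close>

lemma measure_infinite_outside:
  fixes M :: "'a::topological_space measure"
  assumes M: "sets M = sets borel"
  obtains \<tau> where "sets \<tau> = sets borel"
    "\<And>A. A \<in> sets borel \<Longrightarrow> emeasure \<tau> A = (if A \<subseteq> U then emeasure M A else \<infinity>)"
proof -
  define f where "f A = (if A \<subseteq> U then emeasure M A else \<infinity>)" for A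
  define \<tau> where "\<tau> = measure_of UNIV (sets borel) f"
  have sa: "sigma_algebra UNIV (sets borel :: 'a set set)"
    using sets.sigma_algebra_axioms[of "borel :: 'a measure"] by simp
  have "countably_additive (sets borel) f"
  proof (rule countably_additiveI)
    fix A :: "nat \<Rightarrow> 'a set"
    assume A: "range A \<subseteq> sets borel" "disjoint_family A" "(\<Union>i. A i) \<in> sets borel"
    show "(\<Sum>i. f (A i)) = f (\<Union>i. A i)"
    proof (cases "\<forall>i. A i \<subseteq> U")
      case True
      then have "(\<Union>i. A i) \<subseteq> U" by blast
      then show ?thesis using True A M suminf_emeasure[of A M] by (simp add: f_def)
    next
      case False
      then obtain j where j: "\<not> A j \<subseteq> U" by blast
      then have "\<not> (\<Union>i. A i) \<subseteq> U" by blast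
      moreover have "f (A j) \<le> (\<Sum>i. f (A i))"
        using sum_le_suminf[of "\<lambda>i. f (A i)" "{j}"] by simp
      ultimately show ?thesis using j by (simp add: f_def top_unique)
    qed
  qed
  moreover have "positive (sets borel) f" by (simp add: positive_def f_def)
  ultimately have "emeasure \<tau> A = f A" if "A \<in> sets borel" for A
    unfolding \<tau>_def using emeasure_measure_of_sigma[OF sa] that by blast
  moreover have "sets \<tau> = sets borel"
    unfolding \<tau>_def using sets.sigma_sets_eq[of "borel :: 'a measure"] by simp
  ultimately show thesis using that by (simp add: f_def)
qed

lemma surface_measure_le:
  assumes "sets \<tau> = sets borel"
    and "\<And>U k s \<gamma> A. chart \<Omega> U k s \<gamma> \<Longrightarrow> A \<in> sets borel \<Longrightarrow> emeasure (graph_measure U k \<gamma>) A \<le> emeasure \<tau> A"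
    and "A \<in> sets borel"
  shows "emeasure (surface_measure \<Omega>) A \<le> emeasure \<tau> A"
proof -
  have "surface_measure \<Omega> \<le> \<tau>"
    unfolding surface_measure_def
  proof (rule SUP_least)
    fix z assume "z \<in> {(U, k, \<gamma>). \<exists>s. boundary_chart \<Omega> U k s \<gamma>}"
    then obtain U k \<gamma> s where z: "z = (U, k, \<gamma>)" "boundary_chart \<Omega> U k s \<gamma>"
      by auto
    note c = chart.intro[OF z(2)]
    show "(case z of (U, k, \<gamma>) \<Rightarrow> graph_measure U k \<gamma>) \<le> \<tau>"
      unfolding z(1) prod.case
      by (subst le_measure) (use assms(1,2) c in \<open>auto simp: graph_measure_def\<close>)
  qed
  then show ?thesis
    using assms(1,3) by (subst (asm) le_measure) auto
qed

text \<open>The measure equal to \<open>\<mu>\<close> inside \<open>U\<close> and infinite elsewhere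
  dominates every chart measure: these are carried by their own domains and agree with
  \<open>\<mu>\<close> on overlaps.\<close>

lemma surface_measure_eq_graph_measure:
  fixes \<Omega> :: "(real ^ 'n::finite) set"
  assumes op: "open \<Omega>" and bdd: "bounded \<Omega>" and c: "chart \<Omega> U k s \<gamma>"
    and fin: "emeasure (surface_measure \<Omega>) (frontier \<Omega>) < \<infinity>"
    and A: "A \<in> sets borel" "A \<subseteq> U"
  shows "emeasure (surface_measure \<Omega>) A = emeasure (graph_measure U k \<gamma>) A"
proof (rule antisym)
  interpret chart \<Omega> U k s \<gamma> by fact
  obtain \<tau> where \<tau>: "sets \<tau> = sets borel"
    "\<And>A. A \<in> sets borel \<Longrightarrow> emeasure \<tau> A = (if A \<subseteq> U then emeasure \<mu> A else \<infinity>)"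
    using measure_infinite_outside[OF sets_\<mu>] by blast
  have "emeasure (surface_measure \<Omega>) A \<le> emeasure \<tau> A"
  proof (rule surface_measure_le[OF \<tau>(1) _ A(1)])
    fix U' k' s' \<gamma>' and X :: "(real ^ 'n) set" assume c': "chart \<Omega> U' k' s' \<gamma>'" and X: "X \<in> sets borel"
    interpret B: chart \<Omega> U' k' s' \<gamma>' by fact
    show "emeasure B.\<mu> X \<le> emeasure \<tau> X"
    proof (cases "X \<subseteq> U")
      case True
      have "emeasure B.\<mu> X = emeasure B.\<mu> (X \<inter> (frontier \<Omega> \<inter> U'))"
        by (rule B.emeasure_\<mu>_Int[OF X, symmetric])
      also have "\<dots> \<le> emeasure B.\<mu> (X \<inter> U')"
        using X B.open_U by (intro emeasure_mono) auto
      also have "\<dots> = emeasure \<mu> (X \<inter> U')"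
        by (rule graph_measures_agree[OF op bdd c' c fin]) (use X B.open_U True in auto)
      also have "\<dots> \<le> emeasure \<mu> X" using X by (intro emeasure_mono) auto
      finally show ?thesis using \<tau>(2)[OF X] True by simp
    qed (simp add: \<tau>(2)[OF X])
  qed
  then show "emeasure (surface_measure \<Omega>) A \<le> emeasure \<mu> A" using \<tau>(2) A by simp
  show "emeasure \<mu> A \<le> emeasure (surface_measure \<Omega>) A"
    using \<mu>_le_surface_measure A(1) by (subst (asm) le_measure) auto
qed

text \<open>Here the upper bound is zero on sets of non-regular points and infinite on all others;
  each graph measure is carried by regular points.\<close>

lemma emeasure_surface_measure_singular:
  fixes \<Omega> :: "(real ^ 'n::finite) set"
  assumes "A \<in> sets borel" "A \<inter> regular_boundary \<Omega> = {}"
  shows "emeasure (surface_measure \<Omega>) A = 0"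
proof -
  obtain \<tau> where \<tau>: "sets \<tau> = sets borel"
    "\<And>A. A \<in> sets borel \<Longrightarrow> emeasure \<tau> A = (if A \<subseteq> - regular_boundary \<Omega> then emeasure (null_measure borel) A else \<infinity>)"
    using measure_infinite_outside[of "null_measure borel"] by auto
  have "emeasure (surface_measure \<Omega>) A \<le> emeasure \<tau> A"
  proof (rule surface_measure_le[OF \<tau>(1) _ assms(1)])
    fix U k s \<gamma> and X :: "(real ^ 'n) set" assume c: "chart \<Omega> U k s \<gamma>" and X: "X \<in> sets borel"
    interpret chart \<Omega> U k s \<gamma> by fact
    show "emeasure \<mu> X \<le> emeasure \<tau> X"
    proof (cases "X \<subseteq> - regular_boundary \<Omega>")
      case True
      then have "X \<inter> (frontier \<Omega> \<inter> U) = {}" using regular_boundaryI by blast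
      then show ?thesis using emeasure_\<mu>_outside[OF X] by simp
    qed (simp add: \<tau>(2)[OF X])
  qed
  then show ?thesis using \<tau>(2)[OF assms(1)] assms(2) by (auto simp: disjoint_eq_subset_Compl)
qed

lemma AE_surface_measure: "AE x in surface_measure \<Omega>. x \<in> regular_boundary \<Omega>"
proof (rule AE_I')
  have "emeasure (surface_measure \<Omega>) (- regular_boundary \<Omega>) = 0"
    by (rule emeasure_surface_measure_singular) auto
  then show "- regular_boundary \<Omega> \<in> null_sets (surface_measure \<Omega>)"
    by (rule null_setsI) simp
qed auto

lemma finite_measure_surface_measure:
  assumes "emeasure (surface_measure \<Omega>) (frontier \<Omega>) < \<infinity>"
  shows "finite_measure (surface_measure \<Omega>)"
proof (rule finite_measureI)
  have sp: "space (surface_measure \<Omega>) = UNIV"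
    using sets_eq_imp_space_eq[OF sets_surface_measure] by simp
  have "emeasure (surface_measure \<Omega>) UNIV = emeasure (surface_measure \<Omega>) (frontier \<Omega>)"
    by (rule emeasure_eq_AE) (use AE_surface_measure in \<open>auto elim!: eventually_mono simp: regular_boundary_def\<close>)
  then show "emeasure (surface_measure \<Omega>) (space (surface_measure \<Omega>)) \<noteq> \<infinity>"
    using assms sp by simp
qed

text \<open>The two measures agree on Borel subsets of \<open>U\<close>, so they have the same
  density by the indicator of \<open>U\<close>, which \<open>f\<close> does not notice.\<close>

lemma integral_surface_measure_chart:
  fixes \<Omega> :: "(real ^ 'n::finite) set" and f :: "real ^ 'n \<Rightarrow> real"
  assumes op: "open \<Omega>" and bdd: "bounded \<Omega>" and c: "chart \<Omega> U k s \<gamma>"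
    and fin: "emeasure (surface_measure \<Omega>) (frontier \<Omega>) < \<infinity>"
    and f [measurable]: "f \<in> borel_measurable borel" "\<And>x. x \<notin> U \<Longrightarrow> f x = 0"
  shows "(LINT x|surface_measure \<Omega>. f x) = (LINT x|graph_measure U k \<gamma>. f x)"
proof -
  interpret chart \<Omega> U k s \<gamma> by fact
  have eq: "density (surface_measure \<Omega>) (indicator U) = density \<mu> (indicator U)"
  proof (rule measure_eqI)
    fix A assume "A \<in> sets (density (surface_measure \<Omega>) (indicator U))"
    then have A: "A \<in> sets borel" by simp
    have "emeasure (surface_measure \<Omega>) (U \<inter> A) = emeasure \<mu> (U \<inter> A)"
      by (rule surface_measure_eq_graph_measure[OF op bdd c fin]) (use A in auto)
    then show "emeasure (density (surface_measure \<Omega>) (indicator U)) A = emeasure (density \<mu> (indicator U)) A"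
      using A by (subst (1 2) emeasure_density) (auto simp: indicator_inter_arith[symmetric])
  qed simp
  have dn: "(LINT x|density M (indicator U). f x) = (LINT x|M. f x)"
    if [measurable_cong]: "sets M = sets borel" for M
  proof -
    have "(LINT x|density M (\<lambda>x. ennreal (indicator U x)). f x) = (LINT x|M. indicator U x *\<^sub>R f x)"
      by (rule integral_density) (auto intro!: AE_I2)
    also have "(\<lambda>x. indicator U x *\<^sub>R f x) = f" using f(2) by (auto simp: indicator_def fun_eq_iff)
    finally show ?thesis by (simp add: ennreal_indicator)
  qed
  show ?thesis
    using dn[OF sets_surface_measure[of \<Omega>]] dn[OF sets_\<mu>] eq by simp
qed

section \<open>The divergence theorem\<close>

locale divergence_field =
  fixes \<Omega> :: "(real ^ 'n::finite) set" and W :: "'n \<Rightarrow> real ^ 'n \<Rightarrow> real" and M :: real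
  assumes open_\<Omega>: "open \<Omega>" and bounded_\<Omega>: "bounded \<Omega>"
    and finite_area: "emeasure (surface_measure \<Omega>) (frontier \<Omega>) < \<infinity>"
    and W_cont: "\<And>i. continuous_on (closure \<Omega>) (W i)" and W_C1: "\<And>i. C1_on \<Omega> (W i)"
    and div_bound: "\<And>x. x \<in> \<Omega> \<Longrightarrow> \<bar>\<Sum>i\<in>UNIV. partial i (W i) x\<bar> \<le> M"
begin

abbreviation "\<sigma> \<equiv> surface_measure \<Omega>"

definition divW :: "real ^ 'n \<Rightarrow> real" where
  "divW x = (\<Sum>i\<in>UNIV. partial i (W i) x)"

text \<open>The indicator makes the boundary integrand Borel measurable.\<close>

definition flux :: "real ^ 'n \<Rightarrow> real" where
  "flux x = (\<Sum>i\<in>UNIV. indicator (closure \<Omega>) x * W i x * outward_normal \<Omega> x $ i)"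

text \<open>The integral of the divergence of \<open>\<phi>\<close> times \<open>W\<close>, expanded
  so that only the bounded sum \<open>divW\<close> occurs. Both this and the boundary functional are
  additive in \<open>\<phi>\<close>, which is what localisation exploits.\<close>

definition interior_integral :: "(real ^ 'n \<Rightarrow> real) \<Rightarrow> real" where
  "interior_integral \<phi> = (LINT x|lborel. indicator \<Omega> x * (\<phi> x * divW x + (\<Sum>i\<in>UNIV. W i x * partial i \<phi> x)))"

definition boundary_integral :: "(real ^ 'n \<Rightarrow> real) \<Rightarrow> real" where
  "boundary_integral \<phi> = (LINT x|\<sigma>. \<phi> x * flux x)"

lemma sub_closure: "\<Omega> \<subseteq> closure \<Omega>" and frontier_closure: "frontier \<Omega> \<subseteq> closure \<Omega>"
  using closure_subset by (auto simp: frontier_def)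

lemma compact_closure_\<Omega>: "compact (closure \<Omega>)"
  using bounded_\<Omega> by (simp add: compact_closure)

lemma finite_measure_\<sigma>: "finite_measure \<sigma>"
  by (rule finite_measure_surface_measure[OF finite_area])

lemma W_measurable [measurable]: "(\<lambda>x. indicator (closure \<Omega>) x * W i x) \<in> borel_measurable borel"
  using borel_measurable_continuous_on_indicator[OF _ W_cont, of i] by simp

lemma flux_measurable [measurable]: "flux \<in> borel_measurable borel"
  unfolding flux_def[abs_def] by measurable

lemma W_bound: obtains MW where "MW \<ge> 0" "\<And>i x. x \<in> closure \<Omega> \<Longrightarrow> \<bar>W i x\<bar> \<le> MW"
proof -
  have "\<exists>b. b \<ge> 0 \<and> (\<forall>x\<in>closure \<Omega>. \<bar>W i x\<bar> \<le> b)" for i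
    by (rule compact_bounded_abs[OF compact_closure_\<Omega> W_cont[of i]]) blast
  then obtain b where b: "\<And>i. b i \<ge> 0" "\<And>i x. x \<in> closure \<Omega> \<Longrightarrow> \<bar>W i x\<bar> \<le> b i" by metis
  show thesis
  proof (rule that[of "sum b UNIV"])
    show "0 \<le> sum b UNIV" using b by (simp add: sum_nonneg)
    show "\<bar>W i x\<bar> \<le> sum b UNIV" if "x \<in> closure \<Omega>" for i x
      using b(2)[OF that, of i] member_le_sum[of i UNIV b] b(1) by simp
  qed
qed

lemma flux_bound: obtains MB where "MB \<ge> 0" "\<And>x. x \<in> regular_boundary \<Omega> \<Longrightarrow> \<bar>flux x\<bar> \<le> MB"
proof -
  obtain MW where MW: "MW \<ge> 0" "\<And>i x. x \<in> closure \<Omega> \<Longrightarrow> \<bar>W i x\<bar> \<le> MW"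
    by (rule W_bound) (rule that)
  show thesis
  proof (rule that[of "\<Sum>i\<in>(UNIV::'n set). MW"])
    show "0 \<le> (\<Sum>i\<in>(UNIV::'n set). MW)" using MW by simp
    fix x assume x: "x \<in> regular_boundary \<Omega>"
    then have cl: "x \<in> closure \<Omega>" using frontier_closure by (auto simp: regular_boundary_def)
    have n: "\<bar>outward_normal \<Omega> x $ i\<bar> \<le> 1" for i
      using component_le_norm_cart[of "outward_normal \<Omega> x" i] norm_outward_normal[OF x] by simp
    show "\<bar>flux x\<bar> \<le> (\<Sum>i\<in>(UNIV::'n set). MW)"
      unfolding flux_def
    proof (rule order_trans[OF sum_abs sum_mono])
      fix i
      have "\<bar>W i x\<bar> * \<bar>outward_normal \<Omega> x $ i\<bar> \<le> MW * 1"
        by (rule mult_mono) (use MW cl n in auto)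
      then show "\<bar>indicator (closure \<Omega>) x * W i x * outward_normal \<Omega> x $ i\<bar> \<le> MW"
        using cl by (simp add: abs_mult)
    qed
  qed
qed

lemma C1_bound:
  assumes "C1_on UNIV \<phi>"
  obtains M\<phi> where "M\<phi> \<ge> 0" "\<And>x. x \<in> closure \<Omega> \<Longrightarrow> \<bar>\<phi> x\<bar> \<le> M\<phi>"
proof -
  have "continuous_on (closure \<Omega>) \<phi>"
    by (rule continuous_on_subset[OF C1_on_imp_continuous_on[OF assms open_UNIV] subset_UNIV])
  from compact_bounded_abs[OF compact_closure_\<Omega> this] show thesis
    using that by blast
qed

lemma boundary_integrable:
  assumes "C1_on UNIV \<phi>"
  shows "integrable \<sigma> (\<lambda>x. \<phi> x * flux x)"
proof -
  interpret finite_measure \<sigma> by (rule finite_measure_\<sigma>)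
  have [measurable]: "\<phi> \<in> borel_measurable borel" by (rule C1_on_UNIV_borel_measurable[OF assms])
  obtain MB where MB: "MB \<ge> 0" "\<And>x. x \<in> regular_boundary \<Omega> \<Longrightarrow> \<bar>flux x\<bar> \<le> MB"
    by (rule flux_bound) (rule that)
  obtain M\<phi> where M\<phi>: "M\<phi> \<ge> 0" "\<And>x. x \<in> closure \<Omega> \<Longrightarrow> \<bar>\<phi> x\<bar> \<le> M\<phi>"
    by (rule C1_bound[OF assms]) (rule that)
  show ?thesis
  proof (rule integrable_const_bound)
    show "AE x in \<sigma>. norm (\<phi> x * flux x) \<le> M\<phi> * MB"
    proof (rule eventually_mono[OF AE_surface_measure])
      fix x assume x: "x \<in> regular_boundary \<Omega>"
      then have "x \<in> closure \<Omega>" using frontier_closure by (auto simp: regular_boundary_def)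
      then show "norm (\<phi> x * flux x) \<le> M\<phi> * MB"
        unfolding real_norm_def abs_mult by (intro mult_mono) (use MB M\<phi> x in auto)
    qed
  qed measurable
qed

lemma interior_measurable:
  assumes "C1_on UNIV \<phi>"
  shows "(\<lambda>x. indicator \<Omega> x * (\<phi> x * divW x)) \<in> borel_measurable borel"
    and "(\<lambda>x. indicator \<Omega> x * (\<Sum>i\<in>UNIV. W i x * partial i \<phi> x)) \<in> borel_measurable borel"
proof -
  have c: "continuous_on \<Omega> \<phi>" "continuous_on \<Omega> (partial i \<phi>)" for i
    using C1_on_imp_continuous_on[OF C1_on_subset[OF assms subset_UNIV] open_\<Omega>]
      C1_on_subset[OF assms subset_UNIV[of \<Omega>]] by (auto simp: C1_on_def)
  have w: "continuous_on \<Omega> (W i)" "continuous_on \<Omega> (partial i (W i))" for i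
    using C1_on_imp_continuous_on[OF W_C1 open_\<Omega>] W_C1 by (auto simp: C1_on_def)
  have "continuous_on \<Omega> (\<lambda>x. \<phi> x * divW x)" "continuous_on \<Omega> (\<lambda>x. \<Sum>i\<in>UNIV. W i x * partial i \<phi> x)"
    unfolding divW_def by (intro continuous_intros c w)+
  then show "(\<lambda>x. indicator \<Omega> x * (\<phi> x * divW x)) \<in> borel_measurable borel"
    "(\<lambda>x. indicator \<Omega> x * (\<Sum>i\<in>UNIV. W i x * partial i \<phi> x)) \<in> borel_measurable borel"
    using borel_measurable_continuous_on_indicator[of \<Omega>] open_\<Omega> by force+
qed

lemma interior_integrable:
  assumes "C1_on UNIV \<phi>"
  shows "integrable lborel (\<lambda>x. indicator \<Omega> x * (\<phi> x * divW x))"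
    and "integrable lborel (\<lambda>x. indicator \<Omega> x * (\<Sum>i\<in>UNIV. W i x * partial i \<phi> x))"
proof -
  obtain M\<phi> where M\<phi>: "M\<phi> \<ge> 0" "\<And>x. x \<in> closure \<Omega> \<Longrightarrow> \<bar>\<phi> x\<bar> \<le> M\<phi>"
    by (rule C1_bound[OF assms]) (rule that)
  show "integrable lborel (\<lambda>x. indicator \<Omega> x * (\<phi> x * divW x))"
  proof (rule integrable_bounded_support[OF interior_measurable(1)[OF assms] bounded_\<Omega>])
    show "\<bar>indicator \<Omega> x * (\<phi> x * divW x)\<bar> \<le> M\<phi> * \<bar>M\<bar>" for x
    proof (cases "x \<in> \<Omega>")
      case True
      have "\<bar>\<phi> x\<bar> * \<bar>divW x\<bar> \<le> M\<phi> * \<bar>M\<bar>"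
        by (rule mult_mono) (use True M\<phi> sub_closure div_bound[OF True] in \<open>auto simp: divW_def\<close>)
      then show ?thesis using True by (simp add: abs_mult)
    qed (use M\<phi> in simp)
  qed simp
  have cont: "continuous_on (closure \<Omega>) (\<lambda>x. \<Sum>i\<in>UNIV. W i x * partial i \<phi> x)"
    using C1_on_subset[OF assms subset_UNIV[of "closure \<Omega>"]]
    by (intro continuous_intros W_cont) (auto simp: C1_on_def)
  obtain B where B: "B \<ge> 0" "\<And>x. x \<in> closure \<Omega> \<Longrightarrow> \<bar>\<Sum>i\<in>UNIV. W i x * partial i \<phi> x\<bar> \<le> B"
    by (rule compact_bounded_abs[OF compact_closure_\<Omega> cont]) (rule that)
  show "integrable lborel (\<lambda>x. indicator \<Omega> x * (\<Sum>i\<in>UNIV. W i x * partial i \<phi> x))"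
  proof (rule integrable_bounded_support[OF interior_measurable(2)[OF assms] bounded_\<Omega>])
    show "\<bar>indicator \<Omega> x * (\<Sum>i\<in>UNIV. W i x * partial i \<phi> x)\<bar> \<le> B" for x
      using B(1) B(2)[of x] sub_closure by (cases "x \<in> \<Omega>") auto
  qed simp
qed

lemma interior_integral_split:
  assumes "C1_on UNIV \<phi>"
  shows "interior_integral \<phi> = (LINT x|lborel. indicator \<Omega> x * (\<phi> x * divW x))
      + (LINT x|lborel. indicator \<Omega> x * (\<Sum>i\<in>UNIV. W i x * partial i \<phi> x))"
  unfolding interior_integral_def distrib_left
  by (rule Bochner_Integration.integral_add) (rule interior_integrable[OF assms])+

lemma integrals_add:
  assumes "C1_on UNIV \<phi>" "C1_on UNIV \<psi>"
  shows "interior_integral (\<lambda>x. \<phi> x + \<psi> x) = interior_integral \<phi> + interior_integral \<psi>"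
    and "boundary_integral (\<lambda>x. \<phi> x + \<psi> x) = boundary_integral \<phi> + boundary_integral \<psi>"
proof -
  have p: "partial i (\<lambda>x. \<phi> x + \<psi> x) x = partial i \<phi> x + partial i \<psi> x" for i x
    by (rule partial_add[OF open_UNIV assms UNIV_I])
  have "interior_integral \<phi> + interior_integral \<psi> =
     (LINT x|lborel. indicator \<Omega> x * (\<phi> x * divW x + (\<Sum>i\<in>UNIV. W i x * partial i \<phi> x))
       + indicator \<Omega> x * (\<psi> x * divW x + (\<Sum>i\<in>UNIV. W i x * partial i \<psi> x)))"
    unfolding interior_integral_def
    by (rule Bochner_Integration.integral_add[symmetric])
      (unfold distrib_left, (intro Bochner_Integration.integrable_add interior_integrable assms)+)
  also have "\<dots> = interior_integral (\<lambda>x. \<phi> x + \<psi> x)"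
    unfolding interior_integral_def p
    by (intro Bochner_Integration.integral_cong refl) (simp add: sum.distrib algebra_simps)
  finally show "interior_integral (\<lambda>x. \<phi> x + \<psi> x) = interior_integral \<phi> + interior_integral \<psi>" by simp
  show "boundary_integral (\<lambda>x. \<phi> x + \<psi> x) = boundary_integral \<phi> + boundary_integral \<psi>"
    unfolding boundary_integral_def distrib_right
    by (rule Bochner_Integration.integral_add) (rule boundary_integrable assms)+
qed

lemma divergence_local:
  assumes c: "chart \<Omega> U k s \<gamma>" and \<phi>: "C1_on UNIV \<phi>"
    and K: "compact K" "K \<subseteq> U" "\<And>x. x \<notin> K \<Longrightarrow> \<phi> x = 0"
  shows "interior_integral \<phi> = boundary_integral \<phi>"
proof -
  interpret chart \<Omega> U k s \<gamma> by fact
  define g where "g i x = indicator (closure \<Omega>) x * W i x" for i x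
  have [measurable]: "g i \<in> borel_measurable borel" for i unfolding g_def by measurable
  have [measurable]: "\<phi> \<in> borel_measurable borel" by (rule C1_on_UNIV_borel_measurable[OF \<phi>])
  have gm: "g i \<in> borel_measurable borel" for i by measurable
  have pm: "\<phi> \<in> borel_measurable borel" by measurable
  have "interior_integral \<phi> = (LINT y|lborel. indicator footprint y * (\<phi> (lift y) * (\<Sum>i\<in>UNIV. W i (lift y) * N i y)))"
    unfolding interior_integral_def divW_def
    by (rule divergence_chart[OF bounded_\<Omega> open_\<Omega> W_cont W_C1 div_bound \<phi> K])
  also have "\<dots> = (LINT y|lborel. indicator footprint y * (\<phi> (lift y) * (\<Sum>i\<in>UNIV. g i (lift y) * N i y)))"
  proof (rule Bochner_Integration.integral_cong[OF refl])
    fix y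
    have "lift y \<in> closure \<Omega>" if "lift y \<in> U"
      using in_frontier_iff[OF that] height_lift frontier_closure by auto
    then show "indicator footprint y * (\<phi> (lift y) * (\<Sum>i\<in>UNIV. W i (lift y) * N i y)) =
      indicator footprint y * (\<phi> (lift y) * (\<Sum>i\<in>UNIV. g i (lift y) * N i y))"
      by (cases "lift y \<in> U") (simp_all add: g_def)
  qed
  also have "\<dots> = (LINT x|\<mu>. \<phi> x * (\<Sum>i\<in>UNIV. g i x * outward_normal \<Omega> x $ i))"
    by (rule integral_conormal_graph_measure[OF pm gm])
  also have "\<dots> = (LINT x|\<sigma>. \<phi> x * (\<Sum>i\<in>UNIV. g i x * outward_normal \<Omega> x $ i))"
    by (rule integral_surface_measure_chart[OF open_\<Omega> bounded_\<Omega> c finite_area, symmetric])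
      (measurable, use K in auto)
  finally show ?thesis by (simp add: boundary_integral_def flux_def g_def)
qed

text \<open>A partition of unity built one ball at a time: \<open>\<phi>\<close> times a bump is
  supported in a chart, and the remaining part vanishes on the smaller ball, so the other balls
  suffice for it.\<close>

lemma divergence_finite_cover:
  assumes "finite J" and "\<And>c r. (c, r) \<in> J \<Longrightarrow> r > 0 \<and> (\<exists>U k s \<gamma>. chart \<Omega> U k s \<gamma> \<and> cball c (2 * r) \<subseteq> U)"
    and "C1_on UNIV \<phi>" and "\<And>x. x \<in> closure \<Omega> \<Longrightarrow> x \<notin> (\<Union>(c, r)\<in>J. cball c r) \<Longrightarrow> \<phi> x = 0"
  shows "interior_integral \<phi> = boundary_integral \<phi>"
  using assms
proof (induction J arbitrary: \<phi> rule: finite_induct)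
  case empty
  then have \<phi>0: "\<phi> x = 0" if "x \<in> closure \<Omega>" for x using that by simp
  have a: "indicator \<Omega> x * (\<phi> x * divW x + (\<Sum>i\<in>UNIV. W i x * partial i \<phi> x)) = 0" for x
  proof (cases "x \<in> \<Omega>")
    case True
    have "partial i \<phi> x = 0" for i
      by (rule partial_eq_0_open[OF open_\<Omega> True]) (rule \<phi>0, rule subsetD[OF sub_closure])
    moreover have "\<phi> x = 0" using True sub_closure \<phi>0 by blast
    ultimately show ?thesis by simp
  qed simp
  \<comment> \<open>Off the closure \<open>\<phi>\<close> is arbitrary, but the indicator in
    \<open>flux\<close> is zero.\<close>
  have b: "\<phi> x * flux x = 0" for x
    using \<phi>0[of x] by (cases "x \<in> closure \<Omega>") (simp_all add: flux_def)
  show ?case unfolding interior_integral_def boundary_integral_def a b by simp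
next
  case (insert p J)
  obtain c r where p: "p = (c, r)" by (cases p)
  obtain U k s \<gamma> where ch: "r > 0" "chart \<Omega> U k s \<gamma>" "cball c (2 * r) \<subseteq> U"
    using insert.prems(1)[of c r] p by auto
  define \<phi>1 \<phi>2 where "\<phi>1 x = \<phi> x * bump c r x" and "\<phi>2 x = \<phi> x * (1 - bump c r x)" for x
  have C1: "C1_on UNIV \<phi>1" "C1_on UNIV \<phi>2"
    unfolding \<phi>1_def[abs_def] \<phi>2_def[abs_def]
    by (intro C1_on_mult C1_on_diff C1_on_const C1_on_bump insert.prems(2) open_UNIV)+
  have "interior_integral \<phi>1 = boundary_integral \<phi>1"
  proof (rule divergence_local[OF ch(2) C1(1) compact_cball ch(3)])
    fix x assume "x \<notin> cball c (2 * r)"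
    then have "x \<notin> ball c (2 * r)" by auto
    from bump_0[OF ch(1) this] show "\<phi>1 x = 0" by (simp add: \<phi>1_def)
  qed
  moreover have "interior_integral \<phi>2 = boundary_integral \<phi>2"
  proof (rule insert.IH[OF _ C1(2)])
    show "r > 0 \<and> (\<exists>U k s \<gamma>. chart \<Omega> U k s \<gamma> \<and> cball c (2 * r) \<subseteq> U)" if "(c, r) \<in> J" for c r
      by (rule insert.prems(1)[OF insertI2[OF that]])
    fix x assume x: "x \<in> closure \<Omega>" "x \<notin> (\<Union>(c, r)\<in>J. cball c r)"
    show "\<phi>2 x = 0"
    proof (cases "x \<in> cball c r")
      case True
      from bump_1[OF ch(1) this] show ?thesis by (simp add: \<phi>2_def)
    next
      case False
      then have "\<phi> x = 0" using insert.prems(3)[OF x(1)] x(2) p by simp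
      then show ?thesis by (simp add: \<phi>2_def)
    qed
  qed
  moreover have "\<phi> = (\<lambda>x. \<phi>1 x + \<phi>2 x)"
    by (simp add: \<phi>1_def \<phi>2_def fun_eq_iff algebra_simps)
  ultimately show ?case
    using integrals_add[OF C1] by simp
qed

text \<open>Interior points are handled by the degenerate chart \<open>U = \<Omega>\<close> over a hyperplane far below \<open>\<Omega>\<close>.\<close>

lemma interior_chart: "\<exists>k s \<gamma>. chart \<Omega> \<Omega> k s \<gamma>"
proof -
  obtain B where B: "\<And>x. x \<in> \<Omega> \<Longrightarrow> norm x \<le> B"
    using bounded_\<Omega> by (auto simp: bounded_iff)
  have pos: "- B - 1 < x $ undefined" if "x \<in> \<Omega>" for x
    using B[OF that] component_le_norm_cart[of x undefined] by linarith
  have "boundary_chart \<Omega> \<Omega> undefined 1 (\<lambda>_. - (B + 1))"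
    unfolding boundary_chart_def
    using open_\<Omega> pos by (auto simp: C1_on_const add.assoc)
  then show ?thesis by (blast intro: chart.intro)
qed

text \<open>The closure of \<open>\<Omega>\<close> without \<open>G\<close> is compact, and each of
  its points lies in a chart. Radii are taken so that the doubled ball, which carries the bump,
  still fits into the chart.\<close>

lemma divergence_off_singular:
  assumes \<phi>: "C1_on UNIV \<phi>" and G: "open G" "frontier \<Omega> - regular_boundary \<Omega> \<subseteq> G" "\<And>x. x \<in> G \<Longrightarrow> \<phi> x = 0"
  shows "interior_integral \<phi> = boundary_integral \<phi>"
proof -
  define Q where "Q = closure \<Omega> - G"
  have Q: "compact Q" unfolding Q_def using compact_closure_\<Omega> G(1) by (rule compact_diff)
  have "\<exists>r>0. \<exists>U k s \<gamma>. chart \<Omega> U k s \<gamma> \<and> cball x (2 * r) \<subseteq> U" if "x \<in> Q" for x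
  proof -
    obtain U k s \<gamma> where U: "chart \<Omega> U k s \<gamma>" "x \<in> U"
    proof (cases "x \<in> \<Omega>")
      case True
      then show thesis using that interior_chart by blast
    next
      case False
      then have "x \<in> frontier \<Omega>" using \<open>x \<in> Q\<close> interior_subset by (auto simp: Q_def frontier_def)
      then have "x \<in> regular_boundary \<Omega>" using G \<open>x \<in> Q\<close> by (auto simp: Q_def)
      then show thesis by (rule regular_boundaryE) (rule that)
    qed
    then have "open U" by (blast intro: chart.open_U)
    then obtain e where e: "e > 0" "cball x e \<subseteq> U" using U(2) by (meson open_contains_cball)
    show ?thesis
      by (rule exI[of _ "e / 2"]) (use e U in auto)
  qed
  then obtain r where r: "\<And>x. x \<in> Q \<Longrightarrow> r x > 0"
    "\<And>x. x \<in> Q \<Longrightarrow> \<exists>U k s \<gamma>. chart \<Omega> U k s \<gamma> \<and> cball x (2 * r x) \<subseteq> U" by metis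
  obtain C where C: "C \<subseteq> Q" "finite C" "Q \<subseteq> (\<Union>x\<in>C. ball x (r x))"
  proof (rule compactE_image[OF Q, of Q "\<lambda>x. ball x (r x)"])
    show "Q \<subseteq> (\<Union>x\<in>Q. ball x (r x))" using r(1) by fastforce
  qed auto
  show ?thesis
  proof (rule divergence_finite_cover[of "(\<lambda>x. (x, r x)) ` C", OF _ _ \<phi>])
    show "finite ((\<lambda>x. (x, r x)) ` C)" using C by simp
    fix c \<rho> assume "(c, \<rho>) \<in> (\<lambda>x. (x, r x)) ` C"
    then have "c \<in> Q" "\<rho> = r c" using C by auto
    then show "\<rho> > 0 \<and> (\<exists>U k s \<gamma>. chart \<Omega> U k s \<gamma> \<and> cball c (2 * \<rho>) \<subseteq> U)" using r by simp
  next
    fix x assume x: "x \<in> closure \<Omega>" "x \<notin> (\<Union>(c, r)\<in>(\<lambda>x. (x, r x)) ` C. cball c r)"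
    then have "x \<notin> Q" using C(3) by fastforce
    then show "\<phi> x = 0" using x(1) G(3) by (simp add: Q_def)
  qed
qed

end

section \<open>Cutoff around the singular part of the boundary\<close>

text \<open>The given closed balls may have radius zero. Enlarging the powers of the radii by a
  geometric series makes them open and positive at small cost, after which compactness
  applies.\<close>

lemma codim1_null_finite_cover:
  fixes S :: "(real ^ 'n::finite) set"
  assumes dim: "CARD('n) \<ge> 2" and S: "compact S" "codim1_null S" and e: "e > 0"
  obtains J :: "nat set" and c r where "finite J" "\<And>j. j \<in> J \<Longrightarrow> 0 < r j" "\<And>j. j \<in> J \<Longrightarrow> r j < e"
    "S \<subseteq> (\<Union>j\<in>J. ball (c j) (r j))" "(\<Sum>j\<in>J. r j ^ (CARD('n) - 1)) < e"
    "\<And>j. j \<in> J \<Longrightarrow> ball (c j) (r j) \<inter> S \<noteq> {}"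
proof -
  define d where "d = CARD('n) - 1"
  have d: "d > 0" using dim by (simp add: d_def)
  \<comment> \<open>The enlarged powers sum to less than \<open>2 * \<eta>\<close>. The bound by
    \<open>e\<close> controls the sum, and the bound by \<open>e ^ d\<close> controls each
    radius.\<close>
  define \<eta> where "\<eta> = min e (e ^ d) / 2"
  have \<eta>: "\<eta> > 0" "2 * \<eta> \<le> e" "2 * \<eta> \<le> e ^ d" using e by (simp_all add: \<eta>_def)
  obtain c :: "nat \<Rightarrow> real ^ 'n" and r0 where r0: "\<And>j. 0 \<le> r0 j" "S \<subseteq> (\<Union>j. cball (c j) (r0 j))"
    "summable (\<lambda>j. r0 j ^ d)" "(\<Sum>j. r0 j ^ d) < \<eta>"
    using S(2)[unfolded codim1_null_def, rule_format, OF \<eta>(1)] unfolding d_def by (elim exE conjE) blast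
  define r where "r j = root d (r0 j ^ d + \<eta> * (1/2) ^ Suc j)" for j
  have r_pow: "r j ^ d = r0 j ^ d + \<eta> * (1/2) ^ Suc j" for j
    unfolding r_def using d \<eta>(1) r0(1)[of j] by (intro real_root_pow_pos2) auto
  have r_nonneg: "0 \<le> r j" for j
    unfolding r_def using d \<eta>(1) r0(1)[of j] by (intro real_root_ge_zero) auto
  have r_gt: "r0 j < r j" for j
  proof (rule power_less_imp_less_base[OF _ r_nonneg])
    show "r0 j ^ d < r j ^ d" unfolding r_pow using \<eta>(1) by simp
  qed
  have geo: "(\<lambda>j. \<eta> * (1/2) ^ Suc j) sums (\<eta> * 1)"
    by (rule sums_mult[OF power_half_series])
  have sums: "(\<lambda>j. r j ^ d) sums ((\<Sum>j. r0 j ^ d) + \<eta>)"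
    unfolding r_pow using sums_add[OF summable_sums[OF r0(3)] geo] by simp
  have small: "sum (\<lambda>j. r j ^ d) J < 2 * \<eta>" if "finite J" for J
  proof -
    have "sum (\<lambda>j. r j ^ d) J \<le> (\<Sum>j. r j ^ d)"
      by (rule sum_le_suminf[OF sums_summable[OF sums] that]) (simp add: r_nonneg)
    also have "\<dots> = (\<Sum>j. r0 j ^ d) + \<eta>" using sums by (rule sums_unique[symmetric])
    finally show ?thesis using r0(4) by simp
  qed
  have r_lt: "r j < e" for j
  proof (rule power_less_imp_less_base)
    show "r j ^ d < e ^ d" using small[of "{j}"] \<eta>(3) by simp
  qed (use e in simp)
  have cov: "S \<subseteq> (\<Union>j\<in>UNIV. ball (c j) (r j))"
  proof
    fix x assume "x \<in> S"
    then obtain j where "x \<in> cball (c j) (r0 j)" using r0(2) by blast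
    then have "x \<in> ball (c j) (r j)" using r_gt[of j] by simp
    then show "x \<in> (\<Union>j\<in>UNIV. ball (c j) (r j))" by blast
  qed
  obtain J0 where J0: "finite J0" "S \<subseteq> (\<Union>j\<in>J0. ball (c j) (r j))"
    by (rule compactE_image[OF S(1) _ cov]) auto
  \<comment> \<open>Balls missing \<open>S\<close> are discarded; otherwise small balls far from
    \<open>S\<close> could disturb the cutoff there.\<close>
  define J where "J = {j \<in> J0. ball (c j) (r j) \<inter> S \<noteq> {}}"
  show thesis
  proof (rule that[of J r c])
    show "finite J" using J0 by (simp add: J_def)
    show "0 < r j" for j using r_gt[of j] r0(1)[of j] by linarith
    show "r j < e" for j by (rule r_lt)
    show "S \<subseteq> (\<Union>j\<in>J. ball (c j) (r j))"
    proof
      fix x assume "x \<in> S"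
      then obtain j where "j \<in> J0" "x \<in> ball (c j) (r j)" using J0(2) by blast
      then have "j \<in> J" using \<open>x \<in> S\<close> unfolding J_def by blast
      then show "x \<in> (\<Union>j\<in>J. ball (c j) (r j))" using \<open>x \<in> ball (c j) (r j)\<close> by blast
    qed
    show "(\<Sum>j\<in>J. r j ^ (CARD('n) - 1)) < e"
      using small[OF \<open>finite J\<close>] \<eta>(2) by (simp add: d_def)
    show "ball (c j) (r j) \<inter> S \<noteq> {}" if "j \<in> J" for j using that by (simp add: J_def)
  qed
qed

text \<open>By the product rule, as all remaining factors are at most 1 in absolute value; overlaps
  of the supports are harmless.\<close>

lemma partial_prod_bound:
  fixes f :: "'b \<Rightarrow> real ^ 'n::finite \<Rightarrow> real"
  assumes "finite J" "\<And>j. j \<in> J \<Longrightarrow> C1_on UNIV (f j)" "\<And>j x. j \<in> J \<Longrightarrow> \<bar>f j x\<bar> \<le> 1"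
  shows "\<bar>partial i (\<lambda>x. \<Prod>j\<in>J. f j x) x\<bar> \<le> (\<Sum>j\<in>J. \<bar>partial i (f j) x\<bar>)"
  using assms
proof (induction J rule: finite_induct)
  case (insert a J)
  have C1: "C1_on UNIV (f a)" "C1_on UNIV (\<lambda>x. \<Prod>j\<in>J. f j x)"
    using insert by (auto intro!: C1_on_prod)
  have b: "\<bar>\<Prod>j\<in>J. f j x\<bar> \<le> 1"
    unfolding abs_prod using insert.prems by (intro prod_le_1) auto
  have "partial i (\<lambda>x. \<Prod>j\<in>insert a J. f j x) x =
      partial i (f a) x * (\<Prod>j\<in>J. f j x) + f a x * partial i (\<lambda>x. \<Prod>j\<in>J. f j x) x"
    using partial_mult[OF open_UNIV C1 UNIV_I] insert.hyps by simp
  also have "\<bar>\<dots>\<bar> \<le> \<bar>partial i (f a) x\<bar> * 1 + 1 * (\<Sum>j\<in>J. \<bar>partial i (f j) x\<bar>)"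
    by (rule order_trans[OF abs_triangle_ineq], unfold abs_mult, intro add_mono mult_mono)
      (use b insert in auto)
  finally show ?case using insert.hyps by simp
qed simp

text \<open>Applied to cutoffs \<open>w m\<close> that vanish near the singular set and tend to 1
  off it. Dominated convergence handles the terms with \<open>divW\<close> and \<open>flux\<close>;
  the term with the gradient of the cutoff is estimated explicitly.\<close>

theorem (in divergence_field) divergence_theorem:
  assumes dim: "CARD('n) \<ge> 2" and null: "codim1_null (frontier \<Omega> - regular_boundary \<Omega>)"
  shows "(LINT x|lborel. indicator \<Omega> x * divW x) = (LINT x|\<sigma>. flux x)"
proof -
  define S where "S = frontier \<Omega> - regular_boundary \<Omega>"
  have "S = frontier \<Omega> \<inter> (frontier \<Omega> - regular_boundary \<Omega>)" unfolding S_def by blast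
  then have S: "compact S"
    using compact_Int_closed[OF compact_frontier_bounded[OF bounded_\<Omega>] closed_singular] by simp
  define e where "e m = inverse (real (Suc m))" for m
  have e: "e m > 0" for m by (simp add: e_def)
  have e0: "e \<longlonglongrightarrow> 0" unfolding e_def by (rule LIMSEQ_inverse_real_of_nat)
  define good where "good m J c r \<longleftrightarrow> finite J \<and> (\<forall>j\<in>J. 0 < r j) \<and> (\<forall>j\<in>J. r j < e m) \<and>
      (\<forall>j\<in>J. ball (c j) (r j) \<inter> S \<noteq> {}) \<and> S \<subseteq> (\<Union>j\<in>J. ball (c j) (r j)) \<and>
      (\<Sum>j\<in>J. r j ^ (CARD('n) - 1)) < e m" for m and J :: "nat set" and c r
  have "\<exists>J c r. good m J c r" for m
  proof -
    obtain J :: "nat set" and c r where *: "finite J" "\<And>j. j \<in> J \<Longrightarrow> 0 < r j" "\<And>j. j \<in> J \<Longrightarrow> r j < e m"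
      "S \<subseteq> (\<Union>j\<in>J. ball (c j) (r j))" "(\<Sum>j\<in>J. r j ^ (CARD('n) - 1)) < e m"
      "\<And>j. j \<in> J \<Longrightarrow> ball (c j) (r j) \<inter> S \<noteq> {}"
      by (rule codim1_null_finite_cover[OF dim S null[folded S_def] e[of m]]) (rule that)
    have "good m J c r"
      unfolding good_def by (intro conjI ballI *)
    then show ?thesis by blast
  qed
  then obtain J c r where good: "\<And>m. good m (J m) (c m) (r m)" by metis
  have J: "finite (J m)" "S \<subseteq> (\<Union>j\<in>J m. ball (c m j) (r m j))" "(\<Sum>j\<in>J m. r m j ^ (CARD('n) - 1)) < e m" for m
    using good[of m] unfolding good_def by blast+
  have Jr: "0 < r m j" "r m j < e m" "ball (c m j) (r m j) \<inter> S \<noteq> {}" if "j \<in> J m" for m j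
    using good[of m] that unfolding good_def by blast+
  define w where "w m x = (\<Prod>j\<in>J m. 1 - bump (c m j) (r m j) x)" for m x
  have f1: "C1_on UNIV (\<lambda>x. 1 - bump a b x)" for a :: "real ^ 'n" and b
    by (intro C1_on_diff C1_on_const C1_on_bump open_UNIV)
  have w_C1: "C1_on UNIV (w m)" for m
    unfolding w_def[abs_def] by (intro C1_on_prod J(1) open_UNIV f1)
  have w_bounds: "0 \<le> w m x" "w m x \<le> 1" for m x
    unfolding w_def using bump_bounds by (auto intro!: prod_nonneg prod_le_1)
  have w_lim: "(\<lambda>m. w m x) \<longlonglongrightarrow> 1" if "x \<notin> S" for x
  proof -
    have "open (- S)" "x \<in> - S" using S that by (auto simp: compact_imp_closed open_Compl)
    then obtain \<delta> where \<delta>: "\<delta> > 0" "ball x \<delta> \<subseteq> - S" by (meson open_contains_ball)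
    \<comment> \<open>A point where a bump is nonzero lies within \<open>2 * r\<close> of a centre,
      which lies within \<open>r\<close> of \<open>S\<close>; hence the factor 3.\<close>
    have "\<forall>\<^sub>F m in sequentially. e m < \<delta> / 3"
      using order_tendstoD(2)[OF e0, of "\<delta> / 3"] \<delta> by simp
    then have "\<forall>\<^sub>F m in sequentially. w m x = 1"
    proof (rule eventually_mono)
      fix m assume m: "e m < \<delta> / 3"
      have "bump (c m j) (r m j) x = 0" if j: "j \<in> J m" for j
      proof (rule bump_0[OF Jr(1)[OF j]], rule notI)
        assume x: "x \<in> ball (c m j) (2 * r m j)"
        obtain z where z: "z \<in> ball (c m j) (r m j)" "z \<in> S" using Jr(3)[OF j] by blast
        have "dist x z \<le> dist (c m j) x + dist (c m j) z" by (rule dist_triangle3)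
        then have "dist x z < \<delta>" using x z(1) Jr(2)[OF j] m by simp
        then show False using \<delta>(2) z(2) by (auto simp: subset_iff)
      qed
      then show "w m x = 1" by (simp add: w_def)
    qed
    then show ?thesis by (rule tendsto_eventually)
  qed
  have eq: "interior_integral (w m) = boundary_integral (w m)" for m
  proof (rule divergence_off_singular[OF w_C1])
    show "open (\<Union>j\<in>J m. ball (c m j) (r m j))" by (intro open_UN) simp
    show "frontier \<Omega> - regular_boundary \<Omega> \<subseteq> (\<Union>j\<in>J m. ball (c m j) (r m j))"
      using J(2) unfolding S_def .
    fix x assume "x \<in> (\<Union>j\<in>J m. ball (c m j) (r m j))"
    then obtain j where j: "j \<in> J m" "x \<in> ball (c m j) (r m j)" by blast
    then have "1 - bump (c m j) (r m j) x = 0" using bump_1[OF Jr(1)[OF j(1)], of x] by simp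
    then show "w m x = 0" unfolding w_def using J(1) j(1) by (intro prod_zero) auto
  qed
  have B: "(\<lambda>m. boundary_integral (w m)) \<longlonglongrightarrow> (LINT x|\<sigma>. flux x)"
    unfolding boundary_integral_def
  proof (rule integral_dominated_convergence[where w = "\<lambda>x. \<bar>flux x\<bar>"])
    show "integrable \<sigma> (\<lambda>x. \<bar>flux x\<bar>)"
      using boundary_integrable[OF C1_on_const[of UNIV 1]] by simp
    show "AE x in \<sigma>. (\<lambda>m. w m x * flux x) \<longlonglongrightarrow> flux x"
    proof (rule eventually_mono[OF AE_surface_measure])
      fix x assume "x \<in> regular_boundary \<Omega>"
      then have "x \<notin> S" by (simp add: S_def)
      from tendsto_mult_right[OF w_lim[OF this], of "flux x"] show "(\<lambda>m. w m x * flux x) \<longlonglongrightarrow> flux x" by simp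
    qed
    show "AE x in \<sigma>. norm (w m x * flux x) \<le> \<bar>flux x\<bar>" for m
      using w_bounds by (intro AE_I2) (simp add: abs_mult mult_left_le_one_le)
    show "flux \<in> borel_measurable \<sigma>" by measurable
    show "(\<lambda>x. w m x * flux x) \<in> borel_measurable \<sigma>" for m
      using boundary_integrable[OF w_C1] by (rule borel_measurable_integrable)
  qed
  have I1: "(\<lambda>m. LINT x|lborel. indicator \<Omega> x * (w m x * divW x)) \<longlonglongrightarrow> (LINT x|lborel. indicator \<Omega> x * divW x)"
  proof -
    have i1: "integrable lborel (\<lambda>x. indicator \<Omega> x * divW x)"
      using interior_integrable(1)[OF C1_on_const[of UNIV 1]] by simp
    show ?thesis
    proof (rule integral_dominated_convergence[where w = "\<lambda>x. \<bar>indicator \<Omega> x * divW x\<bar>"])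
      show "integrable lborel (\<lambda>x. \<bar>indicator \<Omega> x * divW x\<bar>)" using i1 by simp
      show "(\<lambda>x. indicator \<Omega> x * divW x) \<in> borel_measurable lborel" using i1 by (rule borel_measurable_integrable)
      show "(\<lambda>x. indicator \<Omega> x * (w m x * divW x)) \<in> borel_measurable lborel" for m
        using interior_integrable(1)[OF w_C1] by (rule borel_measurable_integrable)
      show "AE x in lborel. (\<lambda>m. indicator \<Omega> x * (w m x * divW x)) \<longlonglongrightarrow> indicator \<Omega> x * divW x"
      proof (rule AE_I2)
        fix x
        show "(\<lambda>m. indicator \<Omega> x * (w m x * divW x)) \<longlonglongrightarrow> indicator \<Omega> x * divW x"
        proof (cases "x \<in> \<Omega>")
          case True
          then have "x \<notin> S" using open_\<Omega> by (simp add: S_def frontier_def interior_open)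
          from tendsto_mult_left[OF tendsto_mult_right[OF w_lim[OF this], of "divW x"], of "indicator \<Omega> x"]
          show ?thesis by simp
        qed simp
      qed
      show "AE x in lborel. norm (indicator \<Omega> x * (w m x * divW x)) \<le> \<bar>indicator \<Omega> x * divW x\<bar>" for m
        using w_bounds by (intro AE_I2) (simp add: abs_mult mult_left_mono mult_left_le_one_le)
    qed
  qed
  obtain MW where MW: "MW \<ge> 0" "\<And>i x. x \<in> closure \<Omega> \<Longrightarrow> \<bar>W i x\<bar> \<le> MW"
    by (rule W_bound) (rule that)
  define V where "V = unit_ball_vol (real CARD('n))"
  \<comment> \<open>Collects the number of components, the bound of \<open>W\<close>, the constant 3
    of the bump derivative, and the volume of a ball of doubled radius. The remaining powers are r^n
    / r = r^(n - 1).\<close>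
  define cst where "cst = real CARD('n) * MW * 3 * 2 ^ CARD('n) * V"
  have V: "V \<ge> 0" unfolding V_def by simp
  have I2: "\<bar>LINT x|lborel. indicator \<Omega> x * (\<Sum>i\<in>UNIV. W i x * partial i (w m) x)\<bar> \<le> cst * e m" for m
  proof -
    define h where "h x = (\<Sum>j\<in>J m. real CARD('n) * MW * (3 / r m j) * indicator (cball (c m j) (2 * r m j)) x)" for x
    have hb: "has_bochner_integral lborel h (\<Sum>j\<in>J m. real CARD('n) * MW * (3 / r m j) * (V * (2 * r m j) ^ CARD('n)))"
      unfolding h_def
    proof (rule has_bochner_integral_sum)
      fix j assume j: "j \<in> J m"
      have "measure lborel (cball (c m j) (2 * r m j)) = V * (2 * r m j) ^ CARD('n)"
        using content_cball[of "2 * r m j" "c m j"] Jr(1)[OF j] by (simp add: V_def DIM_cart)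
      moreover have "has_bochner_integral lborel (indicator (cball (c m j) (2 * r m j)) :: real ^ 'n \<Rightarrow> real)
          (measure lborel (cball (c m j) (2 * r m j)))"
        using emeasure_bounded_finite[of "cball (c m j) (2 * r m j)"]
        by (intro has_bochner_integral_real_indicator) auto
      ultimately show "has_bochner_integral lborel
          (\<lambda>x. real CARD('n) * MW * (3 / r m j) * indicator (cball (c m j) (2 * r m j)) x)
          (real CARD('n) * MW * (3 / r m j) * (V * (2 * r m j) ^ CARD('n)))"
        by (intro has_bochner_integral_mult_right) simp_all
    qed
    have pw: "\<bar>partial i (w m) x\<bar> \<le> (\<Sum>j\<in>J m. 3 / r m j * indicator (cball (c m j) (2 * r m j)) x)" for i x
    proof -
      have "\<bar>partial i (w m) x\<bar> \<le> (\<Sum>j\<in>J m. \<bar>partial i (\<lambda>x. 1 - bump (c m j) (r m j) x) x\<bar>)"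
        unfolding w_def[abs_def]
      proof (rule partial_prod_bound[OF J(1) f1])
        show "\<bar>1 - bump (c m j) (r m j) x\<bar> \<le> 1" for j x
          using bump_bounds[of "c m j" "r m j" x] by simp
      qed
      also have "\<dots> \<le> (\<Sum>j\<in>J m. 3 / r m j * indicator (cball (c m j) (2 * r m j)) x)"
      proof (rule sum_mono)
        fix j assume "j \<in> J m"
        from partial_bump_bound[OF Jr(1)[OF this], of i "c m j" x]
        show "\<bar>partial i (\<lambda>x. 1 - bump (c m j) (r m j) x) x\<bar> \<le> 3 / r m j * indicator (cball (c m j) (2 * r m j)) x"
          using partial_diff[OF open_UNIV C1_on_const C1_on_bump UNIV_I, of i 1 "c m j" "r m j" x] by simp
      qed
      finally show ?thesis .
    qed
    have bd: "\<bar>indicator \<Omega> x * (\<Sum>i\<in>UNIV. W i x * partial i (w m) x)\<bar> \<le> h x" for x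
    proof (cases "x \<in> \<Omega>")
      case True
      have "\<bar>\<Sum>i\<in>UNIV. W i x * partial i (w m) x\<bar> \<le> (\<Sum>i\<in>(UNIV::'n set). MW * (\<Sum>j\<in>J m. 3 / r m j * indicator (cball (c m j) (2 * r m j)) x))"
      proof (rule order_trans[OF sum_abs sum_mono])
        fix i
        show "\<bar>W i x * partial i (w m) x\<bar> \<le> MW * (\<Sum>j\<in>J m. 3 / r m j * indicator (cball (c m j) (2 * r m j)) x)"
          unfolding abs_mult using True sub_closure MW pw by (intro mult_mono) auto
      qed
      also have "\<dots> = h x" by (simp add: h_def sum_distrib_left mult_ac)
      finally show ?thesis using True by simp
    next
      case False
      have "0 \<le> h x" unfolding h_def using MW Jr(1) by (intro sum_nonneg mult_nonneg_nonneg) (auto simp: less_imp_le)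
      then show ?thesis using False by simp
    qed
    have "\<bar>LINT x|lborel. indicator \<Omega> x * (\<Sum>i\<in>UNIV. W i x * partial i (w m) x)\<bar> \<le> (LINT x|lborel. h x)"
    proof (rule order_trans[OF integral_abs_bound integral_mono])
      show "integrable lborel (\<lambda>x. \<bar>indicator \<Omega> x * (\<Sum>i\<in>UNIV. W i x * partial i (w m) x)\<bar>)"
        using interior_integrable(2)[OF w_C1] by simp
      show "integrable lborel h" using hb by (simp add: has_bochner_integral_iff)
    qed (rule bd)
    also have "\<dots> = (\<Sum>j\<in>J m. real CARD('n) * MW * (3 / r m j) * (V * (2 * r m j) ^ CARD('n)))"
      using hb by (simp add: has_bochner_integral_iff)
    also have "\<dots> = (\<Sum>j\<in>J m. cst * r m j ^ (CARD('n) - 1))"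
    proof (rule sum.cong[OF refl])
      fix j assume j: "j \<in> J m"
      have "r m j ^ CARD('n) = r m j * r m j ^ (CARD('n) - 1)"
        using dim by (subst power_Suc[symmetric]) simp
      then show "real CARD('n) * MW * (3 / r m j) * (V * (2 * r m j) ^ CARD('n)) = cst * r m j ^ (CARD('n) - 1)"
        using Jr(1)[OF j] by (simp add: cst_def power_mult_distrib)
    qed
    also have "\<dots> = cst * (\<Sum>j\<in>J m. r m j ^ (CARD('n) - 1))" by (simp add: sum_distrib_left)
    also have "\<dots> \<le> cst * e m"
      using J(3)[of m] MW V by (intro mult_left_mono) (auto simp: cst_def)
    finally show ?thesis .
  qed
  have "(\<lambda>m. LINT x|lborel. indicator \<Omega> x * (\<Sum>i\<in>UNIV. W i x * partial i (w m) x)) \<longlonglongrightarrow> 0"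
  proof (rule Lim_null_comparison)
    show "\<forall>\<^sub>F m in sequentially. norm (LINT x|lborel. indicator \<Omega> x * (\<Sum>i\<in>UNIV. W i x * partial i (w m) x)) \<le> cst * e m"
      unfolding real_norm_def by (rule always_eventually, rule allI, rule I2)
    show "(\<lambda>m. cst * e m) \<longlonglongrightarrow> 0" by (rule tendsto_mult_right_zero[OF e0])
  qed
  from tendsto_add[OF I1 this] have "(\<lambda>m. interior_integral (w m)) \<longlonglongrightarrow> (LINT x|lborel. indicator \<Omega> x * divW x)"
    unfolding interior_integral_split[OF w_C1] by simp
  then show ?thesis
    using B unfolding eq by (rule LIMSEQ_unique)
qed

section \<open>Gradients of functions vanishing on the boundary\<close>

text \<open>Every point of the closure of an open set is a limit point of it, so the limit in
  \<open>partial_ext\<close> is unique and any continuous extension computes it.\<close>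

lemma partial_ext_eq:
  fixes \<Omega> :: "(real ^ 'n::finite) set"
  assumes op: "open \<Omega>" and g: "continuous_on (closure \<Omega>) g" "\<And>x. x \<in> \<Omega> \<Longrightarrow> g x = partial i f x"
    and x: "x \<in> closure \<Omega>"
  shows "partial_ext \<Omega> i f x = g x"
proof -
  have "x islimpt \<Omega>"
  proof (cases "x \<in> \<Omega>")
    case True
    then show ?thesis using op by (intro interior_limit_point) (simp add: interior_open)
  next
    case False
    then show ?thesis using x by (simp add: closure_def)
  qed
  then have nt: "at x within \<Omega> \<noteq> bot"
    by (simp add: trivial_limit_within)
  have "(g \<longlongrightarrow> g x) (at x within \<Omega>)"
    using g(1) x closure_subset unfolding continuous_on_def by (blast intro: tendsto_within_subset)
  moreover have "\<forall>\<^sub>F y in at x within \<Omega>. g y = partial i f y"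
    unfolding eventually_at_topological using g(2) by blast
  ultimately have "(partial i f \<longlongrightarrow> g x) (at x within \<Omega>)"
    by (rule Lim_transform_eventually)
  then show ?thesis
    unfolding partial_ext_def by (rule tendsto_Lim[OF nt])
qed

lemma C1_on_cong_open:
  assumes "open S" "C1_on S f" "\<And>x. x \<in> S \<Longrightarrow> g x = f x"
  shows "C1_on S g"
proof (rule C1_onI)
  show "((\<lambda>t. g (x + t *\<^sub>R axis i 1)) has_real_derivative partial i f x) (at 0)" if "x \<in> S" for i x
    by (rule C1_on_open_cong_partial[OF assms(1) that assms(3) C1_on_has_partial[OF assms(2) that]])
  show "continuous_on S (partial i f)" for i using assms(2) by (simp add: C1_on_def)
qed

text \<open>The mean value theorem is applied along the boundary curve shifted into \<open>\<Omega>\<close> by \<open>\<epsilon>\<close>.\<close>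

lemma (in chart) tangential_derivative_zero:
  assumes f: "C1_on \<Omega> f" "continuous_on (closure \<Omega>) f" and op: "open \<Omega>"
    and g: "\<And>i. continuous_on (closure \<Omega>) (g i)" "\<And>i x. x \<in> \<Omega> \<Longrightarrow> g i x = partial i f x"
    and f0: "\<And>x. x \<in> frontier \<Omega> \<Longrightarrow> f x = 0"
    and x: "x \<in> U" "x \<in> frontier \<Omega>" and m: "m \<noteq> k"
  shows "g m x + partial m \<gamma> x * g k x = 0"
proof -
  \<comment> \<open>The derivative of \<open>f\<close> along the tangent vector of the graph that
    projects to axis \<open>m\<close>.\<close>
  define D where "D y = g m y + partial m \<gamma> y * g k y" for y
  have Dc: "continuous_on (closure \<Omega>) D"
    unfolding D_def by (intro continuous_intros g continuous_on_partial_\<gamma>)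
  have xcl: "x \<in> closure \<Omega>" using x by (simp add: frontier_def)
  have hx: "height x = 0" using in_frontier_iff x by simp
  \<comment> \<open>A curve of constant height \<open>\<epsilon>\<close>: on the boundary for
    \<open>\<epsilon> = 0\<close>, and, within \<open>U\<close>, inside \<open>\<Omega>\<close> for
    positive \<open>\<epsilon>\<close>, where \<open>f\<close> is differentiable.\<close>
  define p where "p \<epsilon> t = lift (x + t *\<^sub>R axis m 1) + (s * \<epsilon>) *\<^sub>R axis k 1" for \<epsilon> t
  have p_alt: "p \<epsilon> t = x + t *\<^sub>R axis m 1 + (\<gamma> (x + t *\<^sub>R axis m 1) - x $ k + s * \<epsilon>) *\<^sub>R axis k 1" for \<epsilon> t
    using m by (simp add: p_def lift_graph_alt axis_def algebra_simps)
  have p0: "p 0 0 = x" by (simp add: p_def lift_eq[OF hx])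
  have height_p: "height (p \<epsilon> t) = \<epsilon>" for \<epsilon> t
    unfolding p_def height_shift height_lift by (simp add: mult.assoc[symmetric] s_sq)
  have pd: "(p \<epsilon> has_vector_derivative (axis m 1 + partial m \<gamma> (p \<epsilon> t) *\<^sub>R axis k 1)) (at t)" for \<epsilon> t
  proof -
    have eq: "partial m \<gamma> (p \<epsilon> t) = partial m \<gamma> (x + t *\<^sub>R axis m 1)"
      unfolding p_def partial_\<gamma>_shift partial_\<gamma>_lift ..
    have d0: "((\<lambda>t. \<gamma> (x + t *\<^sub>R axis m 1) - x $ k + s * \<epsilon>) has_real_derivative
        partial m \<gamma> (x + t *\<^sub>R axis m 1)) (at t)"
      by (rule DERIV_cong[OF DERIV_add[OF DERIV_diff[OF C1_on_has_partial_at[OF C1_\<gamma> UNIV_I] DERIV_const] DERIV_const]]) simp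
    have d': "((\<lambda>t. (\<gamma> (x + t *\<^sub>R axis m 1) - x $ k + s * \<epsilon>) *\<^sub>R (axis k 1 :: real ^ 'n)) has_vector_derivative
        (partial m \<gamma> (x + t *\<^sub>R axis m 1)) *\<^sub>R axis k 1) (at t)"
      using has_vector_derivative_scaleR[OF d0 has_vector_derivative_const[of "axis k 1"]] by simp
    have d1: "((\<lambda>t. x + t *\<^sub>R axis m 1) has_vector_derivative axis m 1) (at t)"
      by (auto intro!: derivative_eq_intros simp: has_vector_derivative_def)
    show ?thesis
      unfolding eq unfolding p_alt[abs_def] by (rule has_vector_derivative_add[OF d1 d'])
  qed
  have small: "\<bar>D x\<bar> \<le> e" if e: "e > 0" for e
  proof -
    obtain \<delta> where \<delta>: "\<delta> > 0" "\<And>y. y \<in> closure \<Omega> \<Longrightarrow> dist y x < \<delta> \<Longrightarrow> \<bar>D y - D x\<bar> < e"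
      using Dc xcl e unfolding continuous_on_iff dist_real_def by blast
    obtain \<rho> where \<rho>: "\<rho> > 0" "ball x \<rho> \<subseteq> U" using open_U x(1) by (meson open_contains_ball)
    \<comment> \<open>Half is reserved for moving along the curve and half for the shift into
      \<open>\<Omega>\<close>.\<close>
    define a where "a = min \<delta> \<rho> / 2"
    have a: "a > 0" "a + a \<le> \<delta>" "a + a \<le> \<rho>" using \<delta>(1) \<rho>(1) by (auto simp: a_def)
    have "isCont (p 0) 0"
      using has_vector_derivative_continuous[OF pd] by blast
    then obtain d where d: "d > 0" "\<And>t. dist t 0 < d \<Longrightarrow> dist (p 0 t) (p 0 0) < a"
      using a(1) unfolding continuous_at_eps_delta by blast
    define T where "T = d / 2"
    have T: "0 < T" using d(1) by (simp add: T_def)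
    have near: "dist (p \<epsilon> t) x < a + a" if "0 \<le> t" "t \<le> T" "0 \<le> \<epsilon>" "\<epsilon> < a" for t \<epsilon>
    proof -
      have "p \<epsilon> t = p 0 t + (s * \<epsilon>) *\<^sub>R axis k 1" by (simp add: p_def)
      then have "dist (p \<epsilon> t) (p 0 t) = \<epsilon>" using that by (simp add: dist_norm abs_mult abs_s)
      moreover have "dist (p 0 t) x < a" using d(2)[of t] that d(1) p0 by (simp add: T_def)
      ultimately show ?thesis using dist_triangle[of "p \<epsilon> t" x "p 0 t"] that by linarith
    qed
    have inU: "p \<epsilon> t \<in> U" if "0 \<le> t" "t \<le> T" "0 \<le> \<epsilon>" "\<epsilon> < a" for t \<epsilon>
      using near[OF that] \<rho>(2) a(3) by (auto simp: dist_commute subset_iff)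
    have in\<Omega>: "p \<epsilon> t \<in> \<Omega>" if "0 \<le> t" "t \<le> T" "0 < \<epsilon>" "\<epsilon> < a" for t \<epsilon>
      using \<Omega>_iff[OF inU] that height_p by simp
    have est: "\<bar>f (p \<epsilon> T) - f (p \<epsilon> 0) - T * D x\<bar> \<le> T * e" if \<epsilon>: "0 < \<epsilon>" "\<epsilon> < a" for \<epsilon>
    proof -
      have "((\<lambda>t. f (p \<epsilon> t)) has_real_derivative D (p \<epsilon> t)) (at t)" if t: "0 \<le> t" "t \<le> T" for t
      proof -
        have i: "p \<epsilon> t \<in> \<Omega>" by (rule in\<Omega>[OF t \<epsilon>])
        have "(\<Sum>i\<in>UNIV. (axis m 1 + partial m \<gamma> (p \<epsilon> t) *\<^sub>R axis k 1) $ i * partial i f (p \<epsilon> t))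
          = (\<Sum>i\<in>UNIV. (if i = m then partial i f (p \<epsilon> t) else 0)) +
            (\<Sum>i\<in>UNIV. (if i = k then partial m \<gamma> (p \<epsilon> t) * partial i f (p \<epsilon> t) else 0))"
          unfolding sum.distrib[symmetric] by (intro sum.cong refl) (auto simp: axis_def algebra_simps)
        also have "\<dots> = D (p \<epsilon> t)" using g(2)[OF i] by (simp add: D_def)
        finally show ?thesis using C1_on_directional[OF f(1) op i pd] by simp
      qed
      from MVT2[OF T this] obtain z where z: "0 < z" "z < T" "f (p \<epsilon> T) - f (p \<epsilon> 0) = (T - 0) * D (p \<epsilon> z)"
        by blast
      have "dist (p \<epsilon> z) x < \<delta>" using near[of z \<epsilon>] z \<epsilon> a(2) by simp
      moreover have "p \<epsilon> z \<in> closure \<Omega>" using in\<Omega>[of z \<epsilon>] z \<epsilon> closure_subset by auto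
      ultimately have "\<bar>D (p \<epsilon> z) - D x\<bar> \<le> e" using \<delta>(2) by fastforce
      then have "T * \<bar>D (p \<epsilon> z) - D x\<bar> \<le> T * e" using T by (intro mult_left_mono) auto
      moreover have "f (p \<epsilon> T) - f (p \<epsilon> 0) - T * D x = T * (D (p \<epsilon> z) - D x)"
        using z(3) by (simp add: algebra_simps)
      ultimately show ?thesis using T by (simp add: abs_mult)
    qed
    define \<epsilon> where "\<epsilon> n = a / 2 * inverse (real (Suc n))" for n
    have \<epsilon>: "0 < \<epsilon> n" "\<epsilon> n < a" for n
    proof -
      have "inverse (real (Suc n)) \<le> 1" by (simp add: inverse_le_1_iff)
      then have "\<epsilon> n \<le> a / 2" unfolding \<epsilon>_def using a(1) by (intro mult_left_le) auto
      then show "\<epsilon> n < a" using a(1) by linarith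
      show "0 < \<epsilon> n" using a(1) by (simp add: \<epsilon>_def)
    qed
    have \<epsilon>0: "\<epsilon> \<longlonglongrightarrow> 0"
      unfolding \<epsilon>_def by (rule tendsto_mult_right_zero[OF LIMSEQ_inverse_real_of_nat])
    have flim: "(\<lambda>n. f (p (\<epsilon> n) t)) \<longlonglongrightarrow> 0" if t: "0 \<le> t" "t \<le> T" for t
    proof -
      have "(\<lambda>n. p (\<epsilon> n) t) \<longlonglongrightarrow> lift (x + t *\<^sub>R axis m 1) + (s * 0) *\<^sub>R axis k 1"
        unfolding p_def by (intro tendsto_intros \<epsilon>0)
      then have lim: "(\<lambda>n. p (\<epsilon> n) t) \<longlonglongrightarrow> p 0 t" by (simp add: p_def)
      have fr: "p 0 t \<in> frontier \<Omega>"
        using in_frontier_iff[OF inU[OF t]] height_p a(1) by simp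
      then have "p 0 t \<in> closure \<Omega>" by (simp add: frontier_def)
      from continuous_on_tendsto_compose[OF f(2) lim this] show ?thesis
        using in\<Omega>[OF t \<epsilon>] closure_subset[of \<Omega>] f0[OF fr] by (auto simp: always_eventually subset_iff)
    qed
    \<comment> \<open>As the height tends to zero with \<open>T\<close> fixed, both endpoint values
      vanish and only the derivative term survives.\<close>
    have "(\<lambda>n. \<bar>f (p (\<epsilon> n) T) - f (p (\<epsilon> n) 0) - T * D x\<bar>) \<longlonglongrightarrow> \<bar>0 - 0 - T * D x\<bar>"
      using T by (intro tendsto_intros flim) auto
    then have "\<bar>0 - 0 - T * D x\<bar> \<le> T * e"
      by (rule LIMSEQ_le_const2) (use est \<epsilon> in blast)
    then show ?thesis using T by (simp add: abs_mult)
  qed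
  have "\<bar>D x\<bar> \<le> 0" by (rule field_le_epsilon) (use small in simp)
  then show ?thesis by (simp add: D_def)
qed

text \<open>The tangential equations express every component of the gradient through component
  \<open>k\<close>, in the same proportions as the conormal.\<close>

lemma gradient_normal_on_boundary:
  fixes \<Omega> :: "(real ^ 'n::finite) set"
  assumes f: "C1_on \<Omega> f" "continuous_on (closure \<Omega>) f" and op: "open \<Omega>"
    and g: "\<And>i. continuous_on (closure \<Omega>) (g i)" "\<And>i x. x \<in> \<Omega> \<Longrightarrow> g i x = partial i f x"
    and f0: "\<And>x. x \<in> frontier \<Omega> \<Longrightarrow> f x = 0"
    and x: "x \<in> regular_boundary \<Omega>"
  obtains c where "\<And>m. g m x = c * outward_normal \<Omega> x $ m"
proof -
  obtain U k s \<gamma> where "chart \<Omega> U k s \<gamma>" and xU: "x \<in> U" "x \<in> frontier \<Omega>"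
    using x by (rule regular_boundaryE)
  then interpret chart \<Omega> U k s \<gamma> by simp
  \<comment> \<open>Dictated by \<open>m = k\<close>: there the normal has the component
    \<open>- s / area_factor \<gamma> x\<close>.\<close>
  define c where "c = - s * g k x * area_factor \<gamma> x"
  have nu: "outward_normal \<Omega> x $ m = N m x / area_factor \<gamma> x" for m
    unfolding outward_normal_eq[OF xU] sgn_div_norm norm_nvec by (simp add: divide_inverse)
  show thesis
  proof (rule that[of c])
    fix m
    have "c * outward_normal \<Omega> x $ m = - s * g k x * N m x"
      unfolding nu c_def using area_pos[of x] by simp
    also have "\<dots> = - (s * s) * g k x * (partial m \<gamma> x - (if m = k then 1 else 0))"
      unfolding conormal_def by simp
    also have "\<dots> = g m x"
    proof (cases "m = k")
      case False
      from tangential_derivative_zero[OF f op g f0 xU False] show ?thesis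
        using False by (simp add: s_sq algebra_simps)
    qed (simp add: s_sq partial_k_\<gamma>)
    finally show "g m x = c * outward_normal \<Omega> x $ m" by simp
  qed
qed

section \<open>The Pohozaev identity\<close>

locale elastic_equilibrium =
  fixes \<Omega> :: "(real ^ 'n::finite) set" and u :: "real ^ 'n \<Rightarrow> real ^ 'n"
    and C :: "'n \<Rightarrow> 'n \<Rightarrow> 'n \<Rightarrow> 'n \<Rightarrow> real" and F :: "real ^ 'n \<Rightarrow> real"
  assumes open_\<Omega>: "open \<Omega>" and bounded_\<Omega>: "bounded \<Omega>"
    and C_major: "\<And>k l i j. C k l i j = C l k j i"
    and F: "C1_on UNIV F" "F 0 = 0"
    and u_C2: "\<And>i. C2_on \<Omega> (\<lambda>x. u x $ i)" and u_C1: "\<And>i. C1_closure \<Omega> (\<lambda>x. u x $ i)"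
    and system: "\<And>x i. x \<in> \<Omega> \<Longrightarrow>
      (\<Sum>j\<in>UNIV. \<Sum>k\<in>UNIV. \<Sum>l\<in>UNIV. C k l i j * partial l (partial k (\<lambda>y. u y $ j)) x)
        + partial i F (u x) = 0"
    and dirichlet: "\<And>x. x \<in> frontier \<Omega> \<Longrightarrow> u x = 0"
begin

text \<open>The gradient of \<open>u\<close> in its continuous extension, so that
  \<open>stress\<close>, \<open>energy\<close> and \<open>W\<close> make sense up to the
  boundary.\<close>

definition G :: "'n \<Rightarrow> 'n \<Rightarrow> real ^ 'n \<Rightarrow> real" where
  "G i k = partial_ext \<Omega> k (\<lambda>y. u y $ i)"

definition H :: "'n \<Rightarrow> 'n \<Rightarrow> 'n \<Rightarrow> real ^ 'n \<Rightarrow> real" where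
  "H i k m = partial m (partial k (\<lambda>y. u y $ i))"

definition stress :: "'n \<Rightarrow> 'n \<Rightarrow> real ^ 'n \<Rightarrow> real" where
  "stress i k x = (\<Sum>j\<in>UNIV. \<Sum>l\<in>UNIV. C k l i j * G j l x)"

definition energy :: "real ^ 'n \<Rightarrow> real" where
  "energy x = (\<Sum>i\<in>UNIV. \<Sum>k\<in>UNIV. G i k x * stress i k x)"

definition radial :: "'n \<Rightarrow> real ^ 'n \<Rightarrow> real" where
  "radial i x = (\<Sum>m\<in>UNIV. x $ m * G i m x)"

text \<open>Obtained by multiplying the system by \<open>x\<^sub>m u\<^sup>i\<^sub>m + (n - 2) / 2 u\<^sup>i\<close> and collecting divergences.\<close>

definition W :: "'n \<Rightarrow> real ^ 'n \<Rightarrow> real" where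
  "W k x = (\<Sum>i\<in>UNIV. radial i x * stress i k x) - x $ k * energy x / 2 + x $ k * F (u x)
     + (real CARD('n) - 2) / 2 * (\<Sum>i\<in>UNIV. u x $ i * stress i k x)"

lemma sub_closure: "\<Omega> \<subseteq> closure \<Omega>" by (rule closure_subset)

lemma G_ext: "\<exists>g. continuous_on (closure \<Omega>) g \<and> (\<forall>x\<in>\<Omega>. g x = partial k (\<lambda>y. u y $ i) x) \<and> (\<forall>x\<in>closure \<Omega>. G i k x = g x)"
proof -
  obtain g where g: "continuous_on (closure \<Omega>) g" "\<forall>x\<in>\<Omega>. g x = partial k (\<lambda>y. u y $ i) x"
    using u_C1[of i] unfolding C1_closure_def by blast
  have "G i k x = g x" if "x \<in> closure \<Omega>" for x
    unfolding G_def by (rule partial_ext_eq[OF open_\<Omega> g(1) _ that]) (use g(2) in blast)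
  then show ?thesis using g by blast
qed

lemma G_cont: "continuous_on (closure \<Omega>) (G i k)"
proof -
  obtain g where g: "continuous_on (closure \<Omega>) g" "\<forall>x\<in>closure \<Omega>. G i k x = g x"
    using G_ext[where i = i and k = k] by blast
  then show ?thesis by (metis continuous_on_cong)
qed

lemma G_eq: "x \<in> \<Omega> \<Longrightarrow> G i k x = partial k (\<lambda>y. u y $ i) x"
  using G_ext[where i = i and k = k] sub_closure by force

lemma C1_partial_u: "C1_on \<Omega> (partial k (\<lambda>y. u y $ i))" and C1_u: "C1_on \<Omega> (\<lambda>y. u y $ i)"
  using u_C2[of i] unfolding C2_on_def by blast+

lemma C1_G: "C1_on \<Omega> (G i k)"
  by (rule C1_on_cong_open[OF open_\<Omega> C1_partial_u G_eq])

lemma u_cont: "continuous_on (closure \<Omega>) (\<lambda>x. u x $ i)"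
  using u_C1[of i] unfolding C1_closure_def by blast

lemma u_cont': "continuous_on (closure \<Omega>) u"
  using continuous_on_vec_lambda[of "closure \<Omega>" "\<lambda>i x. u x $ i"] u_cont by simp

lemma stress_cont: "continuous_on (closure \<Omega>) (stress i k)"
  unfolding stress_def[abs_def] by (intro continuous_intros G_cont)

lemma energy_cont: "continuous_on (closure \<Omega>) energy"
  unfolding energy_def[abs_def] by (intro continuous_intros G_cont stress_cont)

lemma Fu_cont: "continuous_on (closure \<Omega>) (\<lambda>x. F (u x))"
  by (rule continuous_on_compose2[OF C1_on_imp_continuous_on[OF F(1) open_UNIV] u_cont']) simp

lemma fu_cont: "continuous_on (closure \<Omega>) (\<lambda>x. partial i F (u x))"
  by (rule continuous_on_compose2[OF _ u_cont', of UNIV]) (use F(1) in \<open>simp_all add: C1_on_def\<close>)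

lemma W_cont: "continuous_on (closure \<Omega>) (W k)"
  unfolding W_def[abs_def] radial_def
  by (intro continuous_intros G_cont stress_cont energy_cont Fu_cont u_cont) simp

lemma W_C1: "C1_on \<Omega> (W k)"
proof -
  have stress: "C1_on \<Omega> (stress i k)" for i k
    unfolding stress_def[abs_def] by (intro C1_on_sum C1_on_mult C1_on_const C1_G open_\<Omega>)
  have energy: "C1_on \<Omega> (\<lambda>x. energy x / 2)"
    unfolding energy_def[abs_def] divide_inverse
    by (intro C1_on_sum C1_on_mult C1_on_const C1_G stress open_\<Omega>)
  have radial: "C1_on \<Omega> (radial i)" for i
    unfolding radial_def[abs_def] by (intro C1_on_sum C1_on_mult C1_on_component C1_G open_\<Omega>)
  have Fu: "C1_on \<Omega> (\<lambda>x. F (u x))"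
    by (rule C1_on_compose_vec[OF open_\<Omega> F(1) C1_u])
  have "C1_on \<Omega> (\<lambda>x. (\<Sum>i\<in>UNIV. radial i x * stress i k x) - x $ k * (energy x / 2) + x $ k * F (u x)
     + (real CARD('n) - 2) / 2 * (\<Sum>i\<in>UNIV. u x $ i * stress i k x))"
    by (intro C1_on_add C1_on_diff C1_on_sum C1_on_mult C1_on_const C1_on_component C1_u stress energy radial Fu open_\<Omega>)
  then show ?thesis unfolding W_def[abs_def] by simp
qed

section \<open>The divergence of the Pohozaev field\<close>

lemma H_sym: "x \<in> \<Omega> \<Longrightarrow> H i k m x = H i m k x"
  unfolding H_def by (rule C2_on_partial_commute[OF u_C2 open_\<Omega>])

text \<open>The system in divergence form. Differentiating the stress gives the second derivatives
  in the opposite order from the system, which \<open>H_sym\<close> repairs.\<close>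

lemma div_stress: "x \<in> \<Omega> \<Longrightarrow> (\<Sum>k\<in>UNIV. \<Sum>j\<in>UNIV. \<Sum>l\<in>UNIV. C k l i j * H j l k x) = - partial i F (u x)"
proof -
  assume x: "x \<in> \<Omega>"
  have "(\<Sum>k\<in>UNIV. \<Sum>j\<in>UNIV. \<Sum>l\<in>UNIV. C k l i j * H j l k x) = (\<Sum>j\<in>UNIV. \<Sum>k\<in>UNIV. \<Sum>l\<in>UNIV. C k l i j * H j l k x)"
    by (rule sum.swap)
  also have "\<dots> = (\<Sum>j\<in>UNIV. \<Sum>k\<in>UNIV. \<Sum>l\<in>UNIV. C k l i j * H j k l x)"
    using H_sym[OF x] by (intro sum.cong refl) simp
  finally show ?thesis using system[OF x, of i] unfolding H_def by linarith
qed

text \<open>The bilinear form of the moduli is symmetric under exchange of the pairs (i, k) and (j,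
  l). The right side is arranged so that its inner sum has the shape of
  \<open>stress j l\<close>.\<close>

lemma stress_symmetry:
  "(\<Sum>i\<in>UNIV. \<Sum>k\<in>UNIV. a i k * (\<Sum>j\<in>UNIV. \<Sum>l\<in>UNIV. C k l i j * b j l)) =
   (\<Sum>j\<in>UNIV. \<Sum>l\<in>UNIV. b j l * (\<Sum>i\<in>UNIV. \<Sum>k\<in>UNIV. C l k j i * a i k))"
proof -
  have el: "a i k * (C k l i j * b j l) = b j l * (C l k j i * a i k)" for i j k l
    by (subst C_major) simp
  \<comment> \<open>Index pairs are merged so that a single exchange of sums is enough.\<close>
  have "(\<Sum>i\<in>UNIV. \<Sum>k\<in>UNIV. a i k * (\<Sum>j\<in>UNIV. \<Sum>l\<in>UNIV. C k l i j * b j l)) =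
      (\<Sum>(i, k)\<in>UNIV. \<Sum>(j, l)\<in>UNIV. a i k * (C k l i j * b j l))"
    unfolding UNIV_Times_UNIV[symmetric] sum.cartesian_product[symmetric] by (simp add: sum_distrib_left)
  also have "\<dots> = (\<Sum>(j, l)\<in>UNIV. \<Sum>(i, k)\<in>UNIV. a i k * (C k l i j * b j l))"
    unfolding case_prod_unfold by (rule sum.swap)
  also have "\<dots> = (\<Sum>(j, l)\<in>UNIV. \<Sum>(i, k)\<in>UNIV. b j l * (C l k j i * a i k))"
    unfolding el ..
  also have "\<dots> = (\<Sum>j\<in>UNIV. \<Sum>l\<in>UNIV. b j l * (\<Sum>i\<in>UNIV. \<Sum>k\<in>UNIV. C l k j i * a i k))"
    unfolding UNIV_Times_UNIV[symmetric] sum.cartesian_product[symmetric] by (simp add: sum_distrib_left)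
  finally show ?thesis .
qed

lemma energy_eq:
  "energy x = (\<Sum>i\<in>UNIV. \<Sum>j\<in>UNIV. \<Sum>k\<in>UNIV. \<Sum>l\<in>UNIV. C k l i j * G i k x * G j l x)"
proof -
  have "energy x = (\<Sum>i\<in>UNIV. \<Sum>k\<in>UNIV. \<Sum>j\<in>UNIV. \<Sum>l\<in>UNIV. C k l i j * G i k x * G j l x)"
    unfolding energy_def stress_def by (simp add: sum_distrib_left mult_ac)
  also have "\<dots> = (\<Sum>i\<in>UNIV. \<Sum>j\<in>UNIV. \<Sum>k\<in>UNIV. \<Sum>l\<in>UNIV. C k l i j * G i k x * G j l x)"
    by (intro sum.cong refl sum.swap)
  finally show ?thesis .
qed

context
  fixes x assumes x: "x \<in> \<Omega>"
begin

lemma dG: "((\<lambda>t. G i k (x + t *\<^sub>R axis m 1)) has_real_derivative H i k m x) (at 0)"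
  unfolding H_def
  by (rule C1_on_open_cong_partial[OF open_\<Omega> x G_eq C1_on_has_partial[OF C1_partial_u x]])

lemma du: "((\<lambda>t. u (x + t *\<^sub>R axis m 1) $ i) has_real_derivative G i m x) (at 0)"
  using C1_on_has_partial[OF C1_u x, of m i] G_eq[OF x] by simp

lemma dcomponent: "((\<lambda>t. (x + t *\<^sub>R axis m 1) $ p) has_real_derivative (if m = p then 1 else 0)) (at 0)"
  by (auto intro!: derivative_eq_intros simp: axis_def)

lemma dstress: "((\<lambda>t. stress i k (x + t *\<^sub>R axis m 1)) has_real_derivative
    (\<Sum>j\<in>UNIV. \<Sum>l\<in>UNIV. C k l i j * H j l m x)) (at 0)"
  unfolding stress_def by (intro DERIV_sum DERIV_cmult dG)

lemma dradial: "((\<lambda>t. radial i (x + t *\<^sub>R axis m 1)) has_real_derivative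
    G i m x + (\<Sum>p\<in>UNIV. x $ p * H i p m x)) (at 0)"
proof -
  have "((\<lambda>t. radial i (x + t *\<^sub>R axis m 1)) has_real_derivative
      (\<Sum>p\<in>UNIV. (if m = p then 1 else 0) * G i p (x + 0 *\<^sub>R axis m 1) + H i p m x * (x + 0 *\<^sub>R axis m 1) $ p)) (at 0)"
    unfolding radial_def by (intro DERIV_sum DERIV_mult dG dcomponent)
  moreover have "(\<Sum>p\<in>UNIV. (if m = p then 1 else 0) * G i p (x + 0 *\<^sub>R axis m 1) + H i p m x * (x + 0 *\<^sub>R axis m 1) $ p)
      = (\<Sum>p\<in>UNIV. (if m = p then G i p x else 0)) + (\<Sum>p\<in>UNIV. x $ p * H i p m x)"
    unfolding sum.distrib[symmetric] by (intro sum.cong refl) (simp add: mult.commute)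
  ultimately show ?thesis by simp
qed

text \<open>The factor 2 is due to \<open>stress_symmetry\<close>: differentiating either gradient
  in the quadratic form gives the same result.\<close>

lemma denergy: "((\<lambda>t. energy (x + t *\<^sub>R axis m 1)) has_real_derivative
    2 * (\<Sum>i\<in>UNIV. \<Sum>k\<in>UNIV. H i k m x * stress i k x)) (at 0)"
proof -
  have "((\<lambda>t. energy (x + t *\<^sub>R axis m 1)) has_real_derivative
      (\<Sum>i\<in>UNIV. \<Sum>k\<in>UNIV. H i k m x * stress i k (x + 0 *\<^sub>R axis m 1)
        + (\<Sum>j\<in>UNIV. \<Sum>l\<in>UNIV. C k l i j * H j l m x) * G i k (x + 0 *\<^sub>R axis m 1))) (at 0)"
    unfolding energy_def by (intro DERIV_sum DERIV_mult dG dstress)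
  moreover have "(\<Sum>i\<in>UNIV. \<Sum>k\<in>UNIV. H i k m x * stress i k (x + 0 *\<^sub>R axis m 1)
        + (\<Sum>j\<in>UNIV. \<Sum>l\<in>UNIV. C k l i j * H j l m x) * G i k (x + 0 *\<^sub>R axis m 1))
    = (\<Sum>i\<in>UNIV. \<Sum>k\<in>UNIV. H i k m x * stress i k x)
      + (\<Sum>i\<in>UNIV. \<Sum>k\<in>UNIV. G i k x * (\<Sum>j\<in>UNIV. \<Sum>l\<in>UNIV. C k l i j * H j l m x))"
    by (simp add: sum.distrib mult.commute)
  moreover have "(\<Sum>i\<in>UNIV. \<Sum>k\<in>UNIV. G i k x * (\<Sum>j\<in>UNIV. \<Sum>l\<in>UNIV. C k l i j * H j l m x))
      = (\<Sum>i\<in>UNIV. \<Sum>k\<in>UNIV. H i k m x * stress i k x)"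
    unfolding stress_symmetry[of "\<lambda>i k. G i k x" "\<lambda>j l. H j l m x"] stress_def ..
  ultimately show ?thesis by simp
qed

lemma dFu: "((\<lambda>t. F (u (x + t *\<^sub>R axis m 1))) has_real_derivative
    (\<Sum>j\<in>UNIV. G j m x * partial j F (u x))) (at 0)"
  using C1_on_has_partial[OF C1_on_compose_vec[OF open_\<Omega> F(1) C1_u] x, of m]
    partial_compose_vec[OF open_\<Omega> F(1) C1_u x, of m] G_eq[OF x] by simp

lemma partial_W: "partial k (W k) x =
    (\<Sum>i\<in>UNIV. (G i k x + (\<Sum>p\<in>UNIV. x $ p * H i p k x)) * stress i k x
        + (\<Sum>j\<in>UNIV. \<Sum>l\<in>UNIV. C k l i j * H j l k x) * radial i x)
    - (energy x / 2 + x $ k * (\<Sum>i\<in>UNIV. \<Sum>m\<in>UNIV. H i m k x * stress i m x))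
    + (F (u x) + x $ k * (\<Sum>j\<in>UNIV. G j k x * partial j F (u x)))
    + (real CARD('n) - 2) / 2 * (\<Sum>i\<in>UNIV. G i k x * stress i k x
        + (\<Sum>j\<in>UNIV. \<Sum>l\<in>UNIV. C k l i j * H j l k x) * u x $ i)"
proof (rule partial_eqI)
  \<comment> \<open>The derivatives keep the literal shape produced by the product rule, with
    evaluations at \<open>x + 0 *\<^sub>R axis k 1\<close>; they are simplified once at the
    end.\<close>
  have a: "((\<lambda>t. \<Sum>i\<in>UNIV. radial i (x + t *\<^sub>R axis k 1) * stress i k (x + t *\<^sub>R axis k 1)) has_real_derivative
     (\<Sum>i\<in>UNIV. (G i k x + (\<Sum>p\<in>UNIV. x $ p * H i p k x)) * stress i k (x + 0 *\<^sub>R axis k 1)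
        + (\<Sum>j\<in>UNIV. \<Sum>l\<in>UNIV. C k l i j * H j l k x) * radial i (x + 0 *\<^sub>R axis k 1))) (at 0)"
    by (intro DERIV_sum DERIV_mult dradial dstress)
  have b: "((\<lambda>t. (x + t *\<^sub>R axis k 1) $ k * energy (x + t *\<^sub>R axis k 1) / 2) has_real_derivative
     ((if k = k then 1 else 0) * energy (x + 0 *\<^sub>R axis k 1)
        + (2 * (\<Sum>i\<in>UNIV. \<Sum>m\<in>UNIV. H i m k x * stress i m x)) * (x + 0 *\<^sub>R axis k 1) $ k) / 2) (at 0)"
    by (intro DERIV_cdivide DERIV_mult denergy dcomponent)
  have c: "((\<lambda>t. (x + t *\<^sub>R axis k 1) $ k * F (u (x + t *\<^sub>R axis k 1))) has_real_derivative
     ((if k = k then 1 else 0) * F (u (x + 0 *\<^sub>R axis k 1))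
        + (\<Sum>j\<in>UNIV. G j k x * partial j F (u x)) * (x + 0 *\<^sub>R axis k 1) $ k)) (at 0)"
    by (intro DERIV_mult dFu dcomponent)
  have d: "((\<lambda>t. \<Sum>i\<in>UNIV. u (x + t *\<^sub>R axis k 1) $ i * stress i k (x + t *\<^sub>R axis k 1)) has_real_derivative
     (\<Sum>i\<in>UNIV. G i k x * stress i k (x + 0 *\<^sub>R axis k 1)
        + (\<Sum>j\<in>UNIV. \<Sum>l\<in>UNIV. C k l i j * H j l k x) * u (x + 0 *\<^sub>R axis k 1) $ i)) (at 0)"
    by (intro DERIV_sum DERIV_mult du dstress)
  show "((\<lambda>t. W k (x + t *\<^sub>R axis k 1)) has_real_derivative
    (\<Sum>i\<in>UNIV. (G i k x + (\<Sum>p\<in>UNIV. x $ p * H i p k x)) * stress i k x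
        + (\<Sum>j\<in>UNIV. \<Sum>l\<in>UNIV. C k l i j * H j l k x) * radial i x)
    - (energy x / 2 + x $ k * (\<Sum>i\<in>UNIV. \<Sum>m\<in>UNIV. H i m k x * stress i m x))
    + (F (u x) + x $ k * (\<Sum>j\<in>UNIV. G j k x * partial j F (u x)))
    + (real CARD('n) - 2) / 2 * (\<Sum>i\<in>UNIV. G i k x * stress i k x
        + (\<Sum>j\<in>UNIV. \<Sum>l\<in>UNIV. C k l i j * H j l k x) * u x $ i)) (at 0)"
    unfolding W_def
    by (rule DERIV_cong[OF DERIV_add[OF DERIV_add[OF DERIV_diff[OF a b] c] DERIV_cmult[OF d]]])
      (simp add: add_divide_distrib mult.commute)
qed

text \<open>Three cancellations: the energy has total coefficient 1 - n / 2 + (n - 2) / 2 = 0; the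
  radial derivative of the energy comes from two terms with opposite signs; and the radial
  multiplier of the system cancels the radial derivative of F(u).\<close>

lemma div_W: "(\<Sum>k\<in>UNIV. partial k (W k) x) =
    real CARD('n) * F (u x) - (real CARD('n) - 2) / 2 * (\<Sum>i\<in>UNIV. u x $ i * partial i F (u x))"
proof -
  define n where "n = real CARD('n)"
  define f where "f i = partial i F (u x)" for i
  define dS where "dS i k = (\<Sum>j\<in>UNIV. \<Sum>l\<in>UNIV. C k l i j * H j l k x)" for i k
  define E' where "E' m = (\<Sum>i\<in>UNIV. \<Sum>k\<in>UNIV. H i k m x * stress i k x)" for m
  have dS: "(\<Sum>k\<in>UNIV. dS i k) = - f i" for i
    unfolding dS_def f_def by (rule div_stress[OF x])
  have A1: "(\<Sum>k\<in>UNIV. \<Sum>i\<in>UNIV. G i k x * stress i k x) = energy x"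
    unfolding energy_def by (rule sum.swap)
  \<comment> \<open>Symmetry of \<open>H\<close> turns the derivative of the gradient in direction
    \<open>k\<close> into the derivative in direction \<open>p\<close> that appears in
    \<open>E'\<close>.\<close>
  have A2: "(\<Sum>k\<in>UNIV. \<Sum>i\<in>UNIV. (\<Sum>p\<in>UNIV. x $ p * H i p k x) * stress i k x) = (\<Sum>p\<in>UNIV. x $ p * E' p)"
  proof -
    have "(\<Sum>k\<in>UNIV. \<Sum>i\<in>UNIV. (\<Sum>p\<in>UNIV. x $ p * H i p k x) * stress i k x)
        = (\<Sum>i\<in>UNIV. \<Sum>k\<in>UNIV. \<Sum>p\<in>UNIV. x $ p * (H i k p x * stress i k x))"
      by (subst sum.swap) (simp add: sum_distrib_right mult.assoc H_sym[OF x])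
    also have "\<dots> = (\<Sum>i\<in>UNIV. \<Sum>p\<in>UNIV. \<Sum>k\<in>UNIV. x $ p * (H i k p x * stress i k x))"
      by (intro sum.cong refl sum.swap)
    also have "\<dots> = (\<Sum>p\<in>UNIV. \<Sum>i\<in>UNIV. \<Sum>k\<in>UNIV. x $ p * (H i k p x * stress i k x))"
      by (rule sum.swap)
    also have "\<dots> = (\<Sum>p\<in>UNIV. x $ p * E' p)"
      unfolding E'_def by (simp add: sum_distrib_left)
    finally show ?thesis .
  qed
  have A3: "(\<Sum>k\<in>UNIV. \<Sum>i\<in>UNIV. dS i k * a i) = - (\<Sum>i\<in>UNIV. a i * f i)" for a
  proof -
    have "(\<Sum>k\<in>UNIV. \<Sum>i\<in>UNIV. dS i k * a i) = (\<Sum>i\<in>UNIV. (\<Sum>k\<in>UNIV. dS i k) * a i)"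
      by (subst sum.swap) (simp add: sum_distrib_right)
    then show ?thesis unfolding dS by (simp add: sum_negf mult.commute)
  qed
  have A4: "(\<Sum>k\<in>UNIV. x $ k * (\<Sum>j\<in>UNIV. G j k x * f j)) = (\<Sum>i\<in>UNIV. radial i x * f i)"
  proof -
    have "(\<Sum>k\<in>UNIV. x $ k * (\<Sum>j\<in>UNIV. G j k x * f j)) = (\<Sum>k\<in>UNIV. \<Sum>j\<in>UNIV. x $ k * G j k x * f j)"
      by (simp add: sum_distrib_left mult.assoc)
    also have "\<dots> = (\<Sum>j\<in>UNIV. \<Sum>k\<in>UNIV. x $ k * G j k x * f j)" by (rule sum.swap)
    also have "\<dots> = (\<Sum>i\<in>UNIV. radial i x * f i)" unfolding radial_def by (simp add: sum_distrib_right)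
    finally show ?thesis .
  qed
  have "(\<Sum>k\<in>UNIV. partial k (W k) x) =
     ((\<Sum>k\<in>UNIV. \<Sum>i\<in>UNIV. G i k x * stress i k x)
      + (\<Sum>k\<in>UNIV. \<Sum>i\<in>UNIV. (\<Sum>p\<in>UNIV. x $ p * H i p k x) * stress i k x)
      + (\<Sum>k\<in>UNIV. \<Sum>i\<in>UNIV. dS i k * radial i x))
     - (n * (energy x / 2) + (\<Sum>k\<in>UNIV. x $ k * E' k))
     + (n * F (u x) + (\<Sum>k\<in>UNIV. x $ k * (\<Sum>j\<in>UNIV. G j k x * f j)))
     + (n - 2) / 2 * ((\<Sum>k\<in>UNIV. \<Sum>i\<in>UNIV. G i k x * stress i k x) + (\<Sum>k\<in>UNIV. \<Sum>i\<in>UNIV. dS i k * u x $ i))"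
    unfolding partial_W dS_def[symmetric] E'_def[symmetric] f_def[symmetric] n_def
    by (simp only: distrib_right sum.distrib sum_subtractf sum_distrib_left[symmetric] sum_constant)
  also have "\<dots> = n * F (u x) - (n - 2) / 2 * (\<Sum>i\<in>UNIV. u x $ i * f i)"
    unfolding A1 A2 A3 A4 by (simp add: field_simps)
  finally show ?thesis by (simp only: n_def f_def)
qed

end

section \<open>Boundary values of the field and the identity\<close>

text \<open>With gradients proportional to the normal, the indices in the product of
  \<open>radial i\<close> and a normal component can be exchanged, giving E times (x, \<nu>). The
  term with x E / 2 takes away half of it, and \<open>u = 0\<close> with \<open>F 0 = 0\<close>
  removes the rest.\<close>

lemma boundary_identity:
  assumes "x \<in> regular_boundary \<Omega>"
  shows "(\<Sum>k\<in>UNIV. W k x * outward_normal \<Omega> x $ k) = 1 / 2 * (energy x * (x \<bullet> outward_normal \<Omega> x))"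
proof -
  define \<nu> where "\<nu> = outward_normal \<Omega> x"
  have fr: "x \<in> frontier \<Omega>" using assms by (simp add: regular_boundary_def)
  have u0: "u x = 0" by (rule dirichlet[OF fr])
  have "\<exists>c. \<forall>m. G i m x = c * \<nu> $ m" for i
  proof -
    have z: "u y $ i = 0" if "y \<in> frontier \<Omega>" for y using dirichlet[OF that] by simp
    show ?thesis
      unfolding \<nu>_def
    proof (rule gradient_normal_on_boundary[where f = "\<lambda>y. u y $ i" and g = "G i", OF C1_u u_cont open_\<Omega> G_cont G_eq z assms])
      fix c assume "\<And>m. G i m x = c * outward_normal \<Omega> x $ m"
      then show "\<exists>c. \<forall>m. G i m x = c * outward_normal \<Omega> x $ m" by (intro exI allI)
    qed
  qed
  then obtain c where c: "\<And>i m. G i m x = c i * \<nu> $ m" by metis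
  have rad: "radial i x = c i * (x \<bullet> \<nu>)" for i
    unfolding radial_def c inner_vec_def by (simp add: sum_distrib_left mult_ac)
  have "(\<Sum>k\<in>UNIV. W k x * \<nu> $ k) =
     (\<Sum>k\<in>UNIV. (\<Sum>i\<in>UNIV. radial i x * stress i k x) * \<nu> $ k) - (\<Sum>k\<in>UNIV. energy x / 2 * (x $ k * \<nu> $ k))"
    unfolding W_def u0 F(2) sum_subtractf[symmetric] by (intro sum.cong refl) (simp add: algebra_simps)
  also have "(\<Sum>k\<in>UNIV. (\<Sum>i\<in>UNIV. radial i x * stress i k x) * \<nu> $ k) = energy x * (x \<bullet> \<nu>)"
  proof -
    have "(\<Sum>k\<in>UNIV. (\<Sum>i\<in>UNIV. radial i x * stress i k x) * \<nu> $ k) =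
        (\<Sum>k\<in>UNIV. \<Sum>i\<in>UNIV. (G i k x * stress i k x) * (x \<bullet> \<nu>))"
      unfolding rad c by (simp add: sum_distrib_right sum_distrib_left mult_ac)
    also have "\<dots> = (\<Sum>i\<in>UNIV. \<Sum>k\<in>UNIV. (G i k x * stress i k x) * (x \<bullet> \<nu>))" by (rule sum.swap)
    finally show ?thesis unfolding energy_def by (simp add: sum_distrib_right)
  qed
  also have "(\<Sum>k\<in>UNIV. energy x / 2 * (x $ k * \<nu> $ k)) = energy x / 2 * (x \<bullet> \<nu>)"
    unfolding inner_vec_def by (simp add: sum_distrib_left)
  finally show ?thesis by (simp add: \<nu>_def)
qed

text \<open>By \<open>div_W\<close> the divergence involves only \<open>u\<close>, \<open>F\<close>
  and its gradient, all continuous up to the boundary.\<close>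

lemma div_W_bounded: "\<exists>M. \<forall>x\<in>\<Omega>. \<bar>\<Sum>k\<in>UNIV. partial k (W k) x\<bar> \<le> M"
proof -
  have cont: "continuous_on (closure \<Omega>)
     (\<lambda>x. real CARD('n) * F (u x) - (real CARD('n) - 2) / 2 * (\<Sum>i\<in>UNIV. u x $ i * partial i F (u x)))"
    by (intro continuous_intros Fu_cont fu_cont u_cont)
  have cpt: "compact (closure \<Omega>)" using bounded_\<Omega> by (simp add: compact_closure)
  obtain M where M: "\<And>x. x \<in> closure \<Omega> \<Longrightarrow>
      \<bar>real CARD('n) * F (u x) - (real CARD('n) - 2) / 2 * (\<Sum>i\<in>UNIV. u x $ i * partial i F (u x))\<bar> \<le> M"
    by (rule compact_bounded_abs[OF cpt cont]) (rule that)
  have "\<bar>\<Sum>k\<in>UNIV. partial k (W k) x\<bar> \<le> M" if "x \<in> \<Omega>" for x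
    unfolding div_W[OF that] by (rule M[OF subsetD[OF sub_closure that]])
  then show ?thesis by blast
qed

theorem pohozaev_identity:
  assumes dim: "CARD('n) \<ge> 2" and boundary: "piecewise_smooth_boundary \<Omega>"
  shows "(LINT x:\<Omega>|lborel. (real CARD('n) - 2) / 2 * (\<Sum>k\<in>UNIV. u x $ k * partial k F (u x))
            - real CARD('n) * F (u x))
       = - (1 / 2) * (LINT x:frontier \<Omega>|surface_measure \<Omega>. energy x * (x \<bullet> outward_normal \<Omega> x))"
proof -
  have null: "codim1_null (frontier \<Omega> - regular_boundary \<Omega>)"
    and fin: "emeasure (surface_measure \<Omega>) (frontier \<Omega>) < \<infinity>"
    using boundary by (auto simp: piecewise_smooth_boundary_def)
  obtain M where M: "\<And>x. x \<in> \<Omega> \<Longrightarrow> \<bar>\<Sum>k\<in>UNIV. partial k (W k) x\<bar> \<le> M"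
    using div_W_bounded by blast
  interpret D: divergence_field \<Omega> W M
    by standard (fact open_\<Omega> bounded_\<Omega> fin W_cont W_C1 M)+
  have "(LINT x:\<Omega>|lborel. (real CARD('n) - 2) / 2 * (\<Sum>k\<in>UNIV. u x $ k * partial k F (u x))
            - real CARD('n) * F (u x)) = (LINT x|lborel. - (indicator \<Omega> x * D.divW x))"
    unfolding set_lebesgue_integral_def D.divW_def
  proof (rule Bochner_Integration.integral_cong[OF refl])
    fix x
    show "indicator \<Omega> x *\<^sub>R ((real CARD('n) - 2) / 2 * (\<Sum>k\<in>UNIV. u x $ k * partial k F (u x))
            - real CARD('n) * F (u x)) = - (indicator \<Omega> x * (\<Sum>k\<in>UNIV. partial k (W k) x))"
      using div_W[of x] by (cases "x \<in> \<Omega>") simp_all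
  qed
  also have "\<dots> = - (LINT x|lborel. indicator \<Omega> x * D.divW x)" by (rule Bochner_Integration.integral_minus)
  also have "\<dots> = - (LINT x|surface_measure \<Omega>. D.flux x)"
    unfolding D.divergence_theorem[OF dim null] ..
  also have "(LINT x|surface_measure \<Omega>. D.flux x) =
      (LINT x|surface_measure \<Omega>. 1 / 2 * (indicator (frontier \<Omega>) x *\<^sub>R (energy x * (x \<bullet> outward_normal \<Omega> x))))"
  proof (rule integral_cong_AE)
    \<comment> \<open>The energy is controlled only on the closure of \<open>\<Omega>\<close>, so
      the integrand is measurable thanks to the indicator of the frontier.\<close>
    have "continuous_on (frontier \<Omega>) energy"
      by (rule continuous_on_subset[OF energy_cont]) (auto simp: frontier_def)
    then have [measurable]: "(\<lambda>x. indicator (frontier \<Omega>) x *\<^sub>R energy x) \<in> borel_measurable borel"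
      by (intro borel_measurable_continuous_on_indicator) auto
    have "(\<lambda>x. 1 / 2 * ((indicator (frontier \<Omega>) x *\<^sub>R energy x) * (x \<bullet> outward_normal \<Omega> x))) \<in> borel_measurable (surface_measure \<Omega>)"
      by measurable
    then show "(\<lambda>x. 1 / 2 * (indicator (frontier \<Omega>) x *\<^sub>R (energy x * (x \<bullet> outward_normal \<Omega> x)))) \<in> borel_measurable (surface_measure \<Omega>)"
      by (simp add: mult.assoc)
    show "D.flux \<in> borel_measurable (surface_measure \<Omega>)" by measurable
    show "AE x in surface_measure \<Omega>. D.flux x = 1 / 2 * (indicator (frontier \<Omega>) x *\<^sub>R (energy x * (x \<bullet> outward_normal \<Omega> x)))"
    proof (rule eventually_mono[OF AE_surface_measure])
      fix x assume x: "x \<in> regular_boundary \<Omega>"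
      then have fr: "x \<in> frontier \<Omega>" "x \<in> closure \<Omega>" by (auto simp: regular_boundary_def frontier_def)
      then have "D.flux x = (\<Sum>k\<in>UNIV. W k x * outward_normal \<Omega> x $ k)" by (simp add: D.flux_def)
      then show "D.flux x = 1 / 2 * (indicator (frontier \<Omega>) x *\<^sub>R (energy x * (x \<bullet> outward_normal \<Omega> x)))"
        using boundary_identity[OF x] fr by simp
    qed
  qed
  finally show ?thesis by (simp add: set_lebesgue_integral_def)
qed

end

theorem theorem1:
  fixes \<Omega> :: "(real ^ 'n::finite) set"
    and u :: "real ^ 'n \<Rightarrow> real ^ 'n"
    and C :: "'n \<Rightarrow> 'n \<Rightarrow> 'n \<Rightarrow> 'n \<Rightarrow> real"  \<comment> \<open>\<open>C k l i j\<close>: upper indices \<open>k l\<close>, lower indices \<open>i j\<close>\<close>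
    and F :: "real ^ 'n \<Rightarrow> real"
  assumes dim: "CARD('n) \<ge> 2"
    and domain: "open \<Omega>" "connected \<Omega>" "\<Omega> \<noteq> {}" "bounded \<Omega>"
    and boundary: "piecewise_smooth_boundary \<Omega>"
    and C_sym: "\<And>k l i j. C k l i j = C i l k j" "\<And>k l i j. C k l i j = C k j i l"
      "\<And>k l i j. C k l i j = C l k j i"
    and C_nonneg: "\<And>a :: 'n \<Rightarrow> 'n \<Rightarrow> real.
      (\<Sum>i\<in>UNIV. \<Sum>j\<in>UNIV. \<Sum>k\<in>UNIV. \<Sum>l\<in>UNIV. C k l i j * a i k * a j l) \<ge> 0"
    and F: "C1_on UNIV F" "F 0 = 0"
    and u_C2: "\<And>i. C2_on \<Omega> (\<lambda>x. u x $ i)"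
    and u_C1: "\<And>i. C1_closure \<Omega> (\<lambda>x. u x $ i)"
    and system: "\<And>x i. x \<in> \<Omega> \<Longrightarrow>
      (\<Sum>j\<in>UNIV. \<Sum>k\<in>UNIV. \<Sum>l\<in>UNIV. C k l i j * partial l (partial k (\<lambda>y. u y $ j)) x)
        + partial i F (u x) = 0"
    and dirichlet: "\<And>x. x \<in> frontier \<Omega> \<Longrightarrow> u x = 0"
  shows "(LINT x:\<Omega>|lborel. (real CARD('n) - 2) / 2 * (\<Sum>k\<in>UNIV. u x $ k * partial k F (u x))
            - real CARD('n) * F (u x))
       = - (1 / 2) * (LINT x:frontier \<Omega>|surface_measure \<Omega>.
            (\<Sum>i\<in>UNIV. \<Sum>j\<in>UNIV. \<Sum>k\<in>UNIV. \<Sum>l\<in>UNIV. C k l i j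
                * partial_ext \<Omega> k (\<lambda>y. u y $ i) x * partial_ext \<Omega> l (\<lambda>y. u y $ j) x)
            * (x \<bullet> outward_normal \<Omega> x))"
proof -
  interpret E: elastic_equilibrium \<Omega> u C F
    by standard (fact domain(1) domain(4) C_sym(3) F u_C2 u_C1 system dirichlet)+
  show ?thesis
    using E.pohozaev_identity[OF dim boundary] unfolding E.energy_eq E.G_def .
qed

end
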